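(* Let $X$ be a Banach space with the approximation property and let $m:\Sigma\to X$ be a countably additive vector measure such that the integration map $I_m:L^1(m)\to X$ is weakly compact. Then there is a net $(R^\alpha_m)_\alpha$ of finite rank Radon-Nikodým derivative operators of $m$ such that $$\lim_\alpha\|f\|_{L^1(m_\alpha)}=\|f\|_{L^1(m)}\qquad\text{for all } f\in L^1(m),$$ where $m_\alpha$ is the vector measure associated to $R^\alpha_m$, that is, $m_\alpha(A)=R^\alpha_m(\chi_A)$ for $A\in\Sigma$.
   Context: Scalars are real. $(\Omega,\Sigma)$ is a measurable space and $m:\Sigma\to X$ is a countably additive vector measure. For $x^*\in X^*$, $\langle m,x^*\rangle(A):=\langle m(A),x^*\rangle$ is a scalar measure with variation $|\langle m,x^*\rangle|$. The semivariation is $\|m\|(A)=\sup_{\|x^*\|\le 1}|\langle m,x^*\rangle|(A)$; functions that agree off a set $A$ with $\|m\|(A)=0$ are identified. A measurable $f:\Omega\to\mathbb R$ is $m$-integrable if it is integrable with respect to $\langle m,x^*\rangle$ for every $x^*\in X^*$ and for each $A\in\Sigma$ there is an element $\int_A f\,dm\in X$ with $\langle\int_A f\,dm,x^*\rangle=\int_A f\,d\langle m,x^*\rangle$ for all $x^*\in X^*$. $L^1(m)$ is the Banach lattice of ($m$-a.e. classes of) $m$-integrable functions with norm $\|f\|_{L^1(m)}=\sup_{x^*\in B_{X^*}}\int|f|\,d|\langle m,x^*\rangle|$. The integration map is $I_m:L^1(m)\to X$, $I_m(f)=\int_\Omega f\,dm$. Fix a finite positive measure $\mu$ equivalent to $m$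 (i.e. $\mu(A)=0$ iff $\|m\|(A)=0$), for example a Rybakov measure $|\langle m,x_0^*\rangle|$. For $x^*\in X^*$ let $\varphi^m_{x^*}:=\frac{d\langle m,x^*\rangle}{d\mu}$ be the Radon-Nikodým derivative; it acts as a functional on $L^1(m)$ by $\varphi^m_{x^*}(f)=\int f\varphi^m_{x^*}\,d\mu$. A finite rank Radon-Nikodým derivative operator of $m$ is an operator $R_m:L^1(m)\to X$ of the form $R_m(f)=\sum_{i=1}^n\varphi^m_{x_i^*}(f)\,x_i$ with $n\in\mathbb N$, $x_i^*\in X^*$, $x_i\in X$. *)

theory Defs
  imports "HOL-Analysis.Analysis" "HOL-Library.Disjoint_Sets"
begin

text \<open>
  Throughout, a measurable space \<open>(\<Omega>, \<Sigma>)\<close> is given as \<open>(space M, sets M)\<close> for some \<open>M\<close> of type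
  \<open>'a measure\<close>; the measure carried by \<open>M\<close> is never used. Set functions are total on \<open>'a set\<close> and
  only their values on \<open>sets M\<close> matter.
\<close>

definition vector_measure :: "'a measure \<Rightarrow> ('a set \<Rightarrow> 'x::real_normed_vector) \<Rightarrow> bool" where
  "vector_measure M m \<longleftrightarrow>
     (\<forall>A :: nat \<Rightarrow> 'a set. range A \<subseteq> sets M \<longrightarrow> disjoint_family A \<longrightarrow> (\<lambda>n. m (A n)) sums m (\<Union>n. A n))"

definition scalar_measure ::
  "('a set \<Rightarrow> 'x::real_normed_vector) \<Rightarrow> ('x \<Rightarrow>\<^sub>L real) \<Rightarrow> 'a set \<Rightarrow> real" where
  "scalar_measure m \<phi> A = blinfun_apply \<phi> (m A)"


definition total_variation :: "'a measure \<Rightarrow> ('a set \<Rightarrow> real) \<Rightarrow> 'a set \<Rightarrow> ennreal" where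
  "total_variation M \<nu> A =
     (SUP P \<in> {P. finite P \<and> P \<subseteq> sets M \<and> disjoint P \<and> \<Union>P = A}. \<Sum>B\<in>P. ennreal \<bar>\<nu> B\<bar>)"

definition variation_measure :: "'a measure \<Rightarrow> ('a set \<Rightarrow> real) \<Rightarrow> 'a measure" where
  "variation_measure M \<nu> = measure_of (space M) (sets M) (total_variation M \<nu>)"

text \<open>
  The positive part in the Jordan decomposition; \<open>ennreal\<close> sends negative reals to \<open>0\<close>, which does
  not affect the supremum since \<open>B = {}\<close> is admitted. The negative part of \<open>\<nu>\<close> is the positive part
  of \<open>-\<nu>\<close>.
\<close>

definition positive_part_measure :: "'a measure \<Rightarrow> ('a set \<Rightarrow> real) \<Rightarrow> 'a measure" where
  "positive_part_measure M \<nu> =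
     measure_of (space M) (sets M) (\<lambda>A. SUP B \<in> {B \<in> sets M. B \<subseteq> A}. ennreal (\<nu> B))"

definition signed_integral :: "'a measure \<Rightarrow> ('a set \<Rightarrow> real) \<Rightarrow> 'a set \<Rightarrow> ('a \<Rightarrow> real) \<Rightarrow> real" where
  "signed_integral M \<nu> A f =
     set_lebesgue_integral (positive_part_measure M \<nu>) A f
   - set_lebesgue_integral (positive_part_measure M (\<lambda>B. - \<nu> B)) A f"


definition semivariation ::
  "'a measure \<Rightarrow> ('a set \<Rightarrow> 'x::real_normed_vector) \<Rightarrow> 'a set \<Rightarrow> ennreal" where
  "semivariation M m A =
     (SUP \<phi> \<in> {\<phi>. norm \<phi> \<le> 1}. emeasure (variation_measure M (scalar_measure m \<phi>)) A)"

definition is_vm_integral ::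
  "'a measure \<Rightarrow> ('a set \<Rightarrow> 'x::real_normed_vector) \<Rightarrow> 'a set \<Rightarrow> ('a \<Rightarrow> real) \<Rightarrow> 'x \<Rightarrow> bool" where
  "is_vm_integral M m A f y \<longleftrightarrow>
     (\<forall>\<phi>. blinfun_apply \<phi> y = signed_integral M (scalar_measure m \<phi>) A f)"

text \<open>
  The space \<open>L\<^sup>1(m)\<close> is represented by the integrable functions themselves, without passing to classes
  modulo almost everywhere equality; norm and integral do not depend on the representative.
\<close>

definition vm_L1 :: "'a measure \<Rightarrow> ('a set \<Rightarrow> 'x::real_normed_vector) \<Rightarrow> ('a \<Rightarrow> real) set" where
  "vm_L1 M m = {f \<in> borel_measurable M.
     (\<forall>\<phi>. integrable (variation_measure M (scalar_measure m \<phi>)) f) \<and>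
     (\<forall>A\<in>sets M. \<exists>y. is_vm_integral M m A f y)}"

definition vm_integral ::
  "'a measure \<Rightarrow> ('a set \<Rightarrow> 'x::real_normed_vector) \<Rightarrow> 'a set \<Rightarrow> ('a \<Rightarrow> real) \<Rightarrow> 'x" where
  "vm_integral M m A f = (THE y. is_vm_integral M m A f y)"

definition integration_map ::
  "'a measure \<Rightarrow> ('a set \<Rightarrow> 'x::real_normed_vector) \<Rightarrow> ('a \<Rightarrow> real) \<Rightarrow> 'x" where
  "integration_map M m f = vm_integral M m (space M) f"

definition L1_norm ::
  "'a measure \<Rightarrow> ('a set \<Rightarrow> 'x::real_normed_vector) \<Rightarrow> ('a \<Rightarrow> real) \<Rightarrow> ennreal" where
  "L1_norm M m f =
     (SUP \<phi> \<in> {\<phi>. norm \<phi> \<le> 1}. \<integral>\<^sup>+ x. ennreal \<bar>f x\<bar> \<partial>variation_measure M (scalar_measure m \<phi>))"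


definition weak_topology :: "'x::real_normed_vector topology" where
  "weak_topology =
     topology_generated_by {blinfun_apply \<phi> -` U | (\<phi> :: 'x \<Rightarrow>\<^sub>L real) U. open U}"

definition relatively_weakly_compact :: "'x::real_normed_vector set \<Rightarrow> bool" where
  "relatively_weakly_compact S \<longleftrightarrow> compactin weak_topology (weak_topology closure_of S)"

definition weakly_compact_integration_map ::
  "'a measure \<Rightarrow> ('a set \<Rightarrow> 'x::real_normed_vector) \<Rightarrow> bool" where
  "weakly_compact_integration_map M m \<longleftrightarrow>
     relatively_weakly_compact (integration_map M m ` {f \<in> vm_L1 M m. L1_norm M m f \<le> 1})"

definition approximation_property :: "'x::real_normed_vector itself \<Rightarrow> bool" where
  "approximation_property _ \<longleftrightarrow>
     (\<forall>K :: 'x set. \<forall>\<epsilon>>0. compact K \<longrightarrow>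
        (\<exists>T :: 'x \<Rightarrow>\<^sub>L 'x. (\<exists>B. finite B \<and> range (blinfun_apply T) \<subseteq> span B) \<and>
           (\<forall>x\<in>K. norm (blinfun_apply T x - x) \<le> \<epsilon>)))"


definition equivalent_measure ::
  "'a measure \<Rightarrow> 'a measure \<Rightarrow> ('a set \<Rightarrow> 'x::real_normed_vector) \<Rightarrow> bool" where
  "equivalent_measure M \<mu> m \<longleftrightarrow>
     sets \<mu> = sets M \<and> (\<forall>A\<in>sets M. emeasure \<mu> A = 0 \<longleftrightarrow> semivariation M m A = 0)"

text \<open>The library's \<open>RN_deriv\<close> only covers nonnegative measures.\<close>

definition signed_RN_deriv :: "'a measure \<Rightarrow> ('a set \<Rightarrow> real) \<Rightarrow> 'a \<Rightarrow> real" where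
  "signed_RN_deriv \<mu> \<nu> =
     (SOME h. integrable \<mu> h \<and> (\<forall>A\<in>sets \<mu>. \<nu> A = set_lebesgue_integral \<mu> A h))"

definition RN_functional ::
  "'a measure \<Rightarrow> ('a set \<Rightarrow> 'x::real_normed_vector) \<Rightarrow> ('x \<Rightarrow>\<^sub>L real) \<Rightarrow> ('a \<Rightarrow> real) \<Rightarrow> real" where
  "RN_functional \<mu> m \<phi> f = (\<integral>x. f x * signed_RN_deriv \<mu> (scalar_measure m \<phi>) x \<partial>\<mu>)"

definition finite_rank_RN_operator ::
  "'a measure \<Rightarrow> 'a measure \<Rightarrow> ('a set \<Rightarrow> 'x::real_normed_vector) \<Rightarrow> (('a \<Rightarrow> real) \<Rightarrow> 'x) \<Rightarrow> bool" where
  "finite_rank_RN_operator M \<mu> m R \<longleftrightarrow>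
     (\<exists>(n::nat) (\<phi> :: nat \<Rightarrow> 'x \<Rightarrow>\<^sub>L real) (x :: nat \<Rightarrow> 'x).
        \<forall>f\<in>vm_L1 M m. R f = (\<Sum>i<n. RN_functional \<mu> m (\<phi> i) f *\<^sub>R x i))"

definition associated_measure :: "(('a \<Rightarrow> real) \<Rightarrow> 'x) \<Rightarrow> 'a set \<Rightarrow> 'x" where
  "associated_measure R A = R (indicat_real A)"


definition directed_set :: "'i set \<Rightarrow> ('i \<Rightarrow> 'i \<Rightarrow> bool) \<Rightarrow> bool" where
  "directed_set I le \<longleftrightarrow> I \<noteq> {} \<and> (\<forall>i\<in>I. le i i) \<and>
     (\<forall>i\<in>I. \<forall>j\<in>I. \<forall>k\<in>I. le i j \<longrightarrow> le j k \<longrightarrow> le i k) \<and>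
     (\<forall>i\<in>I. \<forall>j\<in>I. \<exists>k\<in>I. le i k \<and> le j k)"

text \<open>
  Convergence of a net \<open>(x\<^sub>i)\<^sub>i\<^sub>\<in>\<^sub>I\<close> is convergence along the filter generated by the tails of \<open>I\<close>.
  Since types cannot be quantified existentially, an assertion that a net exists has to fix the type
  of its indices. For real-valued convergence at all \<open>f\<close> in a set of functions, pairs \<open>(F, \<epsilon>)\<close>, with \<open>F\<close> a
  finite subset and \<open>\<epsilon> > 0\<close>, suffice: choosing for each pair a member of a given net that is \<open>\<epsilon>\<close>-close
  to the limit at all \<open>f \<in> F\<close> yields a net with the same limits.
\<close>

definition net_filter :: "'i set \<Rightarrow> ('i \<Rightarrow> 'i \<Rightarrow> bool) \<Rightarrow> 'i filter" where
  "net_filter I le = (INF i\<in>I. principal {j\<in>I. le i j})"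

lemma eventually_net_filter:
  assumes "directed_set I le"
  shows "eventually P (net_filter I le) \<longleftrightarrow> (\<exists>i\<in>I. \<forall>j\<in>I. le i j \<longrightarrow> P j)"
proof -
  have "eventually P (net_filter I le) \<longleftrightarrow> (\<exists>i\<in>I. eventually P (principal {j\<in>I. le i j}))"
    unfolding net_filter_def
  proof (rule eventually_INF_base)
    show "I \<noteq> {}" using assms by (auto simp: directed_set_def)
    fix a b assume "a \<in> I" "b \<in> I"
    then obtain k where k: "k \<in> I" "le a k" "le b k"
      using assms unfolding directed_set_def by metis
    have "le a j \<and> le b j" if "j \<in> I" "le k j" for j
      using assms k that \<open>a \<in> I\<close> \<open>b \<in> I\<close> unfolding directed_set_def by metis
    then have "{j\<in>I. le k j} \<subseteq> {j\<in>I. le a j} \<inter> {j\<in>I. le b j}" by blast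
    then show "\<exists>x\<in>I. principal {j\<in>I. le x j} \<le> inf (principal {j\<in>I. le a j}) (principal {j\<in>I. le b j})"
      using k(1) by (intro bexI[of _ k]) (simp_all only: inf_principal principal_le_iff)
  qed
  then show ?thesis by (auto simp: eventually_principal)
qed

end

theory Submission
  imports Defs "HOL-Probability.Discrete_Topology"
begin

text \<open>
  For an operator \<open>T\<close> on \<open>X\<close> of finite rank, \<open>T \<circ> I\<^sub>m\<close> is a Radon--Nikodym derivative operator with
  associated measure \<open>T \<circ> m\<close>, and the norm of \<open>f\<close> in \<open>L\<^sup>1(T \<circ> m)\<close> is the supremum of \<open>\<parallel>T w\<parallel>\<close> over
  \<open>w = I\<^sub>m(f s)\<close> with \<open>s = \<plusminus>1\<close>. So for finitely many \<open>f\<close> one needs \<open>T\<close> close to the identity at finitely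
  many points and of norm at most \<open>1 + \<epsilon>\<close> on the set \<open>W\<close> of all \<open>I\<^sub>m(f s) / \<parallel>f\<parallel>\<close>. The approximation
  property gives no bound on \<open>W\<close>, which need not be norm compact.

  If no such \<open>T\<close> exists, the Mazur--Orlicz theorem yields a finitely additive mean \<open>\<Lambda>\<close> on pairs
  \<open>(\<phi>, w)\<close> of a functional in the dual ball and a point of \<open>W\<close> with \<open>\<Lambda>(\<phi>(T w)) \<ge> 1 + \<epsilon>\<close> for all
  admissible \<open>T\<close>. Each \<open>w\<close> is \<open>\<integral> h g dm\<close> for a fixed \<open>g\<close> in \<open>L\<^sup>1(m)\<close> and a function \<open>h\<close> with values in
  \<open>[-1, 1]\<close>. Approximate \<open>h\<close> in mean square by functions \<open>G\<^sub>n(\<phi>)\<close> which depend on \<open>\<phi>\<close> only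
  and take finitely many values. By the parallelogram law minimizing sequences are Cauchy, and since \<open>g\<close> has
  an absolutely continuous integral, the points \<open>\<integral> G\<^sub>n(\<phi>) g dm\<close> converge in mean so fast that a norm
  compact set controls \<open>\<Lambda>(\<phi>(T w))\<close>: if \<open>T\<close> is close to the identity there, this value is at most
  \<open>1 + \<epsilon>/2\<close>, and the approximation property provides such a \<open>T\<close>.
\<close>

subsection \<open>Linear functionals below sublinear ones\<close>

text \<open>The vector \<open>w\<close> can be replaced by \<open>\<integral> G(\<phi>) g dm\<close>
  because every test applied to their difference depends on \<open>\<phi>\<close> alone: the adjoint
  of \<open>T\<close> turns \<open>\<phi>(T v)\<close> into such a functional of \<open>v\<close>,
  and a norming functional of \<open>\<integral> G(\<phi>) g dm\<close> is another. A near-minimizer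
  of the mean square distance is nearly orthogonal under \<open>\<Lambda>\<close> to the bounded
  functions of \<open>\<phi>\<close> with finitely many values, so both tests hardly see the
  replacement. The first carries the estimate of \<open>\<Lambda>(\<phi>(T w))\<close> from
  \<open>W\<close> to the values of \<open>G\<^sub>n\<close>; the second bounds the mean norm of
  these values by a quantity tending to 1.

  Each \<open>G\<^sub>n\<close> has finite range so that the rescaled increments of all stages fit
  into one compact set. To match this restriction the adjoint is discretized, which the finite rank
  of \<open>T\<close> permits. As \<open>\<Lambda>\<close> is only finitely additive, no limit of
  the \<open>G\<^sub>n\<close> is formed; each estimate is made at one \<open>n\<close> with a small
  error. The compact set depends on \<open>\<Lambda>\<close> but not on \<open>T\<close>, so the
  approximation property may supply \<open>T\<close> last.\<close>

definition sublinear :: "('v::real_vector \<Rightarrow> real) \<Rightarrow> bool" where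
  "sublinear p \<longleftrightarrow> (\<forall>x y. p (x + y) \<le> p x + p y) \<and> (\<forall>t x. 0 \<le> t \<longrightarrow> p (t *\<^sub>R x) = t * p x)"

lemma sublinear_add: "sublinear p \<Longrightarrow> p (x + y) \<le> p x + p y"
  and sublinear_scale: "sublinear p \<Longrightarrow> 0 \<le> t \<Longrightarrow> p (t *\<^sub>R x) = t * p x"
  by (auto simp: sublinear_def)

lemma sublinear_zero: "sublinear p \<Longrightarrow> p 0 = 0"
  using sublinear_scale[of p 0 0] by simp

lemma sublinear_minus: "sublinear p \<Longrightarrow> - p (- x) \<le> p x"
  using sublinear_add[of p x "- x"] sublinear_zero[of p] by simp

lemma sublinear_odd_imp_linear:
  assumes p: "sublinear p" and odd: "\<And>x. p (- x) \<le> - p x"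
  shows "linear p"
proof
  fix x y
  have eq: "p (- x) = - p x" for x
    using odd[of x] sublinear_minus[OF p, of x] by simp
  show "p (x + y) = p x + p y"
    using sublinear_add[OF p, of "x + y" "- y"] sublinear_add[OF p, of x y] eq[of y] by simp
  fix r
  show "p (r *\<^sub>R x) = r *\<^sub>R p x"
  proof (cases "0 \<le> r")
    case False
    then have "p (- (r *\<^sub>R x)) = - r * p x"
      using sublinear_scale[OF p, of "- r" x] by simp
    then show ?thesis using eq[of "r *\<^sub>R x"] by simp
  qed (simp add: sublinear_scale[OF p])
qed

text \<open>The infimum of \<open>p (x + t *\<^sub>R y) - t * c\<close> is the largest sublinear
  functional below \<open>p\<close> with value at most \<open>-c\<close> on \<open>-C\<close>; a
  linear functional below it is at least \<open>c\<close> on \<open>C\<close>. Convexity enters in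
  the subadditivity, where two directions of \<open>C\<close> are merged into one.\<close>

lemma sublinear_lower_by_convex:
  fixes p :: "'v::real_vector \<Rightarrow> real"
  assumes p: "sublinear p" and C: "convex C" "C \<noteq> {}" and c: "\<And>y. y \<in> C \<Longrightarrow> c \<le> p y"
  obtains q where "sublinear q" "\<And>x. q x \<le> p x" "\<And>y. y \<in> C \<Longrightarrow> q (- y) \<le> - c"
proof -
  define V where "V x = {p (x + t *\<^sub>R y) - t * c | t y. 0 \<le> t \<and> y \<in> C}" for x
  define q where "q x = Inf (V x)" for x
  have lb: "- p (- x) \<le> v" if v: "v \<in> V x" for x v
  proof -
    obtain t y where ty: "v = p (x + t *\<^sub>R y) - t * c" "0 \<le> t" "y \<in> C"
      using v by (auto simp: V_def)
    have "t * c \<le> p (t *\<^sub>R y)"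
      using ty c[of y] by (simp add: sublinear_scale[OF p] mult_left_mono)
    also have "\<dots> \<le> p (x + t *\<^sub>R y) + p (- x)"
      using sublinear_add[OF p, of "x + t *\<^sub>R y" "- x"] by simp
    finally show ?thesis using ty by simp
  qed
  then have bdd: "bdd_below (V x)" for x
    by (meson bdd_belowI)
  have ne: "V x \<noteq> {}" for x
    using C(2) by (auto simp: V_def intro: exI[of _ 0])
  have le: "q x \<le> p (x + t *\<^sub>R y) - t * c" if "0 \<le> t" "y \<in> C" for x t y
    unfolding q_def by (rule cInf_lower[OF _ bdd]) (use that in \<open>auto simp: V_def\<close>)
  have le0: "q x \<le> p x" for x
    using C(2) le[of 0 _ x] by auto
  have add: "q (x + x') \<le> q x + q x'" for x x'
  proof -
    have "q (x + x') \<le> v + v'" if vv: "v \<in> V x" "v' \<in> V x'" for v v'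
    proof -
      obtain t y where ty: "v = p (x + t *\<^sub>R y) - t * c" "0 \<le> t" "y \<in> C"
        using vv by (auto simp: V_def)
      obtain s z where sz: "v' = p (x' + s *\<^sub>R z) - s * c" "0 \<le> s" "z \<in> C"
        using vv by (auto simp: V_def)
      have "\<exists>w\<in>C. t *\<^sub>R y + s *\<^sub>R z = (t + s) *\<^sub>R w"
      proof (cases "t + s = 0")
        case True
        then show ?thesis using ty sz by (auto intro: bexI[of _ y] simp: add_nonneg_eq_0_iff)
      next
        case False
        then have "(t / (t + s)) *\<^sub>R y + (s / (t + s)) *\<^sub>R z \<in> C"
          using ty sz C(1) by (intro convexD) (auto simp: add_divide_distrib[symmetric])
        then show ?thesis using False
          by (intro bexI[of _ "(t / (t + s)) *\<^sub>R y + (s / (t + s)) *\<^sub>R z"]) (auto simp: scaleR_add_right)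
      qed
      then obtain w where w: "w \<in> C" "t *\<^sub>R y + s *\<^sub>R z = (t + s) *\<^sub>R w" by blast
      have "q (x + x') \<le> p (x + x' + (t + s) *\<^sub>R w) - (t + s) * c"
        using ty sz w by (intro le) auto
      also have "x + x' + (t + s) *\<^sub>R w = (x + t *\<^sub>R y) + (x' + s *\<^sub>R z)"
        unfolding w(2)[symmetric] by simp
      also have "p \<dots> - (t + s) * c \<le> v + v'"
        using sublinear_add[OF p, of "x + t *\<^sub>R y" "x' + s *\<^sub>R z"] ty sz by (simp add: algebra_simps)
      finally show ?thesis .
    qed
    then have "q (x + x') - v' \<le> q x" if "v' \<in> V x'" for v'
      unfolding q_def[of x] using that by (intro cInf_greatest[OF ne]) (auto simp: diff_le_eq)
    then have "q (x + x') - q x \<le> q x'"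
      unfolding q_def[of x'] by (intro cInf_greatest[OF ne]) (auto simp: algebra_simps)
    then show ?thesis by simp
  qed
  have scale_le: "q (r *\<^sub>R x) \<le> r * q x" if r: "0 < r" for r x
  proof -
    have "q (r *\<^sub>R x) / r \<le> v" if v: "v \<in> V x" for v
    proof -
      obtain t y where ty: "v = p (x + t *\<^sub>R y) - t * c" "0 \<le> t" "y \<in> C"
        using v by (auto simp: V_def)
      have "q (r *\<^sub>R x) \<le> p (r *\<^sub>R x + (r * t) *\<^sub>R y) - (r * t) * c"
        using ty r by (intro le) auto
      also have "r *\<^sub>R x + (r * t) *\<^sub>R y = r *\<^sub>R (x + t *\<^sub>R y)" by (simp add: algebra_simps)
      also have "p \<dots> - (r * t) * c = r * v"
        unfolding sublinear_scale[OF p less_imp_le[OF r]] ty(1) by (simp add: algebra_simps)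
      finally show ?thesis using r by (simp add: field_simps)
    qed
    then have "q (r *\<^sub>R x) / r \<le> q x"
      unfolding q_def[of x] by (intro cInf_greatest[OF ne])
    then show ?thesis using r by (simp add: field_simps)
  qed
  have "q 0 = 0"
    using le0[of 0] sublinear_zero[OF p] add[of 0 0] by simp
  have scale: "q (r *\<^sub>R x) = r * q x" if r: "0 \<le> r" for r x
  proof (cases "r = 0")
    case False
    then have r: "0 < r" using r by simp
    have "q x \<le> inverse r * q (r *\<^sub>R x)" using scale_le[of "inverse r" "r *\<^sub>R x"] r by simp
    then have "r * q x \<le> q (r *\<^sub>R x)" using r by (simp add: field_simps)
    then show ?thesis using scale_le[OF r, of x] by simp
  qed (simp add: \<open>q 0 = 0\<close>)
  show thesis
  proof
    show "sublinear q" using add scale by (auto simp: sublinear_def)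
    show "q x \<le> p x" for x by (rule le0)
    show "q (- y) \<le> - c" if "y \<in> C" for y
      using le[of 1 y "- y"] that sublinear_zero[OF p] by simp
  qed
qed

text \<open>Zorn's lemma. Infima of chains are finite because every sublinear \<open>q\<close> below
  \<open>p\<close> lies above \<open>- p (- x)\<close>, and they are subadditive because the smaller
  of two members of a chain can be used at both points.\<close>

lemma exists_minimal_sublinear:
  fixes p :: "'v::real_vector \<Rightarrow> real"
  assumes p: "sublinear p"
  obtains q where "sublinear q" "\<And>x. q x \<le> p x"
    "\<And>q'. sublinear q' \<Longrightarrow> (\<And>x. q' x \<le> q x) \<Longrightarrow> q' = q"
proof -
  define A where "A = {q. sublinear q \<and> (\<forall>x. q x \<le> p x)}"
  \<comment> \<open>The order is reversed, so a maximal element for \<open>P\<close> is a minimal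
    functional.\<close>
  define P where "P q r \<longleftrightarrow> (\<forall>x. r x \<le> q x)" for q r :: "'v \<Rightarrow> real"
  have "\<exists>m\<in>A. \<forall>a\<in>A. P m a \<longrightarrow> a = m"
  proof (rule predicate_Zorn)
    show "partial_order_on A (relation_of P A)"
      unfolding partial_order_on_def preorder_on_def relation_of_def P_def refl_on_def trans_def antisym_def
      by (auto intro: order_trans simp: fun_eq_iff order_antisym)
    fix C assume "C \<in> Chains (relation_of P A)"
    then have CA: "C \<subseteq> A" and chain: "\<And>q r. q \<in> C \<Longrightarrow> r \<in> C \<Longrightarrow> P q r \<or> P r q"
      by (auto simp: Chains_def relation_of_def)
    show "\<exists>u\<in>A. \<forall>a\<in>C. P a u"
    proof (cases "C = {}")
      case True
      then show ?thesis using p by (auto simp: A_def)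
    next
      case False
      define u where "u x = (INF q\<in>C. q x)" for x
      have "- p (- x) \<le> q x" if "q \<in> C" for q x
      proof -
        have "q (- x) \<le> p (- x)" "sublinear q" using that CA by (auto simp: A_def)
        then show ?thesis using sublinear_minus[of q x] by linarith
      qed
      then have bdd: "bdd_below ((\<lambda>q. q x) ` C)" for x
        by (auto intro!: bdd_belowI)
      have le: "u x \<le> q x" if "q \<in> C" for q x
        unfolding u_def using that by (intro cINF_lower[OF bdd])
      have ge: "v \<le> u x" if "\<And>q. q \<in> C \<Longrightarrow> v \<le> q x" for v x
        unfolding u_def using that False by (intro cINF_greatest)
      have add: "u (x + y) \<le> u x + u y" for x y
      proof -
        have "u (x + y) \<le> q x + r y" if qr: "q \<in> C" "r \<in> C" for q r
        proof -
          obtain s where s: "s \<in> C" "s x \<le> q x" "s y \<le> r y"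
            using chain[OF qr] qr by (auto simp: P_def)
          have "u (x + y) \<le> s x + s y"
            using le[OF s(1), of "x + y"] CA s(1) sublinear_add[of s x y] by (force simp: A_def)
          then show ?thesis using s by linarith
        qed
        then have "u (x + y) - q x \<le> r y" if "q \<in> C" "r \<in> C" for q r
          using that by (metis diff_le_eq add.commute)
        then have "u (x + y) - q x \<le> u y" if "q \<in> C" for q
          using that by (intro ge) blast
        then have "u (x + y) - u y \<le> u x"
          by (intro ge) (simp add: algebra_simps)
        then show ?thesis by simp
      qed
      have scale: "u (t *\<^sub>R x) = t * u x" if t: "0 \<le> t" for t x
      proof (cases "t = 0")
        case True
        have "\<And>q. q \<in> C \<Longrightarrow> q 0 = 0" using CA sublinear_zero by (auto simp: A_def)
        then have "u 0 = 0"
          using False le[of _ 0] ge[of 0 0] by (metis all_not_in_conv order_antisym order_refl)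
        then show ?thesis using True by simp
      next
        case False
        then have t: "0 < t" using t by simp
        have eq: "q (t *\<^sub>R x) = t * q x" if "q \<in> C" for q
          using CA that t by (auto simp: A_def sublinear_scale)
        have "u (t *\<^sub>R x) / t \<le> u x"
        proof (rule ge)
          fix q assume "q \<in> C"
          then show "u (t *\<^sub>R x) / t \<le> q x"
            using le[of q "t *\<^sub>R x"] eq t by (simp add: field_simps)
        qed
        moreover have "t * u x \<le> u (t *\<^sub>R x)"
          by (intro ge) (simp add: eq le t)
        ultimately show ?thesis using t by (simp add: field_simps)
      qed
      obtain q where q: "q \<in> C" using False by auto
      then have "q x \<le> p x" for x using CA by (auto simp: A_def)
      then have "u x \<le> p x" for x
        using le[OF q] order_trans by blast
      then have "u \<in> A" using add scale by (auto simp: A_def sublinear_def)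
      then show ?thesis using le by (auto simp: P_def)
    qed
  qed
  then obtain q where q: "q \<in> A" "\<And>r. r \<in> A \<Longrightarrow> P q r \<Longrightarrow> r = q" by blast
  show thesis
  proof
    show "sublinear q" "q x \<le> p x" for x using q(1) by (auto simp: A_def)
    show "q' = q" if "sublinear q'" "\<And>x. q' x \<le> q x" for q'
      using q that by (intro q(2)) (auto simp: A_def P_def intro: order_trans)
  qed
qed

text \<open>A singleton \<open>C\<close> gives the Hahn-Banach extension; a convex set of functions
  \<open>C\<close> gives the mean that exceeds a bound on all of them at once.\<close>

theorem Mazur_Orlicz:
  fixes p :: "'v::real_vector \<Rightarrow> real"
  assumes p: "sublinear p" and C: "convex C" "C \<noteq> {}" and c: "\<And>y. y \<in> C \<Longrightarrow> c \<le> p y"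
  obtains L where "linear L" "\<And>x. L x \<le> p x" "\<And>y. y \<in> C \<Longrightarrow> c \<le> L y"
proof -
  obtain q where q: "sublinear q" "\<And>x. q x \<le> p x" "\<And>y. y \<in> C \<Longrightarrow> q (- y) \<le> - c"
    using sublinear_lower_by_convex[OF assms] by metis
  obtain L where L: "sublinear L" "\<And>x. L x \<le> q x"
      and min: "\<And>q'. sublinear q' \<Longrightarrow> (\<And>x. q' x \<le> L x) \<Longrightarrow> q' = L"
    using exists_minimal_sublinear[OF q(1)] by metis
  \<comment> \<open>Lowering \<open>L\<close> once more along the single direction \<open>y\<close>
    cannot change a minimal functional, which makes \<open>L\<close> odd and hence linear.\<close>
  have "L (- y) \<le> - L y" for y
  proof -
    obtain q' where q': "sublinear q'" "\<And>x. q' x \<le> L x" "q' (- y) \<le> - L y"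
      using sublinear_lower_by_convex[OF L(1), of "{y}" "L y"] by auto
    then show ?thesis using min[of q'] by simp
  qed
  then have lin: "linear L" using sublinear_odd_imp_linear[OF L(1)] by blast
  show thesis
  proof
    show "linear L" by fact
    show "L x \<le> p x" for x using L(2) q(2) order_trans by blast
    show "c \<le> L y" if "y \<in> C" for y
      using L(2)[of "- y"] q(3)[OF that] linear_neg[OF lin, of y] by simp
  qed
qed

section \<open>Continuous functionals: norming a vector and separating it from a subspace\<close>

lemma linear_le_norm_blinfun:
  fixes L :: "'x::real_normed_vector \<Rightarrow> real"
  assumes L: "linear L" "\<And>x. L x \<le> norm x"
  obtains \<phi> :: "'x \<Rightarrow>\<^sub>L real" where "blinfun_apply \<phi> = L" "norm \<phi> \<le> 1"
proof -
  have abs: "\<bar>L x\<bar> \<le> norm x" for x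
    using L(2)[of x] L(2)[of "- x"] linear_neg[OF L(1), of x] by simp
  have "bounded_linear L"
    using L(1) abs by (intro bounded_linear_intro[where K = 1]) (auto simp: linear_add linear_scale)
  then have "blinfun_apply (Blinfun L) = L" by (rule bounded_linear_Blinfun_apply)
  moreover from this have "norm (Blinfun L) \<le> 1"
    using abs by (intro norm_blinfun_bound) auto
  ultimately show thesis using that by blast
qed

lemma exists_norming_functional:
  fixes x :: "'x::real_normed_vector"
  obtains \<phi> :: "'x \<Rightarrow>\<^sub>L real" where "norm \<phi> \<le> 1" "blinfun_apply \<phi> x = norm x"
proof -
  have "sublinear (norm :: 'x \<Rightarrow> real)" by (simp add: sublinear_def norm_triangle_ineq)
  then obtain L where L: "linear L" "\<And>x. L x \<le> norm (x :: 'x)" "\<And>y. y \<in> {x} \<Longrightarrow> norm x \<le> L y"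
    by (rule Mazur_Orlicz[of norm "{x}" "norm x"]) auto
  obtain \<phi> :: "'x \<Rightarrow>\<^sub>L real" where "blinfun_apply \<phi> = L" "norm \<phi> \<le> 1"
    using linear_le_norm_blinfun[OF L(1,2)] by metis
  then show thesis using that[of \<phi>] L(2)[of x] L(3)[of x] by (simp add: order_antisym)
qed

lemma norm_le_functional:
  fixes x :: "'x::real_normed_vector"
  assumes "\<And>\<phi> :: 'x \<Rightarrow>\<^sub>L real. norm \<phi> \<le> 1 \<Longrightarrow> blinfun_apply \<phi> x \<le> c"
  shows "norm x \<le> c"
proof -
  obtain \<phi> :: "'x \<Rightarrow>\<^sub>L real" where "norm \<phi> \<le> 1" "blinfun_apply \<phi> x = norm x"
    using exists_norming_functional[of x] by metis
  then show ?thesis using assms[of \<phi>] by simp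
qed

text \<open>The distance to \<open>Y\<close> is sublinear, vanishes on \<open>Y\<close> and lies
  below the norm; a linear functional below it that reaches the distance at \<open>x\<close> is the
  separating one.\<close>

lemma separate_point_closed_subspace:
  fixes Y :: "'x::real_normed_vector set"
  assumes Y: "subspace Y" "closed Y" and x: "x \<notin> Y"
  obtains \<phi> :: "'x \<Rightarrow>\<^sub>L real" where "\<And>y. y \<in> Y \<Longrightarrow> blinfun_apply \<phi> y = 0" "blinfun_apply \<phi> x \<noteq> 0"
proof -
  let ?p = "\<lambda>x. infdist x Y"
  have ne: "Y \<noteq> {}" using subspace_0[OF Y(1)] by auto
  have approx: "\<exists>y\<in>Y. dist x y < infdist x Y + e" if "0 < e" for x and e :: real
  proof (rule ccontr)
    assume "\<not> ?thesis"
    then have "infdist x Y + e \<le> infdist x Y"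
      unfolding infdist_notempty[OF ne, of x]
      by (intro cINF_greatest[OF ne]) (force simp: infdist_notempty[OF ne])
    then show False using that by simp
  qed
  have add: "?p (x + x') \<le> ?p x + ?p x'" for x x'
  proof (rule field_le_epsilon)
    fix e :: real assume "0 < e"
    then obtain y y' where yy: "y \<in> Y" "dist x y < ?p x + e / 2" "y' \<in> Y" "dist x' y' < ?p x' + e / 2"
      using approx[of "e / 2" x] approx[of "e / 2" x'] by auto
    have "?p (x + x') \<le> dist (x + x') (y + y')"
      using yy by (intro infdist_le subspace_add[OF Y(1)])
    also have "\<dots> \<le> dist x y + dist x' y'" by (rule dist_triangle_add)
    finally show "?p (x + x') \<le> ?p x + ?p x' + e" using yy by simp
  qed
  have scale_le: "?p (t *\<^sub>R x) \<le> t * ?p x" if t: "0 < t" for t x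
  proof (rule field_le_epsilon)
    fix e :: real assume e: "0 < e"
    then obtain y where y: "y \<in> Y" "dist x y < ?p x + e / t"
      using approx[of "e / t" x] t by auto
    have "?p (t *\<^sub>R x) \<le> dist (t *\<^sub>R x) (t *\<^sub>R y)"
      using y by (intro infdist_le subspace_scale[OF Y(1)])
    also have "\<dots> = t * dist x y"
      using that by (simp add: dist_norm scaleR_diff_right[symmetric])
    also have "\<dots> \<le> t * ?p x + e"
      using y(2) that by (simp add: field_simps)
    finally show "?p (t *\<^sub>R x) \<le> t * ?p x + e" .
  qed
  have scale: "?p (t *\<^sub>R x) = t * ?p x" if "0 \<le> t" for t x
  proof (cases "t = 0")
    case True
    then show ?thesis using subspace_0[OF Y(1)] by simp
  next
    case False
    then have t: "0 < t" using that by simp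
    have "?p x \<le> inverse t * ?p (t *\<^sub>R x)" using scale_le[of "inverse t" "t *\<^sub>R x"] t by simp
    then show ?thesis using scale_le[OF t, of x] t by (simp add: field_simps)
  qed
  have "sublinear ?p" using add scale by (simp add: sublinear_def)
  then obtain L where L: "linear L" "\<And>x. L x \<le> ?p x" "\<And>y. y \<in> {x} \<Longrightarrow> ?p x \<le> L y"
    by (rule Mazur_Orlicz[of ?p "{x}" "?p x"]) auto
  have "?p x \<le> norm x" for x
    using infdist_le[OF subspace_0[OF Y(1)], of x] by (simp add: dist_norm)
  then have "L x \<le> norm x" for x using L(2) order_trans by blast
  then obtain \<phi> :: "'x \<Rightarrow>\<^sub>L real" where \<phi>: "blinfun_apply \<phi> = L" "norm \<phi> \<le> 1"
    using linear_le_norm_blinfun[OF L(1)] by metis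
  show thesis
  proof
    show "blinfun_apply \<phi> y = 0" if "y \<in> Y" for y
      using L(2)[of y] L(2)[of "- y"] that subspace_neg[OF Y(1) that] linear_neg[OF L(1), of y] \<phi>
      by simp
    have "0 < ?p x" using in_closed_iff_infdist_zero[OF Y(2) ne] x infdist_nonneg[of x Y] by force
    then show "blinfun_apply \<phi> x \<noteq> 0" using L(3)[of x] \<phi> by simp
  qed
qed

subsection \<open>Finitely additive means\<close>

definition bounded_on :: "'s set \<Rightarrow> ('s \<Rightarrow> real) \<Rightarrow> bool" where
  "bounded_on S F \<longleftrightarrow> (\<exists>B. \<forall>s\<in>S. \<bar>F s\<bar> \<le> B)"

lemma bounded_onI: "(\<And>s. s \<in> S \<Longrightarrow> \<bar>F s\<bar> \<le> B) \<Longrightarrow> bounded_on S F"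
  by (auto simp: bounded_on_def)

lemma bounded_on_const [simp]: "bounded_on S (\<lambda>_. c)"
  by (rule bounded_onI[where B = "\<bar>c\<bar>"]) simp

lemma bounded_on_add: "bounded_on S F \<Longrightarrow> bounded_on S G \<Longrightarrow> bounded_on S (\<lambda>s. F s + G s)"
  unfolding bounded_on_def by (meson abs_triangle_ineq add_mono order_trans)

lemma bounded_on_cmult: "bounded_on S F \<Longrightarrow> bounded_on S (\<lambda>s. k * F s)"
  unfolding bounded_on_def by (metis abs_mult abs_ge_zero mult_left_mono)

lemma bounded_on_minus: "bounded_on S F \<Longrightarrow> bounded_on S (\<lambda>s. - F s)"
  by (simp add: bounded_on_def)

lemma bounded_on_diff: "bounded_on S F \<Longrightarrow> bounded_on S G \<Longrightarrow> bounded_on S (\<lambda>s. F s - G s)"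
  using bounded_on_add[of S F "\<lambda>s. - G s"] bounded_on_minus[of S G] by simp

text \<open>The integral of a finitely additive probability defined on all subsets of
  \<open>S\<close>. The rule \<open>le_bound\<close> contains positivity, normalization and
  independence of the values outside \<open>S\<close>.\<close>

locale mean =
  fixes S :: "'s set" and \<Lambda> :: "('s \<Rightarrow> real) \<Rightarrow> real"
  assumes add: "bounded_on S F \<Longrightarrow> bounded_on S G \<Longrightarrow> \<Lambda> (\<lambda>s. F s + G s) = \<Lambda> F + \<Lambda> G"
    and cmult: "bounded_on S F \<Longrightarrow> \<Lambda> (\<lambda>s. k * F s) = k * \<Lambda> F"
    and le_bound: "bounded_on S F \<Longrightarrow> (\<And>s. s \<in> S \<Longrightarrow> F s \<le> k) \<Longrightarrow> \<Lambda> F \<le> k"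
begin

lemma minus: "bounded_on S F \<Longrightarrow> \<Lambda> (\<lambda>s. - F s) = - \<Lambda> F"
  using cmult[of F "-1"] by simp

lemma diff: "bounded_on S F \<Longrightarrow> bounded_on S G \<Longrightarrow> \<Lambda> (\<lambda>s. F s - G s) = \<Lambda> F - \<Lambda> G"
  using add[of F "\<lambda>s. - G s"] minus[of G] bounded_on_minus[of S G] by simp

lemma ge_bound: "bounded_on S F \<Longrightarrow> (\<And>s. s \<in> S \<Longrightarrow> k \<le> F s) \<Longrightarrow> k \<le> \<Lambda> F"
  using le_bound[of "\<lambda>s. - F s" "- k"] minus[of F] bounded_on_minus[of S F] by simp

lemma mono:
  assumes "bounded_on S F" "bounded_on S G" "\<And>s. s \<in> S \<Longrightarrow> F s \<le> G s"
  shows "\<Lambda> F \<le> \<Lambda> G"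
  using le_bound[of "\<lambda>s. F s - G s" 0] assms diff[of F G] bounded_on_diff[of S F G] by simp

lemma const: "\<Lambda> (\<lambda>_. k) = k"
  using le_bound[of "\<lambda>_. k" k] ge_bound[of "\<lambda>_. k" k] by simp

lemma abs_le:
  assumes "bounded_on S F" "bounded_on S G" "\<And>s. s \<in> S \<Longrightarrow> \<bar>F s\<bar> \<le> G s"
  shows "\<bar>\<Lambda> F\<bar> \<le> \<Lambda> G"
proof -
  have "\<Lambda> F \<le> \<Lambda> G" "\<Lambda> (\<lambda>s. - F s) \<le> \<Lambda> G"
    using assms by (intro mono bounded_on_minus; force)+
  then show ?thesis using minus[OF assms(1)] by simp
qed

end

text \<open>A minimax step: each member of the convex family reaches \<open>c\<close> at its own
  point of \<open>S\<close>, and Mazur-Orlicz for the supremum functional replaces these points by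
  one mean good for the whole family.\<close>

lemma exists_mean:
  fixes S :: "'s set"
  assumes S: "S \<noteq> {}" and ne: "\<F> \<noteq> {}" and bdd: "\<And>F. F \<in> \<F> \<Longrightarrow> bounded_on S F"
    and conv: "\<And>F G u v. F \<in> \<F> \<Longrightarrow> G \<in> \<F> \<Longrightarrow> 0 \<le> u \<Longrightarrow> 0 \<le> v \<Longrightarrow> u + v = 1 \<Longrightarrow> (\<lambda>s. u * F s + v * G s) \<in> \<F>"
    and c: "\<And>F. F \<in> \<F> \<Longrightarrow> \<exists>s\<in>S. c \<le> F s"
  obtains \<Lambda> where "mean S \<Lambda>" "\<And>F. F \<in> \<F> \<Longrightarrow> c \<le> \<Lambda> F"
proof -
  \<comment> \<open>Bounded functions on \<open>S\<close> become a real vector space as bounded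
    continuous functions on a discrete space; extension by \<open>0\<close> makes them bounded
    everywhere.\<close>
  define h where "h F d = (if of_discrete d \<in> S then F (of_discrete d) else 0)" for F :: "'s \<Rightarrow> real" and d
  define E where "E F = Bcontfun (h F)" for F
  define p where "p f = (SUP s\<in>S. apply_bcontfun f (discrete s))" for f :: "'s discrete \<Rightarrow>\<^sub>C real"
  have E: "apply_bcontfun (E F) = h F" if F: "bounded_on S F" for F
  proof -
    obtain B where "\<And>s. s \<in> S \<Longrightarrow> \<bar>F s\<bar> \<le> B" using F by (auto simp: bounded_on_def)
    then have "\<bar>h F d\<bar> \<le> max B 0" for d by (force simp: h_def)
    then have "bounded (range (h F))" by (auto simp: bounded_iff)
    moreover have "continuous_on UNIV (h F)"
      by (auto simp: continuous_on_open_vimage open_discrete)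
    ultimately show ?thesis
      unfolding E_def by (intro Bcontfun_inverse) (simp add: bcontfun_def)
  qed
  have bddf: "bdd_above ((\<lambda>s. apply_bcontfun f (discrete s)) ` S)" for f :: "'s discrete \<Rightarrow>\<^sub>C real"
  proof -
    have "apply_bcontfun f d \<le> norm f" for d
      using norm_bounded[of f d] by simp
    then show ?thesis by (auto intro!: bdd_aboveI)
  qed
  have pge: "apply_bcontfun f (discrete s) \<le> p f" if "s \<in> S" for f s
    unfolding p_def by (intro cSUP_upper that bddf)
  have ple: "p f \<le> k" if "\<And>s. s \<in> S \<Longrightarrow> apply_bcontfun f (discrete s) \<le> k" for f k
    unfolding p_def using that S by (intro cSUP_least)
  have p: "sublinear p"
    unfolding sublinear_def
  proof (intro conjI allI impI)
    fix f g show "p (f + g) \<le> p f + p g"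
      by (intro ple) (simp add: add_mono pge)
  next
    fix t :: real and f assume t: "0 \<le> t"
    show "p (t *\<^sub>R f) = t * p f"
    proof (cases "t = 0")
      case True
      then show ?thesis using S by (simp add: p_def)
    next
      case False
      then have t: "0 < t" using t by simp
      have "p f \<le> p (t *\<^sub>R f) / t"
        using pge[of _ "t *\<^sub>R f"] t by (intro ple) (simp add: field_simps)
      moreover have "p (t *\<^sub>R f) \<le> t * p f"
        using pge[of _ f] t by (intro ple) simp
      ultimately show ?thesis using t by (simp add: field_simps)
    qed
  qed
  have Eadd: "E (\<lambda>s. F s + G s) = E F + E G" if "bounded_on S F" "bounded_on S G" for F G
    using that E[of F] E[of G] E[OF bounded_on_add[OF that]]
    by (intro bcontfun_eqI) (simp add: h_def)
  have Escale: "E (\<lambda>s. k * F s) = k *\<^sub>R E F" if "bounded_on S F" for F k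
    using that E[of F] E[OF bounded_on_cmult[OF that]]
    by (intro bcontfun_eqI) (simp add: h_def)
  have "convex (E ` \<F>)"
  proof (rule convexI)
    fix x y and u v :: real
    assume "x \<in> E ` \<F>" "y \<in> E ` \<F>" and uv: "0 \<le> u" "0 \<le> v" "u + v = 1"
    then obtain F G where FG: "F \<in> \<F>" "x = E F" "G \<in> \<F>" "y = E G" by auto
    have "u *\<^sub>R x + v *\<^sub>R y = E (\<lambda>s. u * F s + v * G s)"
      using FG by (simp add: Eadd Escale bdd bounded_on_cmult)
    then show "u *\<^sub>R x + v *\<^sub>R y \<in> E ` \<F>"
      using conv FG uv by (auto intro!: image_eqI)
  qed
  moreover have "c \<le> p y" if "y \<in> E ` \<F>" for y
  proof -
    obtain F where F: "F \<in> \<F>" "y = E F" using \<open>y \<in> E ` \<F>\<close> by auto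
    obtain s where s: "s \<in> S" "c \<le> F s" using c[OF F(1)] by auto
    have "F s \<le> p y"
      using pge[OF s(1), of y] F s E[OF bdd[OF F(1)]] by (simp add: h_def discrete_inverse)
    then show ?thesis using s by simp
  qed
  ultimately obtain L where L: "linear L" "\<And>x. L x \<le> p x" "\<And>y. y \<in> E ` \<F> \<Longrightarrow> c \<le> L y"
    using Mazur_Orlicz[OF p, of "E ` \<F>" c] ne by blast
  show thesis
  proof
    show "mean S (\<lambda>F. L (E F))"
    proof
      fix F G :: "'s \<Rightarrow> real" and k
      assume F: "bounded_on S F"
      show "L (E (\<lambda>s. F s + G s)) = L (E F) + L (E G)" if "bounded_on S G"
        using F that by (simp add: Eadd linear_add[OF L(1)])
      show "L (E (\<lambda>s. k * F s)) = k * L (E F)"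
        using F by (simp add: Escale linear_scale[OF L(1)])
      show "L (E F) \<le> k" if k: "\<And>s. s \<in> S \<Longrightarrow> F s \<le> k"
      proof -
        have "p (E F) \<le> k"
          using k by (intro ple) (simp add: E[OF F] h_def discrete_inverse)
        then show ?thesis using L(2)[of "E F"] by simp
      qed
    qed
    show "c \<le> L (E F)" if "F \<in> \<F>" for F using L(3) that by simp
  qed
qed

subsection \<open>Finite rank operators\<close>

text \<open>The coefficients of a convergent sequence are Cauchy sequences of reals, so the limit is
  again a combination of \<open>B\<close>.\<close>

lemma closed_span_if_bounded_coefficients:
  fixes B :: "'x::real_normed_vector set"
  assumes B: "finite B" and K: "\<And>c b. b \<in> B \<Longrightarrow> \<bar>c b\<bar> \<le> K * norm (\<Sum>b\<in>B. c b *\<^sub>R b)"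
  shows "closed (span B)"
  unfolding closed_sequential_limits
proof (intro allI impI, elim conjE)
  fix v :: "nat \<Rightarrow> 'x" and l assume "\<forall>n. v n \<in> span B" and l: "v \<longlonglongrightarrow> l"
  then have "\<forall>n. \<exists>c. v n = (\<Sum>b\<in>B. c b *\<^sub>R b)"
    unfolding span_finite[OF B] by auto
  then obtain c where c: "\<And>n. v n = (\<Sum>b\<in>B. c n b *\<^sub>R b)" by metis
  have "Cauchy (\<lambda>n. c n b)" if b: "b \<in> B" for b
  proof (rule metric_CauchyI)
    fix e :: real assume "0 < e"
    moreover have "0 < \<bar>K\<bar> + 1" by simp
    ultimately have "0 < e / (\<bar>K\<bar> + 1)" by simp
    then obtain N where N: "\<And>m n. N \<le> m \<Longrightarrow> N \<le> n \<Longrightarrow> dist (v m) (v n) < e / (\<bar>K\<bar> + 1)"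
      using LIMSEQ_imp_Cauchy[OF l] unfolding Cauchy_def by metis
    show "\<exists>M. \<forall>m\<ge>M. \<forall>n\<ge>M. dist (c m b) (c n b) < e"
    proof (intro exI[of _ N] allI impI)
      fix m n assume mn: "N \<le> m" "N \<le> n"
      have "\<bar>c m b - c n b\<bar> \<le> K * norm (\<Sum>b\<in>B. (c m b - c n b) *\<^sub>R b)"
        by (rule K[OF b])
      also have "(\<Sum>b\<in>B. (c m b - c n b) *\<^sub>R b) = v m - v n"
        by (simp add: c scaleR_diff_left sum_subtractf)
      also have "K * norm (v m - v n) \<le> (\<bar>K\<bar> + 1) * dist (v m) (v n)"
        by (auto simp: dist_norm intro: mult_right_mono)
      also have "\<dots> < e"
        using N[OF mn] by (simp add: field_simps)
      finally show "dist (c m b) (c n b) < e" by (simp add: dist_real_def)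
    qed
  qed
  then have "\<forall>b\<in>B. \<exists>r. (\<lambda>n. c n b) \<longlonglongrightarrow> r"
    by (auto simp: Cauchy_convergent_iff convergent_def)
  then obtain r where "\<And>b. b \<in> B \<Longrightarrow> (\<lambda>n. c n b) \<longlonglongrightarrow> r b" by metis
  then have "(\<lambda>n. \<Sum>b\<in>B. c n b *\<^sub>R b) \<longlonglongrightarrow> (\<Sum>b\<in>B. r b *\<^sub>R b)"
    by (intro tendsto_sum tendsto_scaleR tendsto_const)
  then have "l = (\<Sum>b\<in>B. r b *\<^sub>R b)"
    using l LIMSEQ_unique unfolding c[symmetric] by blast
  then show "l \<in> span B"
    by (auto intro: span_sum span_scale span_base)
qed

text \<open>Continuity of the coordinates with respect to a finite basis. In the induction the bound
  for \<open>B\<close> makes \<open>span B\<close> closed, so the new vector \<open>x\<close> has a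
  positive distance from it, and this distance bounds its coefficient.\<close>

lemma independent_bounded_coefficients:
  fixes B :: "'x::real_normed_vector set"
  assumes "finite B" "independent B"
  shows "\<exists>K. \<forall>c. \<forall>b\<in>B. \<bar>c b\<bar> \<le> K * norm (\<Sum>b\<in>B. c b *\<^sub>R b)"
  using assms
proof (induction B)
  case (insert x B)
  then have ind: "independent B" "x \<notin> span B"
    using insert by (auto simp: independent_insert)
  then obtain K where K: "\<And>c b. b \<in> B \<Longrightarrow> \<bar>c b\<bar> \<le> K * norm (\<Sum>b\<in>B. c b *\<^sub>R b)"
    using insert by metis
  have ne: "span B \<noteq> {}" using span_zero[of B] by auto
  define \<delta> where "\<delta> = infdist x (span B)"
  have "\<delta> \<noteq> 0"
    using in_closed_iff_infdist_zero[OF closed_span_if_bounded_coefficients[OF insert(1) K] ne, of x] ind(2)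
    by (simp add: \<delta>_def)
  then have \<delta>: "0 < \<delta>" using infdist_nonneg[of x "span B"] by (simp add: \<delta>_def)
  \<comment> \<open>The first term serves the coefficient of \<open>x\<close>, the second the
    coefficients of \<open>B\<close> after the multiple of \<open>x\<close> has been
    subtracted.\<close>
  define K' where "K' = max (1 / \<delta>) (\<bar>K\<bar> * (1 + norm x / \<delta>))"
  have "\<bar>c b\<bar> \<le> K' * norm (\<Sum>b\<in>insert x B. c b *\<^sub>R b)" if b: "b \<in> insert x B" for c b
  proof -
    define v where "v = (\<Sum>b\<in>B. c b *\<^sub>R b)"
    define w where "w = (\<Sum>b\<in>insert x B. c b *\<^sub>R b)"
    have w: "w = c x *\<^sub>R x + v" using insert by (simp add: w_def v_def)
    have v: "v \<in> span B" unfolding v_def by (intro span_sum span_scale span_base)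
    have cx: "\<bar>c x\<bar> * \<delta> \<le> norm w"
    proof (cases "c x = 0")
      case False
      have "\<delta> \<le> dist x ((- inverse (c x)) *\<^sub>R v)"
        unfolding \<delta>_def by (intro infdist_le span_scale v)
      also have "dist x ((- inverse (c x)) *\<^sub>R v) = norm (inverse (c x) *\<^sub>R w)"
        using False by (simp add: dist_norm w scaleR_add_right)
      also have "\<dots> = norm w / \<bar>c x\<bar>" by (simp add: divide_inverse mult.commute)
      finally show ?thesis using False by (simp add: field_simps)
    qed simp
    show ?thesis
    proof (cases "b = x")
      case True
      have "\<bar>c x\<bar> \<le> (1 / \<delta>) * norm w" using cx \<delta> by (simp add: field_simps)
      also have "\<dots> \<le> K' * norm w" by (intro mult_right_mono) (auto simp: K'_def)
      finally show ?thesis using True by (simp add: w_def)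
    next
      case False
      then have "\<bar>c b\<bar> \<le> K * norm v" using K[of b c] b by (simp add: v_def)
      also have "\<dots> \<le> \<bar>K\<bar> * norm v" by (intro mult_right_mono) auto
      also have "norm v \<le> norm w + \<bar>c x\<bar> * norm x"
        using norm_triangle_ineq4[of w "c x *\<^sub>R x"] by (simp add: w)
      also have "\<bar>c x\<bar> * norm x \<le> norm w / \<delta> * norm x"
        using cx \<delta> by (intro mult_right_mono) (auto simp: field_simps)
      also have "\<bar>K\<bar> * (norm w + norm w / \<delta> * norm x) = \<bar>K\<bar> * (1 + norm x / \<delta>) * norm w"
        by (simp add: algebra_simps)
      also have "\<dots> \<le> K' * norm w" by (intro mult_right_mono) (auto simp: K'_def)
      finally show ?thesis by (simp add: w_def mult_left_mono)
    qed
  qed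
  then show ?case by blast
qed simp

text \<open>The coordinates of \<open>T y\<close> in a basis of a space containing the range of
  \<open>T\<close> are continuous in \<open>y\<close>; they are the functionals
  \<open>a i\<close>.\<close>

lemma finite_rank_blinfun_representation:
  fixes T :: "'y::real_normed_vector \<Rightarrow>\<^sub>L 'x::real_normed_vector"
  assumes "finite B" "range (blinfun_apply T) \<subseteq> span B"
  obtains n :: nat and a :: "nat \<Rightarrow> 'y \<Rightarrow>\<^sub>L real" and x :: "nat \<Rightarrow> 'x"
  where "\<And>y. blinfun_apply T y = (\<Sum>i<n. blinfun_apply (a i) y *\<^sub>R x i)"
proof -
  obtain D where D: "D \<subseteq> B" "independent D" "B \<subseteq> span D"
    using maximal_independent_subset by metis
  have fin: "finite D" using D assms finite_subset by blast
  have "span B \<subseteq> span D" using D span_minimal[OF D(3)] by simp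
  then have TD: "blinfun_apply T y \<in> span D" for y using assms by auto
  obtain K where K: "\<And>c b. b \<in> D \<Longrightarrow> \<bar>c b\<bar> \<le> K * norm (\<Sum>b\<in>D. c b *\<^sub>R b)"
    using independent_bounded_coefficients[OF fin D(2)] by metis
  define r where "r b y = representation D (blinfun_apply T y) b" for b y
  have sum: "(\<Sum>b\<in>D. r b y *\<^sub>R b) = blinfun_apply T y" for y
    unfolding r_def by (intro sum_representation_eq D TD fin) auto
  have bl: "bounded_linear (r b)" if b: "b \<in> D" for b
  proof (rule bounded_linear_intro[where K = "\<bar>K\<bar> * norm T"])
    show "r b (x + y) = r b x + r b y" for x y
      by (simp add: r_def blinfun.add_right representation_add[OF D(2) TD TD])
    show "r b (t *\<^sub>R x) = t *\<^sub>R r b x" for t x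
      by (simp add: r_def blinfun.scaleR_right representation_scale[OF D(2) TD])
    show "norm (r b x) \<le> norm x * (\<bar>K\<bar> * norm T)" for x
    proof -
      have "\<bar>r b x\<bar> \<le> K * norm (blinfun_apply T x)" using K[OF b, of "\<lambda>b. r b x"] sum by simp
      also have "\<dots> \<le> \<bar>K\<bar> * (norm T * norm x)"
        by (intro mult_mono norm_blinfun) auto
      finally show ?thesis by (simp add: algebra_simps)
    qed
  qed
  obtain e where e: "bij_betw e {0..<card D} D" using ex_bij_betw_nat_finite[OF fin] by blast
  have "blinfun_apply T y = (\<Sum>i<card D. blinfun_apply (Blinfun (r (e i))) y *\<^sub>R e i)" for y
  proof -
    have "blinfun_apply T y = (\<Sum>i\<in>{0..<card D}. r (e i) y *\<^sub>R e i)"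
      unfolding sum[symmetric] by (rule sum.reindex_bij_betw[OF e, symmetric])
    also have "\<dots> = (\<Sum>i<card D. blinfun_apply (Blinfun (r (e i))) y *\<^sub>R e i)"
      using bij_betwE[OF e]
      by (intro sum.cong) (auto simp: bounded_linear_Blinfun_apply bl)
    finally show ?thesis .
  qed
  then show thesis by (rule that)
qed

subsection \<open>Countably additive set functions\<close>

lemma vector_measureD:
  "vector_measure M m \<Longrightarrow> range A \<subseteq> sets M \<Longrightarrow> disjoint_family A \<Longrightarrow> (\<lambda>n::nat. m (A n)) sums m (\<Union>n. A n)"
  by (auto simp: vector_measure_def)

lemma vector_measure_empty:
  assumes "vector_measure M m"
  shows "m {} = 0"
proof -
  have "(\<lambda>n::nat. m {}) sums m {}"
    using vector_measureD[OF assms, of "\<lambda>_. {}"] by (simp add: disjoint_family_on_def)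
  then have "(\<lambda>n::nat. m {}) \<longlonglongrightarrow> 0"
    using sums_summable summable_LIMSEQ_zero by blast
  then show ?thesis by (simp add: LIMSEQ_const_iff)
qed

lemma vector_measure_Un:
  assumes m: "vector_measure M m" and A: "A \<in> sets M" "B \<in> sets M" "A \<inter> B = {}"
  shows "m (A \<union> B) = m A + m B"
proof -
  have "(\<lambda>n. m (binaryset A B n)) sums m (\<Union>n. binaryset A B n)"
    using A by (intro vector_measureD[OF m])
      (auto simp: binaryset_def disjoint_family_on_def split: if_splits)
  then show ?thesis
    using binaryset_sums[of m A B] vector_measure_empty[OF m]
    by (auto simp: UN_binaryset_eq intro: sums_unique2)
qed

lemma vector_measure_Diff:
  assumes m: "vector_measure M m" and A: "A \<in> sets M" "B \<in> sets M" "B \<subseteq> A"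
  shows "m (A - B) = m A - m B"
proof -
  have "m (B \<union> (A - B)) = m B + m (A - B)"
    using A by (intro vector_measure_Un[OF m]) auto
  moreover have "B \<union> (A - B) = A" using A by auto
  ultimately show ?thesis by simp
qed

lemma vector_measure_Int_Diff:
  assumes m: "vector_measure M m" and A: "A \<in> sets M" "B \<in> sets M"
  shows "m A = m (A \<inter> B) + m (A - B)"
proof -
  have "m (A \<inter> B \<union> (A - B)) = m (A \<inter> B) + m (A - B)"
    using A by (intro vector_measure_Un[OF m]) auto
  then show ?thesis by (simp add: Int_Diff_Un)
qed

lemma vector_measure_Un_Int:
  assumes m: "vector_measure M m" and A: "A \<in> sets M" "B \<in> sets M"
  shows "m (A \<union> B) + m (A \<inter> B) = m A + m B"
proof -
  have "m (A \<union> B) = m A + m (B - A)"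
    using vector_measure_Un[OF m, of A "B - A"] A by simp
  moreover have "m B = m (A \<inter> B) + m (B - A)"
    using vector_measure_Int_Diff[OF m, of B A] A by (simp add: Int_commute)
  ultimately show ?thesis by simp
qed

lemma vector_measure_Union:
  assumes m: "vector_measure M m" and P: "finite P" "P \<subseteq> sets M" "disjoint P"
  shows "m (\<Union>P) = (\<Sum>B\<in>P. m B)"
  using P
proof (induction P)
  case (insert A P)
  then have "A \<inter> \<Union>P = {}" by (auto simp: pairwise_insert disjnt_def)
  then have "m (\<Union>(insert A P)) = m A + m (\<Union>P)"
    using insert.hyps insert.prems by (auto intro!: vector_measure_Un[OF m] sets.finite_Union)
  also have "m (\<Union>P) = (\<Sum>B\<in>P. m B)"
    using insert.prems by (intro insert.IH) (auto simp: pairwise_insert)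
  finally show ?case using insert by simp
qed (simp add: vector_measure_empty[OF m])

lemma vector_measure_incseq:
  assumes m: "vector_measure M m" and A: "range A \<subseteq> sets M" "incseq A"
  shows "(\<lambda>n. m (A n)) \<longlonglongrightarrow> m (\<Union>n. A n)"
proof -
  have D: "disjointed A n \<in> sets M" for n
    using A by (intro sets.range_disjointed_sets[THEN subsetD]) auto
  have "(\<lambda>n. m (disjointed A n)) sums m (\<Union>n. disjointed A n)"
    using D by (intro vector_measureD[OF m]) (auto simp: disjoint_family_disjointed)
  moreover have "(\<Sum>i<Suc n. m (disjointed A i)) = m (A n)" for n
  proof (induction n)
    case 0
    then show ?case by (simp add: disjointed_def)
  next
    case (Suc n)
    have "disjointed A (Suc n) = A (Suc n) - A n"
      using A(2) by (rule disjointed_mono)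
    moreover have "m (A (Suc n) - A n) = m (A (Suc n)) - m (A n)"
      using A by (intro vector_measure_Diff[OF m]) (auto dest: incseq_SucD)
    ultimately show ?case using Suc by simp
  qed
  ultimately show ?thesis
    unfolding sums_def UN_disjointed_eq by (subst (asm) filterlim_sequentially_Suc[symmetric]) simp
qed

lemma vector_measure_decseq:
  assumes m: "vector_measure M m" and A: "range A \<subseteq> sets M" "decseq A"
  shows "(\<lambda>n. m (A n)) \<longlonglongrightarrow> m (\<Inter>n. A n)"
proof -
  have sub: "A n \<subseteq> A 0" for n using A(2) by (auto simp: decseq_def)
  have "(\<lambda>n. m (A 0 - A n)) \<longlonglongrightarrow> m (\<Union>n. A 0 - A n)"
    using A by (intro vector_measure_incseq[OF m]) (auto simp: monotone_def)
  moreover have "m (A 0 - A n) = m (A 0) - m (A n)" for n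
    using A sub by (intro vector_measure_Diff[OF m]) auto
  moreover have "(\<Union>n. A 0 - A n) = A 0 - (\<Inter>n. A n)" by auto
  moreover have "m (A 0 - (\<Inter>n. A n)) = m (A 0) - m (\<Inter>n. A n)"
    using A sub by (intro vector_measure_Diff[OF m]) auto
  ultimately have "(\<lambda>n. m (A 0) - m (A n)) \<longlonglongrightarrow> m (A 0) - m (\<Inter>n. A n)" by simp
  from tendsto_diff[OF tendsto_const[of "m (A 0)"] this] show ?thesis by simp
qed

text \<open>If \<open>\<nu>\<close> is unbounded on the subsets of \<open>E\<close>, it is so on one
  half of a splitting of \<open>E\<close>, and the splitting can be chosen such that the discarded
  half has measure at least 1 in modulus. Repeating this yields disjoint sets whose measures do not
  tend to zero.\<close>

lemma real_measure_bounded: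
  fixes \<nu> :: "'a set \<Rightarrow> real"
  assumes \<nu>: "vector_measure M \<nu>"
  obtains K where "\<And>A. A \<in> sets M \<Longrightarrow> \<bar>\<nu> A\<bar> \<le> K"
proof -
  define U where "U E \<longleftrightarrow> E \<in> sets M \<and> (\<forall>K. \<exists>A\<in>sets M. A \<subseteq> E \<and> K < \<bar>\<nu> A\<bar>)" for E
  have step: "\<exists>E'. U E' \<and> E' \<subseteq> E \<and> 1 \<le> \<bar>\<nu> (E - E')\<bar>" if E: "U E" for E
  proof -
    \<comment> \<open>The margin over \<open>\<bar>\<nu> E\<bar>\<close> makes both
      \<open>\<nu> A\<close> and \<open>\<nu> (E - A)\<close> at least 1 in modulus, whichever half
      is kept.\<close>
    obtain A where A: "A \<in> sets M" "A \<subseteq> E" "\<bar>\<nu> E\<bar> + 1 < \<bar>\<nu> A\<bar>"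
      using E unfolding U_def by blast
    have Es: "E \<in> sets M" using E by (simp add: U_def)
    have d: "\<nu> (E - A) = \<nu> E - \<nu> A" using A Es by (intro vector_measure_Diff[OF \<nu>]) auto
    have "U A \<or> U (E - A)"
    proof (rule ccontr)
      assume "\<not> ?thesis"
      then obtain K L where K: "\<And>B. B \<in> sets M \<Longrightarrow> B \<subseteq> A \<Longrightarrow> \<bar>\<nu> B\<bar> \<le> K"
        and L: "\<And>B. B \<in> sets M \<Longrightarrow> B \<subseteq> E - A \<Longrightarrow> \<bar>\<nu> B\<bar> \<le> L"
        using A Es unfolding U_def by (meson linorder_not_le sets.Diff)
      have "\<bar>\<nu> B\<bar> \<le> K + L" if "B \<in> sets M" "B \<subseteq> E" for B
      proof -
        have "\<bar>\<nu> (B \<inter> A)\<bar> \<le> K" "\<bar>\<nu> (B - A)\<bar> \<le> L" using that A by (auto intro: K L)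
        then show ?thesis using vector_measure_Int_Diff[OF \<nu> that(1) A(1)] by linarith
      qed
      then show False using E unfolding U_def by (meson linorder_not_le)
    qed
    then show ?thesis
    proof
      assume "U A"
      then show ?thesis using A d by (intro exI[of _ A]) auto
    next
      assume "U (E - A)"
      moreover have "E - (E - A) = A" using A by auto
      ultimately show ?thesis using A by (intro exI[of _ "E - A"]) auto
    qed
  qed
  have "\<not> U (space M)"
  proof
    assume U0: "U (space M)"
    obtain E where E: "\<And>n::nat. U (E n)" "\<And>n. E (Suc n) \<subseteq> E n \<and> 1 \<le> \<bar>\<nu> (E n - E (Suc n))\<bar>"
      using dependent_nat_choice[of "\<lambda>_. U" "\<lambda>_ E E'. E' \<subseteq> E \<and> 1 \<le> \<bar>\<nu> (E - E')\<bar>"] U0 step by metis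
    have dec: "E j \<subseteq> E i" if "i \<le> j" for i j
      using E(2) that lift_Suc_antimono_le[of E i j] by blast
    have "(E i - E (Suc i)) \<inter> (E j - E (Suc j)) = {}" if "i < j" for i j
      using dec[of "Suc i" j] that by auto
    then have "disjoint_family (\<lambda>n. E n - E (Suc n))"
      unfolding disjoint_family_on_def by (metis Int_commute linorder_neqE_nat)
    then have "(\<lambda>n. \<nu> (E n - E (Suc n))) sums \<nu> (\<Union>n. E n - E (Suc n))"
      using E(1) by (intro vector_measureD[OF \<nu>]) (auto simp: U_def)
    then have "(\<lambda>n. \<nu> (E n - E (Suc n))) \<longlonglongrightarrow> 0"
      using sums_summable summable_LIMSEQ_zero by blast
    then have "eventually (\<lambda>n. \<bar>\<nu> (E n - E (Suc n))\<bar> < 1) sequentially"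
      by (auto dest!: tendstoD[where e = 1])
    then obtain n where "\<bar>\<nu> (E n - E (Suc n))\<bar> < 1" by (auto simp: eventually_sequentially)
    then show False using E(2)[of n] by auto
  qed
  then obtain K where K: "\<forall>A\<in>sets M. A \<subseteq> space M \<longrightarrow> \<bar>\<nu> A\<bar> \<le> K"
    unfolding U_def by (auto simp: not_less)
  show thesis
  proof (rule that)
    fix A assume "A \<in> sets M"
    then show "\<bar>\<nu> A\<bar> \<le> K" using K sets.sets_into_space[of A M] by simp
  qed
qed

section \<open>The Hahn decomposition and the variation expressed by it\<close>

definition Hahn_set :: "'a measure \<Rightarrow> ('a set \<Rightarrow> real) \<Rightarrow> 'a set \<Rightarrow> bool" where
  "Hahn_set M \<nu> P \<longleftrightarrow> P \<in> sets M \<and> (\<forall>A\<in>sets M. A \<subseteq> P \<longrightarrow> 0 \<le> \<nu> A) \<and>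
     (\<forall>A\<in>sets M. A \<inter> P = {} \<longrightarrow> \<nu> A \<le> 0)"

text \<open>The supremum \<open>s\<close> of \<open>\<nu>\<close> is attained at the limit superior
  of sets \<open>A n\<close> whose deficits are below \<open>(1/2)^n\<close>: deficits add up under
  unions, and these are summable. A set of maximal measure has only nonnegative subsets and meets no
  positive set outside.\<close>

theorem Hahn_decomposition:
  fixes \<nu> :: "'a set \<Rightarrow> real"
  assumes \<nu>: "vector_measure M \<nu>"
  obtains P where "Hahn_set M \<nu> P"
proof -
  obtain K where K: "\<And>A. A \<in> sets M \<Longrightarrow> \<bar>\<nu> A\<bar> \<le> K" using real_measure_bounded[OF \<nu>] by metis
  define s where "s = (SUP A\<in>sets M. \<nu> A)"
  have "bdd_above (\<nu> ` sets M)" using K by (intro bdd_aboveI[of _ K]) force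
  then have le: "\<nu> A \<le> s" if "A \<in> sets M" for A
    unfolding s_def using that by (rule cSUP_upper2) auto
  have "\<exists>A\<in>sets M. s - (1/2)^n < \<nu> A" for n :: nat
  proof (rule ccontr)
    assume "\<not> ?thesis"
    then have "s \<le> s - (1/2)^n" unfolding s_def by (intro cSUP_least) (auto simp: not_less)
    moreover have "0 < (1/2 :: real)^n" by simp
    ultimately show False by linarith
  qed
  then obtain A where A: "\<And>n::nat. A n \<in> sets M" "\<And>n. s - (1/2)^n < \<nu> (A n)" by metis
  define V where "V n = (\<Union>i\<in>{n..}. A i)" for n
  have V: "V n \<in> sets M" for n unfolding V_def using A(1) by auto
  have Vs: "s - 2 * (1/2)^n \<le> \<nu> (V n)" for n
  proof -
    define U where "U k = (\<Union>i\<in>{n..n+k}. A i)" for k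
    have U: "U k \<in> sets M" for k unfolding U_def using A(1) by auto
    \<comment> \<open>The bracket is the sum of the deficits from \<open>n\<close> to
      \<open>n + k\<close>. Adding one more set adds at most its own deficit, as the intersection
      has measure at most \<open>s\<close>.\<close>
    have bd: "s - (2 * (1/2)^n - (1/2)^(n+k)) \<le> \<nu> (U k)" for k
    proof (induction k)
      case 0
      have "U 0 = A n" by (auto simp: U_def)
      then show ?case using A(2)[of n] by simp
    next
      case (Suc k)
      have "{n..n + Suc k} = insert (n + Suc k) {n..n+k}" by auto
      then have "U (Suc k) = U k \<union> A (n + Suc k)" by (auto simp: U_def)
      then have "\<nu> (U (Suc k)) + \<nu> (U k \<inter> A (n + Suc k)) = \<nu> (U k) + \<nu> (A (n + Suc k))"
        using vector_measure_Un_Int[OF \<nu> U A(1)] by simp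
      moreover have "\<nu> (U k \<inter> A (n + Suc k)) \<le> s" using U A(1) by (intro le) auto
      ultimately show ?case using Suc A(2)[of "n + Suc k"] by simp
    qed
    have "(\<lambda>k. \<nu> (U k)) \<longlonglongrightarrow> \<nu> (\<Union>k. U k)"
    proof (intro vector_measure_incseq[OF \<nu>])
      have "U i \<subseteq> U j" if "i \<le> j" for i j
        unfolding U_def using that by (intro UN_mono) auto
      then show "incseq U" by (auto simp: incseq_def)
    qed (use U in auto)
    moreover have "(\<Union>k. U k) = V n"
    proof -
      have "x \<in> (\<Union>k. U k)" if "i \<ge> n" "x \<in> A i" for x i
        using that by (auto simp: U_def intro!: exI[of _ "i - n"] bexI[of _ i])
      then show ?thesis by (auto simp: U_def V_def)
    qed
    moreover have "s - 2 * (1/2)^n \<le> \<nu> (U k)" for k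
    proof -
      have "0 < (1/2 :: real)^(n+k)" by simp
      then show ?thesis using bd[of k] by linarith
    qed
    ultimately show ?thesis by (auto intro: LIMSEQ_le_const)
  qed
  define P where "P = (\<Inter>n. V n)"
  have P: "P \<in> sets M" unfolding P_def using V by auto
  have "(\<lambda>n. \<nu> (V n)) \<longlonglongrightarrow> \<nu> P"
    unfolding P_def
  proof (intro vector_measure_decseq[OF \<nu>])
    have "V j \<subseteq> V i" if "i \<le> j" for i j
      unfolding V_def using that by (intro UN_mono) auto
    then show "decseq V" by (auto simp: decseq_def)
  qed (use V in auto)
  moreover have "(\<lambda>n. s - 2 * (1/2)^n) \<longlonglongrightarrow> s - 2 * 0"
    by (intro tendsto_intros LIMSEQ_power_zero) auto
  ultimately have "s - 2 * 0 \<le> \<nu> P"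
    using Vs by (intro LIMSEQ_le[of "\<lambda>n. s - 2 * (1/2)^n" _ "\<lambda>n. \<nu> (V n)"]) auto
  then have Ps: "s \<le> \<nu> P" by simp
  have "0 \<le> \<nu> A" if "A \<in> sets M" "A \<subseteq> P" for A
    using vector_measure_Diff[OF \<nu> P that] le[of "P - A"] that P Ps by auto
  moreover have "\<nu> A \<le> 0" if "A \<in> sets M" "A \<inter> P = {}" for A
    using vector_measure_Un[OF \<nu> P that(1)] le[of "P \<union> A"] that P Ps by (auto simp: Int_commute)
  ultimately show thesis using P that[of P] by (simp add: Hahn_set_def)
qed

lemma vector_measure_restrict:
  assumes "vector_measure M m" "P \<in> sets M"
  shows "vector_measure M (\<lambda>A. m (A \<inter> P))" "vector_measure M (\<lambda>A. m (A - P))"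
  unfolding vector_measure_def
proof safe
  fix A :: "nat \<Rightarrow> 'a set" assume A: "range A \<subseteq> sets M" "disjoint_family A"
  have "(\<lambda>n. m (A n \<inter> P)) sums m (\<Union>n. A n \<inter> P)"
    using A assms(2) by (intro vector_measureD[OF assms(1)]) (auto simp: disjoint_family_on_def)
  then show "(\<lambda>n. m (A n \<inter> P)) sums m ((\<Union>n. A n) \<inter> P)" by simp
  have "(\<lambda>n. m (A n - P)) sums m (\<Union>n. A n - P)"
    using A assms(2) by (intro vector_measureD[OF assms(1)]) (auto simp: disjoint_family_on_def)
  then show "(\<lambda>n. m (A n - P)) sums m ((\<Union>n. A n) - P)" by simp
qed

lemma vector_measure_diff:
  "vector_measure M m \<Longrightarrow> vector_measure M m' \<Longrightarrow> vector_measure M (\<lambda>A. m A - m' A)"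
  by (simp add: vector_measure_def sums_diff)

lemma vector_measure_uminus:
  "vector_measure M m \<Longrightarrow> vector_measure M (\<lambda>A. - m A)"
  by (simp add: vector_measure_def sums_minus)

lemma vector_measure_scalar_measure:
  "vector_measure M m \<Longrightarrow> vector_measure M (scalar_measure m \<phi>)"
  by (simp add: vector_measure_def scalar_measure_def bounded_linear.sums[OF blinfun.bounded_linear_right])

lemma emeasure_measure_of_nonneg:
  fixes \<rho> :: "'a set \<Rightarrow> real"
  assumes \<rho>: "vector_measure M \<rho>" and nn: "\<And>A. A \<in> sets M \<Longrightarrow> 0 \<le> \<rho> A"
  shows "A \<in> sets M \<Longrightarrow> emeasure (measure_of (space M) (sets M) (\<lambda>A. ennreal (\<rho> A))) A = ennreal (\<rho> A)"
proof (rule emeasure_measure_of_sigma)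
  show "sigma_algebra (space M) (sets M)" by (rule sets.sigma_algebra_axioms)
  show "positive (sets M) (\<lambda>A. ennreal (\<rho> A))"
    by (simp add: positive_def vector_measure_empty[OF \<rho>])
  show "countably_additive (sets M) (\<lambda>A. ennreal (\<rho> A))"
  proof (rule countably_additiveI)
    fix A :: "nat \<Rightarrow> 'a set" assume A: "range A \<subseteq> sets M" "disjoint_family A"
    then have "A i \<in> sets M" for i by auto
    then show "(\<Sum>i. ennreal (\<rho> (A i))) = ennreal (\<rho> (\<Union>i. A i))"
      using vector_measureD[OF \<rho> A] nn by (intro suminf_ennreal_eq) simp_all
  qed
qed

context
  fixes M :: "'a measure" and \<nu> :: "'a set \<Rightarrow> real" and P :: "'a set"
  assumes \<nu>: "vector_measure M \<nu>" and Hahn: "Hahn_set M \<nu> P"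
begin

private lemma P: "P \<in> sets M"
  and pos: "\<And>A. A \<in> sets M \<Longrightarrow> A \<subseteq> P \<Longrightarrow> 0 \<le> \<nu> A"
  and neg: "\<And>A. A \<in> sets M \<Longrightarrow> A \<inter> P = {} \<Longrightarrow> \<nu> A \<le> 0"
  using Hahn by (auto simp: Hahn_set_def)

lemma Hahn_pos: "A \<in> sets M \<Longrightarrow> 0 \<le> \<nu> (A \<inter> P)"
  and Hahn_neg: "A \<in> sets M \<Longrightarrow> \<nu> (A - P) \<le> 0"
  using P by (auto intro: pos neg)

lemma vector_measure_Hahn_variation: "vector_measure M (\<lambda>A. \<nu> (A \<inter> P) - \<nu> (A - P))"
  by (rule vector_measure_diff[OF vector_measure_restrict[OF \<nu> P]])

lemma abs_le_Hahn_variation: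
  assumes "A \<in> sets M"
  shows "\<bar>\<nu> A\<bar> \<le> \<nu> (A \<inter> P) - \<nu> (A - P)"
  using vector_measure_Int_Diff[OF \<nu> assms P] Hahn_pos[OF assms] Hahn_neg[OF assms] by simp

lemma total_variation_Hahn:
  assumes A: "A \<in> sets M"
  shows "total_variation M \<nu> A = ennreal (\<nu> (A \<inter> P) - \<nu> (A - P))"
proof (rule antisym)
  let ?\<rho> = "\<lambda>A. \<nu> (A \<inter> P) - \<nu> (A - P)"
  have nn: "0 \<le> ?\<rho> B" if "B \<in> sets M" for B using abs_le_Hahn_variation[OF that] by simp
  show "total_variation M \<nu> A \<le> ennreal (?\<rho> A)"
    unfolding total_variation_def
  proof (rule SUP_least, safe)
    fix Q assume Q: "finite Q" "Q \<subseteq> sets M" "disjoint Q" "A = \<Union>Q"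
    have "(\<Sum>B\<in>Q. ennreal \<bar>\<nu> B\<bar>) \<le> (\<Sum>B\<in>Q. ennreal (?\<rho> B))"
      using Q by (intro sum_mono ennreal_leI abs_le_Hahn_variation) auto
    also have "\<dots> = ennreal (\<Sum>B\<in>Q. ?\<rho> B)"
      using Q by (intro sum_ennreal nn) auto
    also have "(\<Sum>B\<in>Q. ?\<rho> B) = ?\<rho> (\<Union>Q)"
      using Q by (intro vector_measure_Union[symmetric, OF vector_measure_Hahn_variation])
    finally show "(\<Sum>B\<in>Q. ennreal \<bar>\<nu> B\<bar>) \<le> ennreal (?\<rho> (\<Union>Q))" .
  qed
  have "(\<Sum>B\<in>{A \<inter> P, A - P}. ennreal \<bar>\<nu> B\<bar>) \<le> total_variation M \<nu> A"
    unfolding total_variation_def using A P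
    by (intro SUP_upper) (auto simp: disjoint_def)
  moreover have "(\<Sum>B\<in>{A \<inter> P, A - P}. ennreal \<bar>\<nu> B\<bar>) = ennreal (?\<rho> A)"
  \<comment> \<open>When the two parts coincide both are empty, and the partition collapses to one
    set.\<close>
  proof (cases "A \<inter> P = A - P")
    case True
    then have "A = {}" by auto
    then show ?thesis by (simp add: vector_measure_empty[OF \<nu>])
  next
    case False
    then show ?thesis using Hahn_pos[OF A] Hahn_neg[OF A]
      by (simp add: ennreal_plus[symmetric] del: ennreal_plus)
  qed
  ultimately show "ennreal (?\<rho> A) \<le> total_variation M \<nu> A" by simp
qed

lemma positive_part_Hahn:
  assumes A: "A \<in> sets M"
  shows "(SUP B \<in> {B \<in> sets M. B \<subseteq> A}. ennreal (\<nu> B)) = ennreal (\<nu> (A \<inter> P))"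
proof (rule antisym)
  show "(SUP B \<in> {B \<in> sets M. B \<subseteq> A}. ennreal (\<nu> B)) \<le> ennreal (\<nu> (A \<inter> P))"
  proof (rule SUP_least, safe intro!: ennreal_leI)
    fix B assume B: "B \<in> sets M" "B \<subseteq> A"
    have "\<nu> B \<le> \<nu> (B \<inter> P)"
      using vector_measure_Int_Diff[OF \<nu> B(1) P] Hahn_neg[OF B(1)] by simp
    also have "\<dots> \<le> \<nu> (B \<inter> P) + \<nu> (A \<inter> P - B \<inter> P)"
      using pos[of "A \<inter> P - B \<inter> P"] A B P by auto
    also have "\<dots> = \<nu> (A \<inter> P)"
    proof -
      have "B \<inter> P \<subseteq> A \<inter> P" using B by blast
      then show ?thesis using A B P vector_measure_Diff[OF \<nu>, of "A \<inter> P" "B \<inter> P"] by simp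
    qed
    finally show "\<nu> B \<le> \<nu> (A \<inter> P)" .
  qed
  show "ennreal (\<nu> (A \<inter> P)) \<le> (SUP B \<in> {B \<in> sets M. B \<subseteq> A}. ennreal (\<nu> B))"
  proof (rule SUP_upper)
    show "A \<inter> P \<in> {B \<in> sets M. B \<subseteq> A}" using A P by auto
  qed
qed

lemma emeasure_variation_measure_Hahn:
  assumes "A \<in> sets M"
  shows "emeasure (variation_measure M \<nu>) A = ennreal (\<nu> (A \<inter> P) - \<nu> (A - P))"
proof -
  have "variation_measure M \<nu> = measure_of (space M) (sets M) (\<lambda>A. ennreal (\<nu> (A \<inter> P) - \<nu> (A - P)))"
    unfolding variation_measure_def
    by (intro measure_of_eq) (auto simp: sets.space_closed sets.sigma_sets_eq total_variation_Hahn)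
  moreover have "0 \<le> \<nu> (A \<inter> P) - \<nu> (A - P)" if "A \<in> sets M" for A
    using abs_le_Hahn_variation[OF that] by simp
  ultimately show ?thesis
    using emeasure_measure_of_nonneg[OF vector_measure_Hahn_variation _ assms] by simp
qed

end

lemma abs_le_variation_measure:
  fixes \<nu> :: "'a set \<Rightarrow> real"
  assumes \<nu>: "vector_measure M \<nu>" and A: "A \<in> sets M"
  shows "ennreal \<bar>\<nu> A\<bar> \<le> emeasure (variation_measure M \<nu>) A"
proof -
  obtain P where P: "Hahn_set M \<nu> P" using Hahn_decomposition[OF \<nu>] .
  show ?thesis
    unfolding emeasure_variation_measure_Hahn[OF \<nu> P A]
    by (intro ennreal_leI abs_le_Hahn_variation[OF \<nu> P A])
qed

subsection \<open>Densities\<close>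

lemma integrable_indicator_times:
  fixes f :: "'a \<Rightarrow> real"
  shows "A \<in> sets \<mu> \<Longrightarrow> integrable \<mu> f \<Longrightarrow> integrable \<mu> (\<lambda>x. indicat_real A x * f x)"
  using integrable_mult_indicator[of A \<mu> f] by simp

lemma nonneg_density:
  fixes \<rho> :: "'a set \<Rightarrow> real"
  assumes \<rho>: "vector_measure M \<rho>" and nn: "\<And>A. A \<in> sets M \<Longrightarrow> 0 \<le> \<rho> A"
    and \<mu>: "finite_measure \<mu>" "sets \<mu> = sets M"
    and ac: "\<And>A. A \<in> sets M \<Longrightarrow> emeasure \<mu> A = 0 \<Longrightarrow> \<rho> A = 0"
  obtains b where "integrable \<mu> b" "\<And>A. A \<in> sets M \<Longrightarrow> \<rho> A = set_lebesgue_integral \<mu> A b"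
proof -
  interpret finite_measure \<mu> by fact
  define N where "N = measure_of (space M) (sets M) (\<lambda>A. ennreal (\<rho> A))"
  have sN: "sets N = sets \<mu>" "space N = space \<mu>"
    using \<mu>(2) sets_eq_imp_space_eq[OF \<mu>(2)] by (auto simp: N_def)
  have eN: "emeasure N A = ennreal (\<rho> A)" if "A \<in> sets M" for A
    unfolding N_def using that by (intro emeasure_measure_of_nonneg \<rho> nn)
  have fN: "finite_measure N"
  proof (rule finite_measureI)
    have "space N \<in> sets M" using sets.top[of N] sN \<mu>(2) by simp
    then show "emeasure N (space N) \<noteq> \<infinity>" using eN by simp
  qed
  have acN: "absolutely_continuous \<mu> N"
    using \<mu>(2) ac eN by (auto simp: absolutely_continuous_def null_sets_def sN)
  obtain D where D: "D \<in> borel_measurable \<mu>" "AE x in \<mu>. RN_deriv \<mu> N x = ennreal (D x)" "\<And>x. 0 \<le> D x"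
    using real_RN_deriv[OF fN acN sN(1)] by metis
  have "density \<mu> (RN_deriv \<mu> N) = N" using density_RN_deriv[OF acN sN(1)] .
  moreover have "density \<mu> (RN_deriv \<mu> N) = density \<mu> D"
    using D by (intro density_cong) auto
  ultimately have dN: "density \<mu> D = N" by simp
  have nni: "(\<integral>\<^sup>+x\<in>A. ennreal (D x) \<partial>\<mu>) = ennreal (\<rho> A)" if "A \<in> sets M" for A
    using emeasure_density[of D \<mu> A] D(1) that \<mu>(2) eN dN by simp
  have space: "space \<mu> \<in> sets M" using \<mu>(2) by auto
  have int: "integrable \<mu> D"
  proof (rule integrableI_nonneg)
    have "(\<integral>\<^sup>+x. ennreal (D x) \<partial>\<mu>) = (\<integral>\<^sup>+x\<in>space \<mu>. ennreal (D x) \<partial>\<mu>)"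
      by (intro nn_integral_cong) auto
    then show "(\<integral>\<^sup>+x. ennreal (D x) \<partial>\<mu>) < \<infinity>" using nni[OF space] by simp
  qed (use D in auto)
  show thesis
  proof
    show "integrable \<mu> D" by fact
    show "\<rho> A = set_lebesgue_integral \<mu> A D" if A: "A \<in> sets M" for A
    proof -
      have "set_lebesgue_integral \<mu> A D = enn2real (\<integral>\<^sup>+x. ennreal (indicator A x * D x) \<partial>\<mu>)"
        unfolding set_lebesgue_integral_def real_scaleR_def
        using D A \<mu>(2) by (intro integral_eq_nn_integral) auto
      also have "(\<integral>\<^sup>+x. ennreal (indicator A x * D x) \<partial>\<mu>) = (\<integral>\<^sup>+x\<in>A. ennreal (D x) \<partial>\<mu>)"
        by (intro nn_integral_cong) (auto split: split_indicator)
      finally show ?thesis using nni[OF A] nn[OF A] by simp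
    qed
  qed
qed

theorem signed_density:
  fixes \<nu> :: "'a set \<Rightarrow> real"
  assumes \<nu>: "vector_measure M \<nu>" and \<mu>: "finite_measure \<mu>" "sets \<mu> = sets M"
    and ac: "\<And>A. A \<in> sets M \<Longrightarrow> emeasure \<mu> A = 0 \<Longrightarrow> \<nu> A = 0"
  obtains b where "integrable \<mu> b" "\<And>A. A \<in> sets M \<Longrightarrow> \<nu> A = set_lebesgue_integral \<mu> A b"
proof -
  obtain P where Hahn: "Hahn_set M \<nu> P" using Hahn_decomposition[OF \<nu>] .
  then have P: "P \<in> sets M" by (simp add: Hahn_set_def)
  have null: "emeasure \<mu> B = 0" if "A \<in> sets M" "B \<in> sets M" "B \<subseteq> A" "emeasure \<mu> A = 0" for A B
    using emeasure_mono[of B A \<mu>] that \<mu>(2) by simp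
  obtain b where b: "integrable \<mu> b" "\<And>A. A \<in> sets M \<Longrightarrow> \<nu> (A \<inter> P) = set_lebesgue_integral \<mu> A b"
  proof (rule nonneg_density[OF vector_measure_restrict(1)[OF \<nu> P] _ \<mu>])
    fix A assume A: "A \<in> sets M"
    show "0 \<le> \<nu> (A \<inter> P)" by (rule Hahn_pos[OF \<nu> Hahn A])
    show "\<nu> (A \<inter> P) = 0" if "emeasure \<mu> A = 0"
      using null[OF A _ _ that, of "A \<inter> P"] A P by (intro ac) auto
  qed blast
  obtain c where c: "integrable \<mu> c" "\<And>A. A \<in> sets M \<Longrightarrow> - \<nu> (A - P) = set_lebesgue_integral \<mu> A c"
  proof (rule nonneg_density[OF vector_measure_uminus[OF vector_measure_restrict(2)[OF \<nu> P]] _ \<mu>])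
    fix A assume A: "A \<in> sets M"
    show "0 \<le> - \<nu> (A - P)" using Hahn_neg[OF \<nu> Hahn A] by simp
    show "- \<nu> (A - P) = 0" if "emeasure \<mu> A = 0"
      using null[OF A _ _ that, of "A - P"] A P ac[of "A - P"] by auto
  qed blast
  show thesis
  proof
    show "integrable \<mu> (\<lambda>x. b x - c x)" using b c by simp
    fix A assume A: "A \<in> sets M"
    have "set_lebesgue_integral \<mu> A (\<lambda>x. b x - c x) = set_lebesgue_integral \<mu> A b - set_lebesgue_integral \<mu> A c"
      using A b c \<mu>(2)
      by (intro set_integral_diff) (auto simp: set_integrable_def intro!: integrable_indicator_times)
    then show "\<nu> A = set_lebesgue_integral \<mu> A (\<lambda>x. b x - c x)"
      using b(2)[OF A] c(2)[OF A] vector_measure_Int_Diff[OF \<nu> A P] by simp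
  qed
qed

lemma vector_measure_set_integral:
  fixes b :: "'a \<Rightarrow> real"
  assumes "integrable \<mu> b" "sets \<mu> = sets M" "\<And>A. A \<in> sets M \<Longrightarrow> \<nu> A = set_lebesgue_integral \<mu> A b"
  shows "vector_measure M \<nu>"
  unfolding vector_measure_def
proof safe
  fix A :: "nat \<Rightarrow> 'a set" assume A: "range A \<subseteq> sets M" "disjoint_family A"
  have int: "set_integrable \<mu> B b" if "B \<in> sets M" for B
    using that assms(1,2) by (simp add: set_integrable_def integrable_indicator_times)
  have "(\<lambda>n. set_lebesgue_integral \<mu> (\<Union>i<n. A i) b) \<longlonglongrightarrow> set_lebesgue_integral \<mu> (\<Union>n. \<Union>i<n. A i) b"
  proof (rule set_integral_cont_up)
    show "incseq (\<lambda>n. \<Union>i<n. A i)"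
      by (intro incseq_SucI UN_mono) auto
    show "(\<Union>i<n. A i) \<in> sets \<mu>" for n using A(1) assms(2) by (auto intro!: sets.finite_UN)
    show "set_integrable \<mu> (\<Union>n. \<Union>i<n. A i) b" using A(1) by (intro int) auto
  qed
  moreover have "set_lebesgue_integral \<mu> (\<Union>i<n. A i) b = (\<Sum>i<n. set_lebesgue_integral \<mu> (A i) b)" for n
    using A assms(2)
    by (intro set_integral_finite_Union int) (auto simp: disjoint_family_on_def)
  moreover have "(\<Union>n. \<Union>i<n. A i) = (\<Union>n. A n)" by auto
  ultimately have "(\<lambda>n. set_lebesgue_integral \<mu> (A n) b) sums set_lebesgue_integral \<mu> (\<Union>n. A n) b"
    by (simp add: sums_def)
  moreover have "A n \<in> sets M" "(\<Union>n. A n) \<in> sets M" for n using A by auto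
  ultimately show "(\<lambda>n. \<nu> (A n)) sums \<nu> (\<Union>n. A n)" using assms(3) by simp
qed

context
  fixes M \<mu> :: "'a measure" and \<nu> :: "'a set \<Rightarrow> real" and b :: "'a \<Rightarrow> real"
  assumes sets: "sets \<mu> = sets M" and b: "integrable \<mu> b"
    and \<nu>: "\<And>A. A \<in> sets M \<Longrightarrow> \<nu> A = set_lebesgue_integral \<mu> A b"
begin

text \<open>The set where the density is nonnegative is a Hahn set, which makes the general formulas
  for the variation and the positive part explicit.\<close>

private definition "P = {x \<in> space M. 0 \<le> b x}"

private lemma space: "space \<mu> = space M"
  using sets by (rule sets_eq_imp_space_eq)

private lemma P_sets: "P \<in> sets M"
proof -
  have "b \<in> borel_measurable M" using b measurable_cong_sets[OF sets refl] by auto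
  then show ?thesis unfolding P_def by measurable
qed

private lemma set_int: "A \<in> sets M \<Longrightarrow> integrable \<mu> (\<lambda>x. indicat_real A x * b x)"
  using integrable_indicator_times[of A \<mu> b] b sets by simp

private lemma Hahn: "Hahn_set M \<nu> P"
proof -
  have "0 \<le> \<nu> A" if A: "A \<in> sets M" "A \<subseteq> P" for A
  proof -
    have "0 \<le> (\<integral>x. indicat_real A x * b x \<partial>\<mu>)"
      using A by (intro integral_nonneg_AE AE_I2) (auto simp: P_def split: split_indicator)
    then show ?thesis using \<nu>[OF A(1)] by (simp add: set_lebesgue_integral_def)
  qed
  moreover have "\<nu> A \<le> 0" if A: "A \<in> sets M" "A \<inter> P = {}" for A
  proof -
    have "0 \<le> (\<integral>x. - (indicat_real A x * b x) \<partial>\<mu>)"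
      using A by (intro integral_nonneg_AE AE_I2) (auto simp: P_def space split: split_indicator)
    then show ?thesis using \<nu>[OF A(1)] by (simp add: set_lebesgue_integral_def)
  qed
  ultimately show ?thesis using P_sets by (simp add: Hahn_set_def)
qed

private lemma vm: "vector_measure M \<nu>"
  using b sets \<nu> by (rule vector_measure_set_integral)

lemma variation_measure_density: "variation_measure M \<nu> = density \<mu> (\<lambda>x. ennreal \<bar>b x\<bar>)"
proof (rule measure_eqI)
  show "sets (variation_measure M \<nu>) = sets (density \<mu> (\<lambda>x. ennreal \<bar>b x\<bar>))"
    by (simp add: variation_measure_def sets)
  fix A assume "A \<in> sets (variation_measure M \<nu>)"
  then have A: "A \<in> sets M" by (simp add: variation_measure_def)
  have int: "integrable \<mu> (\<lambda>x. indicat_real A x * \<bar>b x\<bar>)"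
    using integrable_indicator_times[of A \<mu> "\<lambda>x. \<bar>b x\<bar>"] b A sets by simp
  have "\<nu> (A \<inter> P) - \<nu> (A - P) = (\<integral>x. indicat_real (A \<inter> P) x * b x - indicat_real (A - P) x * b x \<partial>\<mu>)"
    using A P_sets \<nu>[of "A \<inter> P"] \<nu>[of "A - P"] set_int[of "A \<inter> P"] set_int[of "A - P"]
    by (simp add: set_lebesgue_integral_def)
  also have "\<dots> = (\<integral>x. indicat_real A x * \<bar>b x\<bar> \<partial>\<mu>)"
    by (intro Bochner_Integration.integral_cong) (auto simp: P_def space split: split_indicator)
  finally have "ennreal (\<nu> (A \<inter> P) - \<nu> (A - P)) = (\<integral>\<^sup>+x. ennreal (indicat_real A x * \<bar>b x\<bar>) \<partial>\<mu>)"
    using int by (subst nn_integral_eq_integral) auto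
  also have "\<dots> = (\<integral>\<^sup>+x\<in>A. ennreal \<bar>b x\<bar> \<partial>\<mu>)"
    by (intro nn_integral_cong) (auto split: split_indicator)
  also have "\<dots> = emeasure (density \<mu> (\<lambda>x. ennreal \<bar>b x\<bar>)) A"
    using A b sets by (subst emeasure_density) auto
  finally show "emeasure (variation_measure M \<nu>) A = emeasure (density \<mu> (\<lambda>x. ennreal \<bar>b x\<bar>)) A"
    using emeasure_variation_measure_Hahn[OF vm Hahn A] by simp
qed

lemma positive_part_measure_density: "positive_part_measure M \<nu> = density \<mu> (\<lambda>x. ennreal (b x))"
proof -
  have "positive_part_measure M \<nu> = measure_of (space M) (sets M) (emeasure (density \<mu> (\<lambda>x. ennreal (b x))))"
    unfolding positive_part_measure_def
  proof (intro measure_of_eq)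
    show "sets M \<subseteq> Pow (space M)" by (rule sets.space_closed)
    fix A assume "A \<in> sigma_sets (space M) (sets M)"
    then have A: "A \<in> sets M" by (simp add: sets.sigma_sets_eq)
    have "\<nu> (A \<inter> P) = (\<integral>x. indicat_real (A \<inter> P) x * b x \<partial>\<mu>)"
      using A P_sets \<nu>[of "A \<inter> P"] by (simp add: set_lebesgue_integral_def)
    then have "ennreal (\<nu> (A \<inter> P)) = (\<integral>\<^sup>+x. ennreal (indicat_real (A \<inter> P) x * b x) \<partial>\<mu>)"
      using A P_sets set_int[of "A \<inter> P"]
      by (subst nn_integral_eq_integral) (auto simp: P_def split: split_indicator)
    also have "\<dots> = (\<integral>\<^sup>+x\<in>A. ennreal (b x) \<partial>\<mu>)"
      by (intro nn_integral_cong) (auto simp: P_def space ennreal_neg split: split_indicator)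
    also have "\<dots> = emeasure (density \<mu> (\<lambda>x. ennreal (b x))) A"
      using A b sets by (subst emeasure_density) auto
    finally show "(SUP B \<in> {B \<in> sets M. B \<subseteq> A}. ennreal (\<nu> B)) = emeasure (density \<mu> (\<lambda>x. ennreal (b x))) A"
      using positive_part_Hahn[OF vm Hahn A] by simp
  qed
  also have "\<dots> = density \<mu> (\<lambda>x. ennreal (b x))"
    using measure_of_of_measure[of "density \<mu> (\<lambda>x. ennreal (b x))"] by (simp add: sets space)
  finally show ?thesis .
qed

lemma nn_integral_variation_measure:
  assumes "f \<in> borel_measurable M"
  shows "(\<integral>\<^sup>+x. ennreal \<bar>f x\<bar> \<partial>variation_measure M \<nu>) = (\<integral>\<^sup>+x. ennreal \<bar>f x * b x\<bar> \<partial>\<mu>)"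
proof -
  have f: "f \<in> borel_measurable \<mu>" using assms measurable_cong_sets[OF sets refl] by auto
  show ?thesis
    unfolding variation_measure_density using f b
    by (subst nn_integral_density) (auto simp: abs_mult ennreal_mult mult.commute intro!: nn_integral_cong)
qed

lemma integrable_variation_measure:
  assumes "f \<in> borel_measurable M"
  shows "integrable (variation_measure M \<nu>) f \<longleftrightarrow> integrable \<mu> (\<lambda>x. f x * b x)"
proof -
  have f: "f \<in> borel_measurable \<mu>" using assms measurable_cong_sets[OF sets refl] by auto
  have "integrable (variation_measure M \<nu>) f \<longleftrightarrow> integrable \<mu> (\<lambda>x. \<bar>b x\<bar> *\<^sub>R f x)"
    unfolding variation_measure_density using f b by (intro integrable_density) auto
  also have "\<dots> \<longleftrightarrow> integrable \<mu> (\<lambda>x. norm (\<bar>b x\<bar> *\<^sub>R f x))"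
    using f b by (intro integrable_norm_iff[symmetric]) auto
  also have "(\<lambda>x. norm (\<bar>b x\<bar> *\<^sub>R f x)) = (\<lambda>x. norm (f x * b x))"
    by (auto simp: abs_mult)
  also have "integrable \<mu> \<dots> \<longleftrightarrow> integrable \<mu> (\<lambda>x. f x * b x)"
    using f b by (intro integrable_norm_iff) auto
  finally show ?thesis .
qed

end

lemma signed_integral_density:
  fixes b :: "'a \<Rightarrow> real"
  assumes sets: "sets \<mu> = sets M" and b: "integrable \<mu> b"
    and \<nu>: "\<And>A. A \<in> sets M \<Longrightarrow> \<nu> A = set_lebesgue_integral \<mu> A b"
    and f: "f \<in> borel_measurable M" "integrable \<mu> (\<lambda>x. f x * b x)" and A: "A \<in> sets M"
  shows "signed_integral M \<nu> A f = (\<integral>x. indicat_real A x * (f x * b x) \<partial>\<mu>)"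
proof -
  have f': "f \<in> borel_measurable \<mu>" using f measurable_cong_sets[OF sets refl] by auto
  \<comment> \<open>The change of density for the Lebesgue integral asks for a nonnegative real
    density; \<open>ennreal\<close> truncates at \<open>0\<close> anyway.\<close>
  have max0: "ennreal (max 0 r) = ennreal r" for r by (simp add: max_def ennreal_neg)
  have p: "positive_part_measure M \<nu> = density \<mu> (\<lambda>x. ennreal (max 0 (b x)))"
    unfolding positive_part_measure_density[OF sets b \<nu>, simplified] by (simp add: max0)
  have "positive_part_measure M (\<lambda>B. - \<nu> B) = density \<mu> (\<lambda>x. ennreal (- b x))"
    using b \<nu> by (intro positive_part_measure_density[OF sets]) (auto simp: set_lebesgue_integral_def)
  then have n: "positive_part_measure M (\<lambda>B. - \<nu> B) = density \<mu> (\<lambda>x. ennreal (max 0 (- b x)))"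
    by (simp add: max0)
  have int: "integrable \<mu> (\<lambda>x. max 0 (c x) *\<^sub>R (indicat_real A x *\<^sub>R f x))" if c: "c = b \<or> c = (\<lambda>x. - b x)" for c
  proof (rule Bochner_Integration.integrable_bound[OF f(2)])
    show "(\<lambda>x. max 0 (c x) *\<^sub>R (indicat_real A x *\<^sub>R f x)) \<in> borel_measurable \<mu>"
      using c b f' A sets by (auto intro!: borel_measurable_times)
    show "AE x in \<mu>. norm (max 0 (c x) *\<^sub>R (indicat_real A x *\<^sub>R f x)) \<le> norm (f x * b x)"
      using c by (auto simp: abs_mult mult.commute max_def split: split_indicator intro!: mult_right_mono)
  qed
  have "signed_integral M \<nu> A f =
    (\<integral>x. max 0 (b x) *\<^sub>R (indicat_real A x *\<^sub>R f x) \<partial>\<mu>) - (\<integral>x. max 0 (- b x) *\<^sub>R (indicat_real A x *\<^sub>R f x) \<partial>\<mu>)"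
    unfolding signed_integral_def set_lebesgue_integral_def p n using f' b A sets
    by (subst (1 2) integral_density) auto
  also have "\<dots> = (\<integral>x. max 0 (b x) *\<^sub>R (indicat_real A x *\<^sub>R f x) - max 0 (- b x) *\<^sub>R (indicat_real A x *\<^sub>R f x) \<partial>\<mu>)"
    using int by (intro Bochner_Integration.integral_diff[symmetric]) auto
  also have "\<dots> = (\<integral>x. indicat_real A x * (f x * b x) \<partial>\<mu>)"
    by (intro Bochner_Integration.integral_cong) (auto simp: max_def split: split_indicator)
  finally show ?thesis .
qed

subsection \<open>Vector measures given by scalar densities\<close>

text \<open>By dominated convergence the part of \<open>b\<close> above a high level has a small
  integral; on the rest \<open>b\<close> is bounded.\<close>

lemma (in finite_measure) integral_small_on_small_sets:
  fixes b :: "'a \<Rightarrow> real"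
  assumes b: "integrable M b" and e: "0 < e"
  obtains \<tau> where "0 < \<tau>" "\<And>A. A \<in> sets M \<Longrightarrow> measure M A \<le> \<tau> \<Longrightarrow> (\<integral>x. indicator A x * \<bar>b x\<bar> \<partial>M) \<le> e"
proof -
  have [measurable]: "b \<in> borel_measurable M" using b by simp
  have "(\<lambda>n::nat. \<integral>x. indicator {x\<in>space M. real n < \<bar>b x\<bar>} x * \<bar>b x\<bar> \<partial>M) \<longlonglongrightarrow> (\<integral>x. 0 \<partial>M)"
  proof (rule integral_dominated_convergence[where w = "\<lambda>x. \<bar>b x\<bar>"])
    show "AE x in M. (\<lambda>n. indicator {x\<in>space M. real n < \<bar>b x\<bar>} x * \<bar>b x\<bar>) \<longlonglongrightarrow> 0"
    proof (rule AE_I2)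
      fix x assume "x \<in> space M"
      obtain N :: nat where "\<bar>b x\<bar> \<le> real N" using real_arch_simple by blast
      then have "\<forall>n\<ge>N. indicator {x\<in>space M. real n < \<bar>b x\<bar>} x * \<bar>b x\<bar> = 0"
        by (auto split: split_indicator)
      then show "(\<lambda>n. indicator {x\<in>space M. real n < \<bar>b x\<bar>} x * \<bar>b x\<bar>) \<longlonglongrightarrow> 0"
        by (intro tendsto_eventually) (auto simp: eventually_sequentially)
    qed
    show "AE x in M. norm (indicator {x\<in>space M. real n < \<bar>b x\<bar>} x * \<bar>b x\<bar>) \<le> \<bar>b x\<bar>" for n
      by (auto split: split_indicator)
  qed (use b in auto)
  then have "\<forall>\<^sub>F n in sequentially. (\<integral>x. indicator {x\<in>space M. real n < \<bar>b x\<bar>} x * \<bar>b x\<bar> \<partial>M) < e / 2"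
    using e by (intro order_tendstoD(2)[where y = 0]) auto
  then obtain n where n: "(\<integral>x. indicator {x\<in>space M. real n < \<bar>b x\<bar>} x * \<bar>b x\<bar> \<partial>M) < e / 2"
    by (auto simp: eventually_sequentially)
  show thesis
  proof
    \<comment> \<open>On a set this small the part of \<open>b\<close> below level \<open>n\<close>
      contributes at most \<open>e / 2\<close>; adding 1 avoids a division by zero.\<close>
    show "0 < e / (2 * (real n + 1))" using e by simp
    fix A assume A: "A \<in> sets M" "measure M A \<le> e / (2 * (real n + 1))"
    have i1: "integrable M (\<lambda>x. indicator {x\<in>space M. real n < \<bar>b x\<bar>} x * \<bar>b x\<bar>)"
      using b by (intro integrable_indicator_times) auto
    have i2: "integrable M (\<lambda>x. real n * indicator A x)"
      using A by (intro integrable_mult_right) (auto simp: less_top[symmetric])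
    have "(\<integral>x. indicator A x * \<bar>b x\<bar> \<partial>M)
        \<le> (\<integral>x. indicator {x\<in>space M. real n < \<bar>b x\<bar>} x * \<bar>b x\<bar> + real n * indicator A x \<partial>M)"
      using A b i1 i2
      by (intro integral_mono integrable_indicator_times Bochner_Integration.integrable_add) (auto split: split_indicator)
    also have "\<dots> = (\<integral>x. indicator {x\<in>space M. real n < \<bar>b x\<bar>} x * \<bar>b x\<bar> \<partial>M) + real n * measure M A"
      using i1 i2 A by (simp add: Bochner_Integration.integral_add)
    also have "real n * measure M A \<le> real n * (e / (2 * (real n + 1)))"
      using A by (intro mult_left_mono) auto
    also have "\<dots> \<le> e / 2" using e by (simp add: field_simps)
    finally show "(\<integral>x. indicator A x * \<bar>b x\<bar> \<partial>M) \<le> e" using n by simp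
  qed
qed

lemma abs_integral_le:
  fixes f g :: "'a \<Rightarrow> real"
  assumes "integrable M f" "integrable M g" "\<And>x. x \<in> space M \<Longrightarrow> \<bar>f x\<bar> \<le> g x"
  shows "\<bar>\<integral>x. f x \<partial>M\<bar> \<le> (\<integral>x. g x \<partial>M)"
proof -
  have "\<bar>\<integral>x. f x \<partial>M\<bar> \<le> (\<integral>x. \<bar>f x\<bar> \<partial>M)"
    using integral_norm_bound[of M f] by simp
  also have "\<dots> \<le> (\<integral>x. g x \<partial>M)" using assms by (intro integral_mono) auto
  finally show ?thesis .
qed

text \<open>Points at distance \<open>2 * e\<close> need different approximants, so choosing
  approximants would inject the power set of the naturals into a countable type.\<close>

lemma countable_not_separated_by_sets:
  fixes q :: "'l::countable \<Rightarrow> 'x::real_normed_vector" and x :: "nat set \<Rightarrow> 'x"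
  assumes e: "0 < e" and dense: "\<And>S. \<exists>l. norm (q l - x S) < e" and sep: "\<And>S S'. S \<noteq> S' \<Longrightarrow> 2 * e \<le> norm (x S - x S')"
  shows False
proof -
  obtain l where l: "\<And>S. norm (q (l S) - x S) < e" using dense by metis
  have "inj l"
  proof (rule injI, rule ccontr)
    fix S S' assume SS: "l S = l S'" "S \<noteq> S'"
    have "norm (x S - x S') \<le> norm (q (l S) - x S) + norm (q (l S') - x S')"
      using norm_triangle_ineq4[of "q (l S) - x S'" "q (l S) - x S"] SS(1) by simp
    also have "\<dots> < 2 * e" using l[of S] l[of S'] by simp
    finally show False using sep[OF SS(2)] by simp
  qed
  then have "inj (\<lambda>S. to_nat (l S))" by (simp add: inj_def)
  then have "range (inv (\<lambda>S. to_nat (l S))) = Pow UNIV" by (simp add: inj_imp_surj_inv)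
  then show False using Cantors_theorem by blast
qed

text \<open>Separability in the form needed for counting: lists of pairs of a rational and an index
  form a countable type.\<close>

lemma rational_combinations_dense:
  fixes x :: "nat \<Rightarrow> 'x::real_normed_vector"
  assumes v: "v \<in> span (range x)" and e: "0 < e"
  shows "\<exists>l :: (rat \<times> nat) list. norm (sum_list (map (\<lambda>(r, j). of_rat r *\<^sub>R x j) l) - v) < e"
  using v e
proof (induction arbitrary: e rule: span_induct_alt)
  case base
  then show ?case by (intro exI[of _ "[]"]) simp
next
  case (step c y z)
  then obtain j where y: "y = x j" by auto
  obtain l where l: "norm (sum_list (map (\<lambda>(r, j). of_rat r *\<^sub>R x j) l) - z) < e / 2"
    using step.IH[of "e / 2"] step.prems by auto
  have "0 < e / (2 * (norm y + 1))" using step.prems by (simp add: add_nonneg_pos)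
  then obtain r where r: "c < of_rat r" "of_rat r < c + e / (2 * (norm y + 1))"
    using of_rat_dense[of c "c + e / (2 * (norm y + 1))"] by auto
  have "norm ((of_rat r - c) *\<^sub>R y) \<le> (e / (2 * (norm y + 1))) * norm y"
    using r unfolding norm_scaleR by (intro mult_right_mono) auto
  also have "\<dots> < e / 2"
    using step.prems by (simp add: field_simps add_pos_nonneg)
  finally have "norm ((of_rat r - c) *\<^sub>R y) < e / 2" .
  moreover have "sum_list (map (\<lambda>(r, j). of_rat r *\<^sub>R x j) ((r, j) # l)) - (c *\<^sub>R y + z)
      = (of_rat r - c) *\<^sub>R y + (sum_list (map (\<lambda>(r, j). of_rat r *\<^sub>R x j) l) - z)"
    by (simp add: y algebra_simps)
  ultimately have "norm (sum_list (map (\<lambda>(r, j). of_rat r *\<^sub>R x j) ((r, j) # l)) - (c *\<^sub>R y + z)) < e"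
    using norm_add_less[of "(of_rat r - c) *\<^sub>R y" "e / 2" _ "e / 2"] l by (simp only: field_sum_of_halves)
  then show ?case by blast
qed

lemma subspace_closure_normed:
  fixes S :: "'x::real_normed_vector set"
  assumes S: "subspace S"
  shows "subspace (closure S)"
proof (rule subspaceI)
  show "0 \<in> closure S" using subspace_0[OF S] closure_subset by auto
next
  fix x y assume "x \<in> closure S" "y \<in> closure S"
  then obtain u v where "\<And>n. u n \<in> S" "u \<longlonglongrightarrow> x" "\<And>n. v n \<in> S" "v \<longlonglongrightarrow> y"
    unfolding closure_sequential by metis
  then show "x + y \<in> closure S"
    unfolding closure_sequential
    by (intro exI[of _ "\<lambda>n. u n + v n"]) (auto intro: subspace_add[OF S] tendsto_add)
next
  fix c :: real and x assume "x \<in> closure S"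
  then obtain u where "\<And>n. u n \<in> S" "u \<longlonglongrightarrow> x"
    unfolding closure_sequential by metis
  then show "c *\<^sub>R x \<in> closure S"
    unfolding closure_sequential
    by (intro exI[of _ "\<lambda>n. c *\<^sub>R u n"]) (auto intro: subspace_scale[OF S] tendsto_intros)
qed

section \<open>Uniform integrability of the scalar densities\<close>

text \<open>\<open>\<beta> \<phi>\<close> stands for the density of \<open>\<phi>\<close> composed
  with a vector measure, whose values are supplied weakly by \<open>ex_set\<close>. The instance
  used later is the measure with values \<open>\<integral>\<^sub>A g dm\<close>.\<close>

locale vector_density = finite_measure \<mu> for \<mu> :: "'a measure" +
  fixes \<beta> :: "('x::banach \<Rightarrow>\<^sub>L real) \<Rightarrow> 'a \<Rightarrow> real"
  assumes int: "integrable \<mu> (\<beta> \<phi>)"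
    and ex_set: "A \<in> sets \<mu> \<Longrightarrow> \<exists>y. \<forall>\<phi>. blinfun_apply \<phi> y = (\<integral>x. indicator A x * \<beta> \<phi> x \<partial>\<mu>)"
begin

lemma beta_measurable [measurable]: "\<beta> \<phi> \<in> borel_measurable \<mu>"
  using int by simp

text \<open>A functional that vanishes on all \<open>x {j}\<close> vanishes on \<open>x S\<close> by
  countable additivity of its scalar measure; Hahn-Banach does the rest.\<close>

lemma closed_span_of_set_values:
  assumes D: "\<And>j::nat. D j \<in> sets \<mu>" "disjoint_family D"
    and x: "\<And>S \<phi>. blinfun_apply \<phi> (x S) = (\<integral>t. indicator (\<Union>j\<in>S. D j) t * \<beta> \<phi> t \<partial>\<mu>)"
  shows "x S \<in> closure (span (range (\<lambda>j. x {j})))"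
proof (rule ccontr)
  assume "x S \<notin> closure (span (range (\<lambda>j. x {j})))"
  then obtain \<phi> :: "'x \<Rightarrow>\<^sub>L real" where \<phi>: "\<And>y. y \<in> closure (span (range (\<lambda>j. x {j}))) \<Longrightarrow> blinfun_apply \<phi> y = 0"
    "blinfun_apply \<phi> (x S) \<noteq> 0"
    using separate_point_closed_subspace[OF subspace_closure_normed[OF subspace_span] closed_closure] by metis
  define \<nu> where "\<nu> A = set_lebesgue_integral \<mu> A (\<beta> \<phi>)" for A
  have \<nu>: "vector_measure \<mu> \<nu>"
    by (rule vector_measure_set_integral[OF int refl]) (simp add: \<nu>_def)
  define E where "E j = (if j \<in> S then D j else {})" for j
  have "(\<lambda>j. \<nu> (E j)) sums \<nu> (\<Union>j. E j)"
    using D by (intro vector_measureD[OF \<nu>]) (auto simp: E_def disjoint_family_on_def)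
  moreover have "\<nu> (E j) = 0" for j
  proof -
    have "x {j} \<in> closure (span (range (\<lambda>j. x {j})))"
      using closure_subset span_base by (metis rangeI subsetD)
    then have "\<nu> (D j) = 0" using \<phi>(1)[of "x {j}"] x[of \<phi> "{j}"] by (simp add: \<nu>_def set_lebesgue_integral_def)
    then show ?thesis using vector_measure_empty[OF \<nu>] by (simp add: E_def)
  qed
  moreover have "(\<Union>j. E j) = (\<Union>j\<in>S. D j)" by (auto simp: E_def split: if_splits)
  ultimately have "(\<lambda>j. 0) sums \<nu> (\<Union>j\<in>S. D j)" by simp
  then have "\<nu> (\<Union>j\<in>S. D j) = 0" by (rule sums_unique2[OF _ sums_zero])
  then show False using \<phi>(2) x[of \<phi> S] by (simp add: \<nu>_def set_lebesgue_integral_def)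
qed

text \<open>
  The argument behind the Orlicz--Pettis theorem. Disjoint parts \<open>D\<^sub>k\<close> of the \<open>A\<^sub>k\<close> give a vector \<open>x(S)\<close> for
  every \<open>S \<subseteq> \<nat>\<close>. The functional \<open>\<phi>\<^sub>k\<close> with \<open>k\<close> the least element of the symmetric difference of \<open>S\<close>
  and \<open>S'\<close> separates \<open>x(S)\<close> from \<open>x(S')\<close> by a fixed amount, but all \<open>x(S)\<close> lie in a separable space.
\<close>

lemma vanishing_tails_contradiction:
  assumes e: "0 < e" and A: "\<And>k::nat. A k \<in> sets \<mu>" and \<phi>: "\<And>k. norm (\<phi> k) \<le> 1"
    and big: "\<And>k. e < (\<integral>x. indicator (A k) x * \<bar>\<beta> (\<phi> k) x\<bar> \<partial>\<mu>)"
    and tail: "\<And>k. (\<integral>x. indicator (\<Union>j\<in>{k<..}. A j) x * \<bar>\<beta> (\<phi> k) x\<bar> \<partial>\<mu>) \<le> e / 8"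
  shows False
proof -
  define E where "E k = (\<Union>j\<in>{k<..}. A j)" for k
  have E[measurable]: "E k \<in> sets \<mu>" for k unfolding E_def using A by auto
  note A[measurable]
  have ii: "integrable \<mu> (\<lambda>x. indicator B x * \<beta> \<psi> x)" "integrable \<mu> (\<lambda>x. indicator B x * \<bar>\<beta> \<psi> x\<bar>)"
    if "B \<in> sets \<mu>" for B \<psi>
    using that int by (auto intro: integrable_indicator_times)
  have "\<exists>D\<in>sets \<mu>. D \<subseteq> A k - E k \<and> 3 / 8 * e \<le> \<bar>\<integral>x. indicator D x * \<beta> (\<phi> k) x \<partial>\<mu>\<bar>" for k
  proof -
    define D1 where "D1 = {x\<in>space \<mu>. x \<in> A k - E k \<and> 0 \<le> \<beta> (\<phi> k) x}"
    define D2 where "D2 = {x\<in>space \<mu>. x \<in> A k - E k \<and> \<beta> (\<phi> k) x < 0}"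
    have D: "D1 \<in> sets \<mu>" "D2 \<in> sets \<mu>" unfolding D1_def D2_def by measurable
    have "(\<integral>x. indicator (A k) x * \<bar>\<beta> (\<phi> k) x\<bar> \<partial>\<mu>)
       \<le> (\<integral>x. (indicator D1 x * \<beta> (\<phi> k) x - indicator D2 x * \<beta> (\<phi> k) x) + indicator (E k) x * \<bar>\<beta> (\<phi> k) x\<bar> \<partial>\<mu>)"
      using D by (intro integral_mono Bochner_Integration.integrable_add Bochner_Integration.integrable_diff ii)
        (auto simp: D1_def D2_def split: split_indicator)
    also have "\<dots> = (\<integral>x. indicator D1 x * \<beta> (\<phi> k) x \<partial>\<mu>) - (\<integral>x. indicator D2 x * \<beta> (\<phi> k) x \<partial>\<mu>)
       + (\<integral>x. indicator (E k) x * \<bar>\<beta> (\<phi> k) x\<bar> \<partial>\<mu>)"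
      using D E[of k] by (simp add: ii Bochner_Integration.integral_add Bochner_Integration.integral_diff)
    finally have "7 / 8 * e \<le> (\<integral>x. indicator D1 x * \<beta> (\<phi> k) x \<partial>\<mu>) - (\<integral>x. indicator D2 x * \<beta> (\<phi> k) x \<partial>\<mu>)"
      using big[of k] tail[of k] unfolding E_def by linarith
    \<comment> \<open>One of the two sign parts carries half of \<open>7/8 * e\<close>, which
      exceeds \<open>3/8 * e\<close>.\<close>
    then have "3 / 8 * e \<le> \<bar>\<integral>x. indicator D1 x * \<beta> (\<phi> k) x \<partial>\<mu>\<bar> \<or> 3 / 8 * e \<le> \<bar>\<integral>x. indicator D2 x * \<beta> (\<phi> k) x \<partial>\<mu>\<bar>"
      using e by linarith
    moreover have "D1 \<subseteq> A k - E k" "D2 \<subseteq> A k - E k" by (auto simp: D1_def D2_def)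
    ultimately show ?thesis using D by blast
  qed
  then obtain D where D: "\<And>k. D k \<in> sets \<mu>" "\<And>k. D k \<subseteq> A k - E k"
    "\<And>k. 3 / 8 * e \<le> \<bar>\<integral>x. indicator (D k) x * \<beta> (\<phi> k) x \<partial>\<mu>\<bar>" by metis
  have DE: "D j \<subseteq> E k" if "k < j" for j k using D(2)[of j] that by (auto simp: E_def)
  then have disj: "D j \<inter> D k = {}" if "k < j" for j k using D(2)[of k] that by blast
  then have disj: "D j \<inter> D k = {}" if "j \<noteq> k" for j k using that by (metis Int_commute linorder_neqE_nat)
  have "\<exists>y. \<forall>\<psi>. blinfun_apply \<psi> y = (\<integral>t. indicator (\<Union>j\<in>S. D j) t * \<beta> \<psi> t \<partial>\<mu>)" for S
    using D(1) by (intro ex_set) auto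
  then obtain x where x: "\<And>S \<psi>. blinfun_apply \<psi> (x S) = (\<integral>t. indicator (\<Union>j\<in>S. D j) t * \<beta> \<psi> t \<partial>\<mu>)" by metis
  have sep: "e / 4 \<le> norm (x S - x S')" if k: "k \<in> S" "k \<notin> S'" "\<And>j. j < k \<Longrightarrow> j \<in> S \<longleftrightarrow> j \<in> S'" for k S S'
  proof -
    let ?b = "\<beta> (\<phi> k)" and ?U = "\<Union>j\<in>S. D j" and ?U' = "\<Union>j\<in>S'. D j"
    have U: "?U \<in> sets \<mu>" "?U' \<in> sets \<mu>" using D(1) by auto
    \<comment> \<open>Outside the tail \<open>E k\<close> only indices up to \<open>k\<close> count:
      below \<open>k\<close> the two unions agree, and at \<open>k\<close> they differ by
      \<open>D k\<close>. Testing with \<open>\<phi> k\<close> therefore leaves at least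
      \<open>3/8 * e - e/8\<close>.\<close>
    have pt: "\<bar>indicator ?U t - indicator ?U' t - indicator (D k) t\<bar> \<le> (indicator (E k) t :: real)" for t
    proof (cases "t \<in> E k")
      case True
      then have "t \<notin> D k" using D(2)[of k] by auto
      then show ?thesis using True by (auto split: split_indicator)
    next
      case False
      then have nt: "t \<notin> D j" if "k < j" for j using DE[OF that] by auto
      have "(t \<in> ?U) = (t \<in> D k \<or> (\<exists>j<k. j \<in> S \<and> t \<in> D j))"
        using nt k(1) by (auto) (metis linorder_neqE_nat)
      moreover have "(t \<in> ?U') = (\<exists>j<k. j \<in> S \<and> t \<in> D j)"
        using nt k(2,3) by (auto) (metis linorder_neqE_nat)
      moreover have "t \<in> D k \<Longrightarrow> \<not> (\<exists>j<k. j \<in> S \<and> t \<in> D j)"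
        by (metis disj disjoint_iff less_irrefl)
      ultimately show ?thesis by (auto split: split_indicator)
    qed
    have "blinfun_apply (\<phi> k) (x S - x S') - (\<integral>t. indicator (D k) t * ?b t \<partial>\<mu>)
        = (\<integral>t. indicator ?U t * ?b t - indicator ?U' t * ?b t - indicator (D k) t * ?b t \<partial>\<mu>)"
      using U D(1)[of k] by (simp add: blinfun.diff_right x ii)
    also have "\<bar>\<dots>\<bar> \<le> (\<integral>t. indicator (E k) t * \<bar>?b t\<bar> \<partial>\<mu>)"
    proof (rule abs_integral_le)
      fix t assume "t \<in> space \<mu>"
      have "indicator ?U t * ?b t - indicator ?U' t * ?b t - indicator (D k) t * ?b t
          = (indicator ?U t - indicator ?U' t - indicator (D k) t) * ?b t" by (simp add: algebra_simps)
      then show "\<bar>indicator ?U t * ?b t - indicator ?U' t * ?b t - indicator (D k) t * ?b t\<bar> \<le> indicator (E k) t * \<bar>?b t\<bar>"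
        using mult_right_mono[OF pt[of t], of "\<bar>?b t\<bar>"] by (simp add: abs_mult)
    qed (use U D(1)[of k] E[of k] in \<open>auto intro!: ii Bochner_Integration.integrable_diff\<close>)
    also have "\<dots> \<le> e / 8" using tail[of k] by (simp add: E_def)
    finally have "e / 4 \<le> \<bar>blinfun_apply (\<phi> k) (x S - x S')\<bar>" using D(3)[of k] by linarith
    also have "\<dots> \<le> norm (\<phi> k) * norm (x S - x S')"
      using norm_blinfun[of "\<phi> k" "x S - x S'"] by simp
    also have "\<dots> \<le> 1 * norm (x S - x S')" by (intro mult_right_mono \<phi>) auto
    finally show ?thesis by simp
  qed
  show False
  proof (rule countable_not_separated_by_sets)
    show "0 < e / 8" using e by simp
    show "2 * (e / 8) \<le> norm (x S - x S')" if "S \<noteq> S'" for S S'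
    proof -
      define k where "k = (LEAST k. (k \<in> S) \<noteq> (k \<in> S'))"
      have ex: "\<exists>k. (k \<in> S) \<noteq> (k \<in> S')" using that by auto
      have k: "(k \<in> S) \<noteq> (k \<in> S')" unfolding k_def by (rule LeastI_ex[OF ex])
      have less: "(j \<in> S) = (j \<in> S')" if "j < k" for j using not_less_Least[of j] that unfolding k_def by blast
      show ?thesis
      proof (cases "k \<in> S")
        case True
        then show ?thesis using sep[of k S S'] k less by simp
      next
        case False
        then show ?thesis using sep[of k S' S] k less by (simp add: norm_minus_commute)
      qed
    qed
    show "\<exists>l. norm ((\<lambda>l :: (rat \<times> nat) list. sum_list (map (\<lambda>(r, j). of_rat r *\<^sub>R x {j}) l)) l - x S) < e / 8" for S
    proof -
      have "x S \<in> closure (span (range (\<lambda>j. x {j})))"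
        using D(1) disj x by (intro closed_span_of_set_values) (auto simp: disjoint_family_on_def)
      then obtain v where v: "v \<in> span (range (\<lambda>j. x {j}))" "dist v (x S) < e / 16"
        using e unfolding closure_approachable by (meson divide_pos_pos zero_less_numeral)
      obtain l :: "(rat \<times> nat) list" where "norm (sum_list (map (\<lambda>(r, j). of_rat r *\<^sub>R x {j}) l) - v) < e / 16"
        using rational_combinations_dense[OF v(1), of "e / 16"] e by auto
      then have "norm (sum_list (map (\<lambda>(r, j). of_rat r *\<^sub>R x {j}) l) - x S) < e / 8"
        using v(2) norm_triangle_ineq[of "sum_list (map (\<lambda>(r, j). of_rat r *\<^sub>R x {j}) l) - v" "v - x S"]
        by (simp add: dist_norm)
      then show ?thesis by blast
    qed
  qed
qed

text \<open>Each single density has an absolutely continuous integral. If this failed uniformly over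
  the ball, bad sets could be chosen one after the other, each so small that the union of all later
  ones is negligible for the functionals already chosen;
  \<open>vanishing_tails_contradiction\<close> excludes this.\<close>

theorem uniformly_integrable:
  assumes e: "0 < e"
  shows "\<exists>\<delta>>0. \<forall>A\<in>sets \<mu>. \<forall>\<phi>. norm \<phi> \<le> 1 \<longrightarrow> measure \<mu> A < \<delta> \<longrightarrow>
    (\<integral>x. indicator A x * \<bar>\<beta> \<phi> x\<bar> \<partial>\<mu>) \<le> e"
proof (rule ccontr)
  assume "\<not> ?thesis"
  then have bad: "\<exists>A \<phi>. A \<in> sets \<mu> \<and> norm \<phi> \<le> 1 \<and> measure \<mu> A < \<delta> \<and> e < (\<integral>x. indicator A x * \<bar>\<beta> \<phi> x\<bar> \<partial>\<mu>)"
    if "0 < \<delta>" for \<delta>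
    using that by (meson linorder_not_le)
  \<comment> \<open>A state consists of a bad set, a functional that detects it, and a measure
    \<open>\<tau>\<close> below which sets are negligible for this functional.\<close>
  define P where "P = (\<lambda>(A, \<phi>, \<tau>). A \<in> sets \<mu> \<and> norm \<phi> \<le> 1 \<and> e < (\<integral>x. indicator A x * \<bar>\<beta> \<phi> x\<bar> \<partial>\<mu>) \<and> 0 < \<tau> \<and>
    (\<forall>B\<in>sets \<mu>. measure \<mu> B \<le> \<tau> \<longrightarrow> (\<integral>x. indicator B x * \<bar>\<beta> \<phi> x\<bar> \<partial>\<mu>) \<le> e / 8))"
  \<comment> \<open>Repeated halving bounds the measures of the later sets by
    \<open>\<tau> / 2\<close>, \<open>\<tau> / 4\<close> and so on, with sum
    \<open>\<tau>\<close>.\<close>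
  define Q where "Q = (\<lambda>(A :: 'a set, \<phi> :: 'x \<Rightarrow>\<^sub>L real, \<tau> :: real) (A', \<phi>' :: 'x \<Rightarrow>\<^sub>L real, \<tau>'). measure \<mu> A' < \<tau> / 2 \<and> \<tau>' \<le> \<tau> / 2)"
  have next_ex: "\<exists>s. P s \<and> (case s of (A, \<phi>, \<tau>) \<Rightarrow> measure \<mu> A < \<delta> \<and> \<tau> \<le> \<delta>)" if "0 < \<delta>" for \<delta>
  proof -
    obtain A \<phi> where A: "A \<in> sets \<mu>" "norm \<phi> \<le> 1" "measure \<mu> A < \<delta>" "e < (\<integral>x. indicator A x * \<bar>\<beta> \<phi> x\<bar> \<partial>\<mu>)"
      using bad[OF \<open>0 < \<delta>\<close>] by blast
    obtain \<tau> where \<tau>: "0 < \<tau>" "\<And>B. B \<in> sets \<mu> \<Longrightarrow> measure \<mu> B \<le> \<tau> \<Longrightarrow> (\<integral>x. indicator B x * \<bar>\<beta> \<phi> x\<bar> \<partial>\<mu>) \<le> e / 8"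
      using integral_small_on_small_sets[OF int, of "e / 8" \<phi>] e by auto
    show ?thesis
      using A \<tau> that by (intro exI[of _ "(A, \<phi>, min \<tau> \<delta>)"]) (auto simp: P_def)
  qed
  have "\<exists>s. P s" using next_ex[of 1] by auto
  moreover have "\<exists>s'. P s' \<and> Q s s'" if "P s" for s
    using next_ex[of "snd (snd s) / 2"] that by (auto simp: P_def Q_def)
  ultimately obtain s where s: "\<And>n::nat. P (s n)" "\<And>n. Q (s n) (s (Suc n))"
    using dependent_nat_choice[of "\<lambda>_. P" "\<lambda>_. Q"] by metis
  define A \<phi> \<tau> where "A n = fst (s n)" and "\<phi> n = fst (snd (s n))" and "\<tau> n = snd (snd (s n))" for n
  have PA: "A n \<in> sets \<mu>" "norm (\<phi> n) \<le> 1" "e < (\<integral>x. indicator (A n) x * \<bar>\<beta> (\<phi> n) x\<bar> \<partial>\<mu>)" "0 < \<tau> n"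
    "\<And>B. B \<in> sets \<mu> \<Longrightarrow> measure \<mu> B \<le> \<tau> n \<Longrightarrow> (\<integral>x. indicator B x * \<bar>\<beta> (\<phi> n) x\<bar> \<partial>\<mu>) \<le> e / 8" for n
    using s(1)[of n] by (auto simp: P_def A_def \<phi>_def \<tau>_def split: prod.splits)
  have QA: "measure \<mu> (A (Suc n)) < \<tau> n / 2" "\<tau> (Suc n) \<le> \<tau> n / 2" for n
    using s(2)[of n] by (auto simp: Q_def A_def \<phi>_def \<tau>_def split: prod.splits)
  have \<tau>: "\<tau> (k + i) \<le> \<tau> k * (1/2)^i" for k i
  proof (induction i)
    case (Suc i)
    then show ?case using QA(2)[of "k + i"] by simp
  qed simp
  have "measure \<mu> (\<Union>j\<in>{k<..}. A j) \<le> \<tau> k" for k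
  proof -
    have g: "(\<lambda>i. \<tau> k / 2 * (1/2)^i) sums (\<tau> k / 2 * 2)"
      using geometric_sums[of "1/2::real"] by (intro sums_mult) simp
    have le: "measure \<mu> (A (Suc k + i)) \<le> \<tau> k / 2 * (1/2)^i" for i
      using QA(1)[of "k + i"] \<tau>[of k i] by simp
    have sm: "summable (\<lambda>i. measure \<mu> (A (Suc k + i)))"
      using le by (intro summable_comparison_test[OF _ sums_summable[OF g]]) auto
    have eq: "(\<Union>j\<in>{k<..}. A j) = (\<Union>i. A (Suc k + i))"
    proof (safe, goal_cases)
      case (1 x j)
      then show ?case by (auto intro!: exI[of _ "j - Suc k"])
    next
      case (2 x i)
      then show ?case by (auto intro!: bexI[of _ "Suc k + i"])
    qed
    have "measure \<mu> (\<Union>i. A (Suc k + i)) \<le> (\<Sum>i. measure \<mu> (A (Suc k + i)))"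
      using PA(1) sm by (intro finite_measure_subadditive_countably) auto
    also have "\<dots> \<le> (\<Sum>i. \<tau> k / 2 * (1/2)^i)"
      using le sm g by (intro suminf_le) (auto simp: sums_iff)
    also have "\<dots> = \<tau> k" using g by (simp add: sums_iff)
    finally show ?thesis using eq by simp
  qed
  then have "(\<integral>x. indicator (\<Union>j\<in>{k<..}. A j) x * \<bar>\<beta> (\<phi> k) x\<bar> \<partial>\<mu>) \<le> e / 8" for k
    using PA(1) by (intro PA(5)) auto
  then show False
    by (rule vanishing_tails_contradiction[OF e PA(1,2,3)])
qed

end

section \<open>Truncation, and compactness of a null sequence of finite sets\<close>

definition clip :: "real \<Rightarrow> real \<Rightarrow> real" where
  "clip L r = max (- L) (min L r)"

lemma abs_clip_le: "0 \<le> L \<Longrightarrow> \<bar>clip L r\<bar> \<le> L"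
  by (auto simp: clip_def)

lemma abs_diff_clip_le: "0 \<le> L \<Longrightarrow> \<bar>r - clip L r\<bar> \<le> indicator {r. L < \<bar>r\<bar>} r * \<bar>r\<bar>"
  by (auto simp: clip_def max_def min_def split: split_indicator)

text \<open>\<open>clip L\<close> is the nearest-point projection onto an interval that contains
  \<open>h\<close>.\<close>

lemma clip_closer:
  assumes "\<bar>h\<bar> \<le> L"
  shows "(h - clip L r)\<^sup>2 \<le> (h - r)\<^sup>2"
proof -
  have "\<bar>h - clip L r\<bar> \<le> \<bar>h - r\<bar>" using assms by (auto simp: clip_def)
  then show ?thesis by (simp add: abs_le_square_iff)
qed

lemma measurable_clip [measurable]: "clip L \<in> borel_measurable borel"
  unfolding clip_def by measurable

text \<open>A neighbourhood of \<open>0\<close> absorbs all but finitely many of the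
  \<open>F n\<close>, and what remains is finite.\<close>

lemma compact_insert_zero_UN:
  fixes F :: "nat \<Rightarrow> 'x::real_normed_vector set"
  assumes F: "\<And>n. finite (F n)" "\<And>n x. x \<in> F n \<Longrightarrow> norm x \<le> (1/2)^n"
  shows "compact (insert 0 (\<Union>n. F n))"
proof (rule compactI)
  fix \<U> :: "'x set set" assume U: "\<forall>t\<in>\<U>. open t" "insert 0 (\<Union>n. F n) \<subseteq> \<Union>\<U>"
  then obtain V where V: "V \<in> \<U>" "0 \<in> V" by auto
  then obtain r where r: "0 < r" "ball 0 r \<subseteq> V" using U(1) by (meson open_contains_ball)
  obtain N where N: "(1/2)^N < r" using real_arch_pow_inv[OF r(1), of "1/2"] by auto
  have tail: "x \<in> V" if "N \<le> n" "x \<in> F n" for n x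
  proof -
    have "norm x \<le> (1/2)^n" using F(2) that by blast
    also have "\<dots> \<le> (1/2)^N" using that by (intro power_decreasing) auto
    finally show ?thesis using N r by auto
  qed
  have "\<exists>V. \<forall>x\<in>\<Union>n. F n. V x \<in> \<U> \<and> x \<in> V x" using U(2) by (intro bchoice) auto
  then obtain W where W: "\<And>n x. x \<in> F n \<Longrightarrow> W x \<in> \<U> \<and> x \<in> W x" by auto
  show "\<exists>\<U>'\<subseteq>\<U>. finite \<U>' \<and> insert 0 (\<Union>n. F n) \<subseteq> \<Union>\<U>'"
  proof (intro exI conjI)
    show "insert V (W ` (\<Union>n<N. F n)) \<subseteq> \<U>" using V W by auto
    show "finite (insert V (W ` (\<Union>n<N. F n)))" using F(1) by auto
    show "insert 0 (\<Union>n. F n) \<subseteq> \<Union>(insert V (W ` (\<Union>n<N. F n)))"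
    proof (safe)
      show "0 \<in> \<Union>(insert V (W ` (\<Union>n<N. F n)))" using V by auto
      fix x n assume "x \<in> F n"
      then show "x \<in> \<Union>(insert V (W ` (\<Union>n<N. F n)))"
        using W[of x n] tail[of n x] by (cases "n < N") auto
    qed
  qed
qed

lemma integrable_bounded_times:
  fixes b h :: "'a \<Rightarrow> real"
  assumes "integrable \<mu> b" "h \<in> borel_measurable \<mu>" "\<And>x. \<bar>h x\<bar> \<le> B"
  shows "integrable \<mu> (\<lambda>x. h x * b x)"
proof (rule Bochner_Integration.integrable_bound[of _ "\<lambda>x. B * b x"])
  have "\<bar>h x\<bar> \<le> \<bar>B\<bar>" for x using assms(3)[of x] by linarith
  then show "AE x in \<mu>. norm (h x * b x) \<le> norm (B * b x)"
    by (auto simp: abs_mult intro!: mult_right_mono)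
qed (use assms in auto)

section \<open>Weak integrals of bounded functions\<close>

locale bounded_vector_density = vector_density \<mu> \<beta> for \<mu> :: "'a measure"
    and \<beta> :: "('x::banach \<Rightarrow>\<^sub>L real) \<Rightarrow> 'a \<Rightarrow> real" +
  fixes C :: real
  assumes C: "norm \<phi> \<le> 1 \<Longrightarrow> (\<integral>x. \<bar>\<beta> \<phi> x\<bar> \<partial>\<mu>) \<le> C"
begin

lemma C_nonneg: "0 \<le> C"
proof -
  have "0 \<le> (\<integral>x. \<bar>\<beta> 0 x\<bar> \<partial>\<mu>)" by simp
  then show ?thesis using order_trans[OF _ C[of 0]] by simp
qed

text \<open>\<open>z\<close> is the weak integral of \<open>h\<close> with respect to the vector
  measure with densities \<open>\<beta>\<close>.\<close>

definition represents :: "('a \<Rightarrow> real) \<Rightarrow> 'x \<Rightarrow> bool" where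
  "represents h z \<longleftrightarrow> (\<forall>\<phi>. blinfun_apply \<phi> z = (\<integral>x. h x * \<beta> \<phi> x \<partial>\<mu>))"

lemma norm_le_if_represents:
  assumes h: "h \<in> borel_measurable \<mu>" "\<And>x. \<bar>h x\<bar> \<le> B" and z: "represents h z"
    and c: "\<And>\<phi>. norm \<phi> \<le> 1 \<Longrightarrow> (\<integral>x. \<bar>h x\<bar> * \<bar>\<beta> \<phi> x\<bar> \<partial>\<mu>) \<le> c"
  shows "norm z \<le> c"
proof (rule norm_le_functional)
  fix \<phi> :: "'x \<Rightarrow>\<^sub>L real" assume \<phi>: "norm \<phi> \<le> 1"
  have "(\<integral>x. h x * \<beta> \<phi> x \<partial>\<mu>) \<le> (\<integral>x. \<bar>h x\<bar> * \<bar>\<beta> \<phi> x\<bar> \<partial>\<mu>)"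
    using h int by (intro integral_mono integrable_bounded_times[where B = B]) (simp_all add: abs_mult[symmetric])
  then show "blinfun_apply \<phi> z \<le> c" using z c[OF \<phi>] by (simp add: represents_def)
qed

lemma norm_le_sup_if_represents:
  assumes h: "h \<in> borel_measurable \<mu>" "\<And>x. \<bar>h x\<bar> \<le> B" and z: "represents h z"
  shows "norm z \<le> B * C"
proof (rule norm_le_if_represents[OF h z])
  fix \<phi> :: "'x \<Rightarrow>\<^sub>L real" assume \<phi>: "norm \<phi> \<le> 1"
  \<comment> \<open>Any point of the type shows that the bound is nonnegative.\<close>
  have "0 \<le> B" using h(2)[of undefined] by simp
  have "(\<integral>x. \<bar>h x\<bar> * \<bar>\<beta> \<phi> x\<bar> \<partial>\<mu>) \<le> (\<integral>x. B * \<bar>\<beta> \<phi> x\<bar> \<partial>\<mu>)"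
    using h int \<open>0 \<le> B\<close>
    by (intro integral_mono integrable_bounded_times[where B = B]) (auto intro!: mult_right_mono)
  also have "\<dots> = B * (\<integral>x. \<bar>\<beta> \<phi> x\<bar> \<partial>\<mu>)" by simp
  also have "\<dots> \<le> B * C" using C[OF \<phi>] \<open>0 \<le> B\<close> by (rule mult_left_mono)
  finally show "(\<integral>x. \<bar>h x\<bar> * \<bar>\<beta> \<phi> x\<bar> \<partial>\<mu>) \<le> B * C" .
qed

lemma represents_diff:
  assumes h: "h \<in> borel_measurable \<mu>" "\<And>x. \<bar>h x\<bar> \<le> B" and h': "h' \<in> borel_measurable \<mu>" "\<And>x. \<bar>h' x\<bar> \<le> B'"
    and z: "represents h z" "represents h' z'"
  shows "represents (\<lambda>x. h x - h' x) (z - z')"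
  unfolding represents_def
proof
  fix \<phi>
  have "(\<integral>x. (h x - h' x) * \<beta> \<phi> x \<partial>\<mu>) = (\<integral>x. h x * \<beta> \<phi> x - h' x * \<beta> \<phi> x \<partial>\<mu>)"
    by (simp add: algebra_simps)
  also have "\<dots> = (\<integral>x. h x * \<beta> \<phi> x \<partial>\<mu>) - (\<integral>x. h' x * \<beta> \<phi> x \<partial>\<mu>)"
    using h h' int by (intro Bochner_Integration.integral_diff integrable_bounded_times)
  finally show "blinfun_apply \<phi> (z - z') = (\<integral>x. (h x - h' x) * \<beta> \<phi> x \<partial>\<mu>)"
    using z by (simp add: represents_def blinfun.diff_right)
qed

lemma exists_represents_finite_range:
  assumes h: "h \<in> borel_measurable \<mu>" and fin: "finite (range h)"
  shows "\<exists>z. represents h z"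
proof -
  define A where "A v = {x \<in> space \<mu>. h x = v}" for v
  have A: "A v \<in> sets \<mu>" for v unfolding A_def using h by measurable
  obtain y where y: "\<And>v \<phi>. blinfun_apply \<phi> (y v) = (\<integral>x. indicator (A v) x * \<beta> \<phi> x \<partial>\<mu>)"
    using ex_set[OF A] by metis
  have "represents h (\<Sum>v\<in>range h. v *\<^sub>R y v)"
    unfolding represents_def
  proof
    fix \<phi>
    have "(\<integral>x. h x * \<beta> \<phi> x \<partial>\<mu>) = (\<integral>x. (\<Sum>v\<in>range h. v * (indicator (A v) x * \<beta> \<phi> x)) \<partial>\<mu>)"
    proof (intro Bochner_Integration.integral_cong refl)
      fix x assume "x \<in> space \<mu>"
      then have "(\<Sum>v\<in>range h. v * (indicator (A v) x * \<beta> \<phi> x)) = (\<Sum>v\<in>range h. if v = h x then h x * \<beta> \<phi> x else 0)"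
        by (intro sum.cong) (auto simp: A_def)
      then show "h x * \<beta> \<phi> x = (\<Sum>v\<in>range h. v * (indicator (A v) x * \<beta> \<phi> x))"
        using fin by simp
    qed
    also have "\<dots> = (\<Sum>v\<in>range h. v * (\<integral>x. indicator (A v) x * \<beta> \<phi> x \<partial>\<mu>))"
      using A int by (subst Bochner_Integration.integral_sum) (auto intro: integrable_indicator_times)
    finally show "blinfun_apply \<phi> (\<Sum>v\<in>range h. v *\<^sub>R y v) = (\<integral>x. h x * \<beta> \<phi> x \<partial>\<mu>)"
      by (simp add: y blinfun.sum_right blinfun.scaleR_right)
  qed
  then show ?thesis by blast
qed

text \<open>Rounding \<open>h\<close> down to multiples of \<open>1 / Suc n\<close> gives functions
  with finitely many values that converge uniformly. Their integrals form a Cauchy sequence because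
  the sup norm controls them with the factor \<open>C\<close>, and the space is complete.\<close>

lemma exists_represents:
  assumes h: "h \<in> borel_measurable \<mu>" and B: "\<And>x. \<bar>h x\<bar> \<le> B"
  shows "\<exists>z. represents h z"
proof -
  define k where "k n x = of_int \<lfloor>h x * real (Suc n)\<rfloor> / real (Suc n)" for n x
  note h[measurable]
  have k: "k n \<in> borel_measurable \<mu>" for n unfolding k_def by measurable
  have close: "\<bar>h x - k n x\<bar> \<le> 1 / real (Suc n)" for n x
  proof -
    have "\<bar>h x * real (Suc n) - of_int \<lfloor>h x * real (Suc n)\<rfloor>\<bar> \<le> 1" by linarith
    then have "\<bar>h x * real (Suc n) - of_int \<lfloor>h x * real (Suc n)\<rfloor>\<bar> / real (Suc n) \<le> 1 / real (Suc n)"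
      by (intro divide_right_mono) auto
    moreover have "\<bar>h x * real (Suc n) - of_int \<lfloor>h x * real (Suc n)\<rfloor>\<bar> / real (Suc n) = \<bar>h x - k n x\<bar>"
    proof -
      have "h x - k n x = (h x * real (Suc n) - of_int \<lfloor>h x * real (Suc n)\<rfloor>) / real (Suc n)"
        by (simp add: k_def diff_divide_distrib del: of_nat_Suc)
      then show ?thesis by (simp add: abs_divide del: of_nat_Suc)
    qed
    ultimately show ?thesis by simp
  qed
  have kB: "\<bar>k n x\<bar> \<le> B + 1" for n x
  proof -
    have "1 / real (Suc n) \<le> 1" by simp
    then show ?thesis using close[of x n] B[of x] by linarith
  qed
  have fin: "finite (range (k n))" for n
  proof (rule finite_subset)
    define N where "N = \<lceil>(B + 1) * real (Suc n)\<rceil>"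
    show "range (k n) \<subseteq> (\<lambda>i. of_int i / real (Suc n)) ` {- N..N}"
    proof safe
      fix x
      have "\<bar>real_of_int \<lfloor>h x * real (Suc n)\<rfloor>\<bar> = \<bar>k n x\<bar> * real (Suc n)"
        by (simp add: k_def abs_divide del: of_nat_Suc)
      also have "\<dots> \<le> (B + 1) * real (Suc n)" by (intro mult_right_mono kB) auto
      also have "\<dots> \<le> of_int N" unfolding N_def by linarith
      finally have "\<bar>\<lfloor>h x * real (Suc n)\<rfloor>\<bar> \<le> N" by linarith
      then have "\<lfloor>h x * real (Suc n)\<rfloor> \<in> {- N..N}" by auto
      then show "k n x \<in> (\<lambda>i. of_int i / real (Suc n)) ` {- N..N}"
        unfolding k_def by (rule imageI)
    qed
  qed auto
  obtain z where z: "\<And>n. represents (k n) (z n)"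
    using exists_represents_finite_range[OF k fin] by metis
  have zz: "norm (z m - z n) \<le> (1 / real (Suc m) + 1 / real (Suc n)) * C" for m n
  proof (rule norm_le_sup_if_represents[OF _ _ represents_diff[OF k kB k kB z z]])
    show "\<bar>k m x - k n x\<bar> \<le> 1 / real (Suc m) + 1 / real (Suc n)" for x
      using close[of x m] close[of x n] by linarith
  qed (use k in auto)
  have lim0: "(\<lambda>n. 1 / real (Suc n)) \<longlonglongrightarrow> 0"
    using LIMSEQ_inverse_real_of_nat by (simp add: inverse_eq_divide)
  have "Cauchy z"
  proof (rule metric_CauchyI)
    fix e :: real assume e: "0 < e"
    have "(\<lambda>n. 1 / real (Suc n) * C) \<longlonglongrightarrow> 0 * C" by (intro tendsto_intros lim0)
    then have "\<forall>\<^sub>F n in sequentially. 1 / real (Suc n) * C < e / 2"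
      using e by (intro order_tendstoD) auto
    then obtain N where N: "\<And>n. N \<le> n \<Longrightarrow> 1 / real (Suc n) * C < e / 2"
      by (auto simp: eventually_sequentially)
    show "\<exists>M. \<forall>m\<ge>M. \<forall>n\<ge>M. dist (z m) (z n) < e"
    proof (intro exI[of _ N] allI impI)
      fix m n assume "N \<le> m" "N \<le> n"
      then show "dist (z m) (z n) < e"
        using zz[of m n] N[of m] N[of n] unfolding dist_norm distrib_right by linarith
    qed
  qed
  then obtain l where l: "z \<longlonglongrightarrow> l" by (auto simp: Cauchy_convergent_iff convergent_def)
  have "represents h l"
    unfolding represents_def
  proof
    fix \<phi> :: "'x \<Rightarrow>\<^sub>L real"
    have "(\<lambda>n. blinfun_apply \<phi> (z n)) \<longlonglongrightarrow> blinfun_apply \<phi> l"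
      by (intro tendsto_intros l)
    moreover have "(\<lambda>n. blinfun_apply \<phi> (z n)) \<longlonglongrightarrow> (\<integral>x. h x * \<beta> \<phi> x \<partial>\<mu>)"
    proof (rule Lim_transform_bound[where g = "\<lambda>n. 1 / real (Suc n) * (\<integral>x. \<bar>\<beta> \<phi> x\<bar> \<partial>\<mu>)", THEN LIM_zero_cancel])
      show "(\<lambda>n. 1 / real (Suc n) * (\<integral>x. \<bar>\<beta> \<phi> x\<bar> \<partial>\<mu>)) \<longlonglongrightarrow> 0"
        using tendsto_mult[OF lim0 tendsto_const, of "\<integral>x. \<bar>\<beta> \<phi> x\<bar> \<partial>\<mu>"] by simp
      show "\<forall>\<^sub>F n in sequentially. norm (blinfun_apply \<phi> (z n) - (\<integral>x. h x * \<beta> \<phi> x \<partial>\<mu>))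
          \<le> norm (1 / real (Suc n) * (\<integral>x. \<bar>\<beta> \<phi> x\<bar> \<partial>\<mu>))"
      proof (rule always_eventually, rule allI)
        fix n
        have "blinfun_apply \<phi> (z n) - (\<integral>x. h x * \<beta> \<phi> x \<partial>\<mu>) = (\<integral>x. k n x * \<beta> \<phi> x - h x * \<beta> \<phi> x \<partial>\<mu>)"
          using z[of n]
            Bochner_Integration.integral_diff[OF integrable_bounded_times[OF int k kB] integrable_bounded_times[OF int h B], of n \<phi> \<phi>]
          by (simp add: represents_def)
        also have "\<bar>\<dots>\<bar> \<le> (\<integral>x. 1 / real (Suc n) * \<bar>\<beta> \<phi> x\<bar> \<partial>\<mu>)"
        proof (rule abs_integral_le)
          show "integrable \<mu> (\<lambda>x. k n x * \<beta> \<phi> x - h x * \<beta> \<phi> x)"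
            using h B k kB int by (intro Bochner_Integration.integrable_diff integrable_bounded_times)
          show "\<bar>k n x * \<beta> \<phi> x - h x * \<beta> \<phi> x\<bar> \<le> 1 / real (Suc n) * \<bar>\<beta> \<phi> x\<bar>" for x
            using mult_right_mono[OF close[of x n], of "\<bar>\<beta> \<phi> x\<bar>"]
            unfolding left_diff_distrib[symmetric] abs_mult abs_minus_commute[of "k n x"] by simp
        qed (use int in auto)
        finally show "norm (blinfun_apply \<phi> (z n) - (\<integral>x. h x * \<beta> \<phi> x \<partial>\<mu>))
          \<le> norm (1 / real (Suc n) * (\<integral>x. \<bar>\<beta> \<phi> x\<bar> \<partial>\<mu>))" by simp
      qed
    qed
    ultimately show "blinfun_apply \<phi> l = (\<integral>x. h x * \<beta> \<phi> x \<partial>\<mu>)" by (rule LIMSEQ_unique)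
  qed
  then show ?thesis by blast
qed

text \<open>Either \<open>{t < \<bar>h\<bar>}\<close> is small and uniform integrability gives
  \<open>e\<close>, or by Chebyshev's inequality the square integral is at least
  \<open>t\<^sup>2 * \<delta>\<close> and a multiple of it exceeds the trivial bound
  \<open>2 * C\<close>. The bound is linear in the square integral, so a mean can be applied to it
  directly.\<close>

lemma norm_le_L2:
  assumes e: "0 < e"
  shows "\<exists>K\<ge>0. \<forall>h z. h \<in> borel_measurable \<mu> \<longrightarrow> (\<forall>x. \<bar>h x\<bar> \<le> 2) \<longrightarrow> represents h z \<longrightarrow>
    norm z \<le> e + K * (\<integral>x. (h x)\<^sup>2 \<partial>\<mu>)"
proof -
  obtain \<delta> where \<delta>: "0 < \<delta>" "\<And>A \<phi>. A \<in> sets \<mu> \<Longrightarrow> norm \<phi> \<le> 1 \<Longrightarrow> measure \<mu> A < \<delta> \<Longrightarrow>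
      (\<integral>x. indicator A x * \<bar>\<beta> \<phi> x\<bar> \<partial>\<mu>) \<le> e / 8"
    using uniformly_integrable[of "e / 8"] e by auto
  \<comment> \<open>Functions below this level contribute at most \<open>e / 2\<close>;
    \<open>C + 1\<close> keeps the quotient meaningful for \<open>C = 0\<close>.\<close>
  define t where "t = e / (2 * (C + 1))"
  have t: "0 < t" using e C_nonneg by (simp add: t_def)
  have tC: "t * C \<le> e / 2" using e C_nonneg by (simp add: t_def field_simps)
  define K where "K = 2 * C / (t\<^sup>2 * \<delta>)"
  have K: "0 \<le> K" using C_nonneg t \<delta> by (simp add: K_def)
  have "norm z \<le> e + K * (\<integral>x. (h x)\<^sup>2 \<partial>\<mu>)"
    if h: "h \<in> borel_measurable \<mu>" "\<And>x. \<bar>h x\<bar> \<le> 2" and z: "represents h z" for h z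
  proof -
    define A where "A = {x \<in> space \<mu>. t < \<bar>h x\<bar>}"
    have A: "A \<in> sets \<mu>" unfolding A_def using h by measurable
    have nn: "0 \<le> (\<integral>x. (h x)\<^sup>2 \<partial>\<mu>)" by simp
    show ?thesis
    proof (cases "measure \<mu> A < \<delta>")
      case True
      have "norm z \<le> e"
      proof (rule norm_le_if_represents[OF h z])
        fix \<phi> :: "'x \<Rightarrow>\<^sub>L real" assume \<phi>: "norm \<phi> \<le> 1"
        have "\<bar>h x\<bar> * \<bar>\<beta> \<phi> x\<bar> \<le> t * \<bar>\<beta> \<phi> x\<bar> + 2 * (indicator A x * \<bar>\<beta> \<phi> x\<bar>)" if "x \<in> space \<mu>" for x
        proof (cases "x \<in> A")
          case True
          have "\<bar>h x\<bar> * \<bar>\<beta> \<phi> x\<bar> \<le> 2 * \<bar>\<beta> \<phi> x\<bar>" using h(2) by (intro mult_right_mono) auto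
          moreover have "0 \<le> t * \<bar>\<beta> \<phi> x\<bar>" using t by simp
          ultimately show ?thesis using True by simp
        next
          case False
          then show ?thesis using that by (auto simp: A_def intro!: mult_right_mono)
        qed
        then have "(\<integral>x. \<bar>h x\<bar> * \<bar>\<beta> \<phi> x\<bar> \<partial>\<mu>) \<le> (\<integral>x. t * \<bar>\<beta> \<phi> x\<bar> + 2 * (indicator A x * \<bar>\<beta> \<phi> x\<bar>) \<partial>\<mu>)"
          using h int A
          by (intro integral_mono Bochner_Integration.integrable_add integrable_mult_right
              integrable_indicator_times integrable_bounded_times[where B = 2]) auto
        also have "\<dots> = t * (\<integral>x. \<bar>\<beta> \<phi> x\<bar> \<partial>\<mu>) + 2 * (\<integral>x. indicator A x * \<bar>\<beta> \<phi> x\<bar> \<partial>\<mu>)"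
          using int A by (subst Bochner_Integration.integral_add) (auto intro!: integrable_indicator_times)
        also have "\<dots> \<le> t * C + 2 * (e / 8)"
          using C[OF \<phi>] \<delta>(2)[OF A \<phi> True] t by (intro add_mono mult_left_mono) auto
        finally show "(\<integral>x. \<bar>h x\<bar> * \<bar>\<beta> \<phi> x\<bar> \<partial>\<mu>) \<le> e" using tC e by linarith
      qed
      then show ?thesis using K nn by (simp add: add_increasing2)
    next
      case False
      have "t\<^sup>2 * measure \<mu> A = (\<integral>x. t\<^sup>2 * indicator A x \<partial>\<mu>)" using A by simp
      also have "\<dots> \<le> (\<integral>x. (h x)\<^sup>2 \<partial>\<mu>)"
      proof (rule integral_mono)
        show "integrable \<mu> (\<lambda>x. t\<^sup>2 * indicator A x)" using A by (simp add: less_top[symmetric])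
        have "(h x)\<^sup>2 \<le> 2\<^sup>2" for x using h(2)[of x] abs_le_square_iff[of "h x" 2] by simp
        then show "integrable \<mu> (\<lambda>x. (h x)\<^sup>2)"
          using h(1) by (intro integrable_const_bound[where B = 4]) auto
        show "t\<^sup>2 * indicator A x \<le> (h x)\<^sup>2" for x
          using t abs_le_square_iff[of t "h x"] by (auto simp: A_def split: split_indicator)
      qed
      finally have "t\<^sup>2 * \<delta> \<le> (\<integral>x. (h x)\<^sup>2 \<partial>\<mu>)"
        using False mult_left_mono[of \<delta> "measure \<mu> A" "t\<^sup>2"] by simp
      then have "K * (t\<^sup>2 * \<delta>) \<le> K * (\<integral>x. (h x)\<^sup>2 \<partial>\<mu>)" using K by (rule mult_left_mono)
      moreover have "K * (t\<^sup>2 * \<delta>) = 2 * C" using t \<delta> by (simp add: K_def)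
      ultimately show ?thesis using norm_le_sup_if_represents[OF h z] e by simp
    qed
  qed
  then show ?thesis using K by blast
qed

text \<open>One level serves the whole dual ball: \<open>{L < \<bar>\<beta> \<phi>\<bar>}\<close>
  has measure at most \<open>C / L\<close>, which falls below the threshold of uniform
  integrability.\<close>

lemma clip_approximates:
  assumes e: "0 < e"
  shows "\<exists>L\<ge>0. \<forall>\<phi>. norm \<phi> \<le> 1 \<longrightarrow> (\<integral>x. \<bar>\<beta> \<phi> x - clip L (\<beta> \<phi> x)\<bar> \<partial>\<mu>) \<le> e"
proof -
  obtain \<delta> where \<delta>: "0 < \<delta>" "\<And>A \<phi>. A \<in> sets \<mu> \<Longrightarrow> norm \<phi> \<le> 1 \<Longrightarrow> measure \<mu> A < \<delta> \<Longrightarrow>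
      (\<integral>x. indicator A x * \<bar>\<beta> \<phi> x\<bar> \<partial>\<mu>) \<le> e"
    using uniformly_integrable[OF e] by auto
  define L where "L = (C + 1) / \<delta>"
  have L: "0 < L" using \<delta> C_nonneg by (simp add: L_def)
  have "(\<integral>x. \<bar>\<beta> \<phi> x - clip L (\<beta> \<phi> x)\<bar> \<partial>\<mu>) \<le> e" if \<phi>: "norm \<phi> \<le> 1" for \<phi>
  proof -
    define A where "A = {x \<in> space \<mu>. L < \<bar>\<beta> \<phi> x\<bar>}"
    have A: "A \<in> sets \<mu>" unfolding A_def by measurable
    have "L * measure \<mu> A = (\<integral>x. L * indicator A x \<partial>\<mu>)" using A by simp
    also have "\<dots> \<le> (\<integral>x. \<bar>\<beta> \<phi> x\<bar> \<partial>\<mu>)"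
      using A int by (intro integral_mono) (auto simp: A_def less_top[symmetric] split: split_indicator)
    also have "\<dots> \<le> C" by (rule C[OF \<phi>])
    finally have LA: "L * measure \<mu> A \<le> C" .
    have "measure \<mu> A < \<delta>"
    proof (rule ccontr)
      assume "\<not> ?thesis"
      then have "L * \<delta> \<le> L * measure \<mu> A" using L by (intro mult_left_mono) auto
      moreover have "L * \<delta> = C + 1" using \<delta> by (simp add: L_def)
      ultimately show False using LA by linarith
    qed
    then have "(\<integral>x. indicator A x * \<bar>\<beta> \<phi> x\<bar> \<partial>\<mu>) \<le> e" by (intro \<delta> A \<phi>)
    moreover have "(\<integral>x. \<bar>\<beta> \<phi> x - clip L (\<beta> \<phi> x)\<bar> \<partial>\<mu>) \<le> (\<integral>x. indicator A x * \<bar>\<beta> \<phi> x\<bar> \<partial>\<mu>)"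
    proof (rule integral_mono)
      show "integrable \<mu> (\<lambda>x. \<bar>\<beta> \<phi> x - clip L (\<beta> \<phi> x)\<bar>)"
        using L abs_clip_le[of L]
        by (intro integrable_abs Bochner_Integration.integrable_diff int integrable_const_bound[where B = L]) auto
      show "integrable \<mu> (\<lambda>x. indicator A x * \<bar>\<beta> \<phi> x\<bar>)" using A int by (intro integrable_indicator_times) auto
      show "\<bar>\<beta> \<phi> x - clip L (\<beta> \<phi> x)\<bar> \<le> indicator A x * \<bar>\<beta> \<phi> x\<bar>" if "x \<in> space \<mu>" for x
        using abs_diff_clip_le[of L "\<beta> \<phi> x"] L that by (auto simp: A_def split: split_indicator)
    qed
    ultimately show ?thesis by simp
  qed
  then show ?thesis using L by (meson less_imp_le)
qed

end

subsection \<open>Approximation on sets of vectors represented by bounded densities\<close>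

text \<open>\<open>H\<close> selects a representing function for each vector occurring in
  \<open>S\<close>. The mean averages over functional and vector jointly, and in general it is not a
  product.\<close>

locale represented_mean = bounded_vector_density \<mu> \<beta> C + mean S \<Lambda>
  for \<mu> :: "'a measure" and \<beta> :: "('x::banach \<Rightarrow>\<^sub>L real) \<Rightarrow> 'a \<Rightarrow> real" and C
    and S :: "(('x \<Rightarrow>\<^sub>L real) \<times> 'x) set" and \<Lambda> +
  fixes H :: "'x \<Rightarrow> 'a \<Rightarrow> real"
  assumes S_norm: "s \<in> S \<Longrightarrow> norm (fst s) \<le> 1" "s \<in> S \<Longrightarrow> norm (snd s) \<le> 1"
    and H_meas: "s \<in> S \<Longrightarrow> H (snd s) \<in> borel_measurable \<mu>"
    and H_le: "s \<in> S \<Longrightarrow> \<bar>H (snd s) x\<bar> \<le> 1"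
    and H_rep: "s \<in> S \<Longrightarrow> represents (H (snd s)) (snd s)"
begin

text \<open>\<open>range G\<close> is a set of functions: \<open>G\<close> takes finitely many
  functions as values, while each of them may take infinitely many real values. The vectors obtained
  from \<open>G\<close> thus form a finite set.\<close>

definition admissible :: "real \<Rightarrow> (('x \<Rightarrow>\<^sub>L real) \<Rightarrow> 'a \<Rightarrow> real) \<Rightarrow> bool" where
  "admissible B G \<longleftrightarrow> finite (range G) \<and> (\<forall>\<phi>. G \<phi> \<in> borel_measurable \<mu>) \<and> (\<forall>\<phi> x. \<bar>G \<phi> x\<bar> \<le> B)"

lemma admissibleD:
  assumes "admissible B G"
  shows "finite (range G)" "G \<phi> \<in> borel_measurable \<mu>" "\<bar>G \<phi> x\<bar> \<le> B"
  using assms by (auto simp: admissible_def)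

lemma bounded_on_integral:
  assumes "\<And>s. s \<in> S \<Longrightarrow> integrable \<mu> (F s)" "\<And>s x. s \<in> S \<Longrightarrow> \<bar>F s x\<bar> \<le> B"
  shows "bounded_on S (\<lambda>s. \<integral>x. F s x \<partial>\<mu>)"
proof (rule bounded_onI)
  fix s assume s: "s \<in> S"
  have "\<bar>\<integral>x. F s x \<partial>\<mu>\<bar> \<le> (\<integral>x. B \<partial>\<mu>)"
    using assms s by (intro abs_integral_le) auto
  then show "\<bar>\<integral>x. F s x \<partial>\<mu>\<bar> \<le> B * measure \<mu> (space \<mu>)" by (simp add: mult.commute)
qed

lemma integrable_bounded:
  fixes f :: "'a \<Rightarrow> real"
  assumes "f \<in> borel_measurable \<mu>" "\<And>x. \<bar>f x\<bar> \<le> B"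
  shows "integrable \<mu> f"
  using assms by (intro integrable_const_bound[where B = B]) auto

text \<open>
  \<open>H w\<close> depends on both components of \<open>(\<phi>, w)\<close> while \<open>G\<close> sees only \<open>\<phi>\<close>, so the infimum of the energy
  need not be zero. Near-minimizers act as a conditional expectation of \<open>H\<close> given \<open>\<phi>\<close>.
\<close>

definition energy :: "(('x \<Rightarrow>\<^sub>L real) \<Rightarrow> 'a \<Rightarrow> real) \<Rightarrow> real" where
  "energy G = \<Lambda> (\<lambda>s. \<integral>x. (H (snd s) x - G (fst s) x)\<^sup>2 \<partial>\<mu>)"

text \<open>Minus one half of the derivative of \<open>energy\<close> at \<open>G\<close> in the
  direction \<open>G'\<close>.\<close>

definition pairing :: "(('x \<Rightarrow>\<^sub>L real) \<Rightarrow> 'a \<Rightarrow> real) \<Rightarrow> (('x \<Rightarrow>\<^sub>L real) \<Rightarrow> 'a \<Rightarrow> real) \<Rightarrow> real" where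
  "pairing G G' = \<Lambda> (\<lambda>s. \<integral>x. (H (snd s) x - G (fst s) x) * G' (fst s) x \<partial>\<mu>)"

definition min_energy :: real where
  "min_energy = Inf (energy ` {G. admissible 1 G})"

lemma product_bound:
  assumes "\<bar>a\<bar> \<le> A" "\<bar>b\<bar> \<le> B"
  shows "\<bar>a * b :: real\<bar> \<le> A * B"
  using assms by (auto simp: abs_mult intro!: mult_mono)

lemma square_bound: "\<bar>a\<bar> \<le> A \<Longrightarrow> \<bar>(a :: real)\<^sup>2\<bar> \<le> A\<^sup>2"
  using power_mono[of "\<bar>a\<bar>" A 2] by simp

lemma
  assumes G: "admissible B G" and s: "s \<in> S"
  shows diff_meas: "(\<lambda>x. H (snd s) x - G (fst s) x) \<in> borel_measurable \<mu>"
    and diff_le: "\<bar>H (snd s) x - G (fst s) x\<bar> \<le> 1 + B"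
  using admissibleD[OF G] H_meas[OF s] H_le[OF s, of x]
  by (auto simp: abs_le_iff) (smt (verit) admissibleD(3)[OF G])+

lemma energy_integrable:
  assumes "admissible B G" "s \<in> S"
  shows "integrable \<mu> (\<lambda>x. (H (snd s) x - G (fst s) x)\<^sup>2)"
  using diff_meas[OF assms] square_bound[OF diff_le[OF assms]]
  by (intro integrable_bounded[where B = "(1 + B)\<^sup>2"] borel_measurable_power)

lemma bounded_on_energy:
  assumes "admissible B G"
  shows "bounded_on S (\<lambda>s. \<integral>x. (H (snd s) x - G (fst s) x)\<^sup>2 \<partial>\<mu>)"
  using energy_integrable[OF assms] square_bound[OF diff_le[OF assms]]
  by (intro bounded_on_integral[where B = "(1 + B)\<^sup>2"])

lemma pairing_integrable:
  assumes "admissible B G" "admissible B' G'" "s \<in> S"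
  shows "integrable \<mu> (\<lambda>x. (H (snd s) x - G (fst s) x) * G' (fst s) x)"
  using diff_meas[OF assms(1,3)] product_bound[OF diff_le[OF assms(1,3)] admissibleD(3)[OF assms(2)]] admissibleD(2)[OF assms(2)]
  by (intro integrable_bounded[where B = "(1 + B) * B'"] borel_measurable_times) auto

lemma bounded_on_pairing:
  assumes "admissible B G" "admissible B' G'"
  shows "bounded_on S (\<lambda>s. \<integral>x. (H (snd s) x - G (fst s) x) * G' (fst s) x \<partial>\<mu>)"
  using pairing_integrable[OF assms] product_bound[OF diff_le[OF assms(1)] admissibleD(3)[OF assms(2)]]
  by (intro bounded_on_integral[where B = "(1 + B) * B'"]) auto

lemma square_integrable:
  assumes "admissible B G"
  shows "integrable \<mu> (\<lambda>x. (G \<phi> x)\<^sup>2)"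
  using square_bound[OF admissibleD(3)[OF assms]] admissibleD(2)[OF assms]
  by (intro integrable_bounded[where B = "B\<^sup>2"] borel_measurable_power)

lemma square_integral_le:
  assumes "admissible B G"
  shows "(\<integral>x. (G \<phi> x)\<^sup>2 \<partial>\<mu>) \<le> B\<^sup>2 * measure \<mu> (space \<mu>)"
proof -
  have "(\<integral>x. (G \<phi> x)\<^sup>2 \<partial>\<mu>) \<le> (\<integral>x. B\<^sup>2 \<partial>\<mu>)"
    using square_integrable[OF assms] admissibleD(3)[OF assms]
    by (intro integral_mono) (auto intro: order_trans[OF abs_ge_self square_bound])
  then show ?thesis by (simp add: mult.commute)
qed

lemma bounded_on_square:
  assumes "admissible B G"
  shows "bounded_on S (\<lambda>s. \<integral>x. (G (fst s) x)\<^sup>2 \<partial>\<mu>)"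
  using square_integral_le[OF assms]
  by (intro bounded_onI[where B = "B\<^sup>2 * measure \<mu> (space \<mu>)"]) simp

lemma energy_nonneg: "admissible B G \<Longrightarrow> 0 \<le> energy G"
  unfolding energy_def by (intro ge_bound bounded_on_energy) auto

lemma admissible_add:
  assumes "admissible B G" "admissible B' G'"
  shows "admissible (B + B') (\<lambda>\<phi> x. G \<phi> x + G' \<phi> x)"
proof -
  have "range (\<lambda>\<phi> x. G \<phi> x + G' \<phi> x) \<subseteq> (\<lambda>(g, g') x. g x + g' x) ` (range G \<times> range G')" by auto
  then have "finite (range (\<lambda>\<phi> x. G \<phi> x + G' \<phi> x))"
    by (rule finite_subset[OF _ finite_imageI[OF finite_cartesian_product[OF
          admissibleD(1)[OF assms(1)] admissibleD(1)[OF assms(2)]]]])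
  moreover have "\<bar>G \<phi> x + G' \<phi> x\<bar> \<le> B + B'" for \<phi> x
    using admissibleD(3)[OF assms(1), of \<phi> x] admissibleD(3)[OF assms(2), of \<phi> x] by linarith
  ultimately show ?thesis
    using assms by (auto simp: admissible_def intro: borel_measurable_add)
qed

lemma admissible_compose:
  assumes "admissible B G" "f \<in> borel_measurable borel" "\<And>x. \<bar>x\<bar> \<le> B \<Longrightarrow> \<bar>f x\<bar> \<le> B'"
  shows "admissible B' (\<lambda>\<phi> x. f (G \<phi> x))"
proof -
  have "range (\<lambda>\<phi> x. f (G \<phi> x)) = (\<lambda>g x. f (g x)) ` range G" by auto
  then have "finite (range (\<lambda>\<phi> x. f (G \<phi> x)))" using admissibleD(1)[OF assms(1)] by auto
  moreover have "(\<lambda>x. f (G \<phi> x)) \<in> borel_measurable \<mu>" for \<phi>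
    using measurable_compose[OF admissibleD(2)[OF assms(1)] assms(2)] .
  ultimately show ?thesis
    using admissibleD(3)[OF assms(1)] assms(3) by (auto simp: admissible_def)
qed

text \<open>Clipping does not increase the energy, so the infimum bounds the unclipped variations as well.\<close>

lemma min_energy_le:
  assumes G: "admissible B G"
  shows "min_energy \<le> energy G"
proof -
  let ?G = "\<lambda>\<phi> x. clip 1 (G \<phi> x)"
  have a: "admissible 1 ?G"
    using G by (rule admissible_compose) (auto simp: abs_clip_le)
  have "min_energy \<le> energy ?G"
    unfolding min_energy_def using a energy_nonneg by (intro cInf_lower bdd_belowI[of _ 0]) auto
  also have "\<dots> \<le> energy G"
    unfolding energy_def
    by (intro mono bounded_on_energy[OF a] bounded_on_energy[OF G] integral_mono
        energy_integrable[OF a] energy_integrable[OF G] clip_closer H_le)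
  finally show ?thesis .
qed

lemma exists_near_minimizer:
  assumes "0 < e"
  shows "\<exists>G. admissible 1 G \<and> energy G \<le> min_energy + e"
proof -
  have "admissible 1 (\<lambda>_ _. 0)" by (simp add: admissible_def)
  then have "energy ` {G. admissible 1 G} \<noteq> {}" by auto
  then have "\<exists>r\<in>energy ` {G. admissible 1 G}. r < min_energy + e"
    unfolding min_energy_def using assms by (intro cInf_lessD) auto
  then show ?thesis by auto
qed

text \<open>The first order condition at an approximate minimum: the energy of
  \<open>G + t G'\<close> is a quadratic polynomial in \<open>t\<close> up to replacing its leading
  coefficient by the bound \<open>q\<close>, and it cannot fall below the infimum.\<close>

lemma pairing_le:
  assumes G: "admissible 1 G" and e: "energy G \<le> min_energy + e\<^sup>2" "0 < e" and G': "admissible B G'"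
  shows "\<bar>pairing G G'\<bar> \<le> e * (1 + B\<^sup>2 * measure \<mu> (space \<mu>))"
proof -
  define q where "q = B\<^sup>2 * measure \<mu> (space \<mu>)"
  have q: "0 \<le> q" by (simp add: q_def)
  have main: "2 * t * pairing G G' \<le> e\<^sup>2 + t\<^sup>2 * q" for t
  proof -
    have a: "admissible (1 + \<bar>t\<bar> * B) (\<lambda>\<phi> x. G \<phi> x + t * G' \<phi> x)"
      using G' by (intro admissible_add G admissible_compose[OF G']) (auto simp: abs_mult intro: mult_left_mono)
    have expand: "(\<integral>x. (H (snd s) x - (G (fst s) x + t * G' (fst s) x))\<^sup>2 \<partial>\<mu>) =
      (\<integral>x. (H (snd s) x - G (fst s) x)\<^sup>2 \<partial>\<mu>) - 2 * t * (\<integral>x. (H (snd s) x - G (fst s) x) * G' (fst s) x \<partial>\<mu>)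
        + t\<^sup>2 * (\<integral>x. (G' (fst s) x)\<^sup>2 \<partial>\<mu>)" if s: "s \<in> S" for s
    proof -
      have "(\<integral>x. (H (snd s) x - (G (fst s) x + t * G' (fst s) x))\<^sup>2 \<partial>\<mu>) =
        (\<integral>x. (H (snd s) x - G (fst s) x)\<^sup>2 - 2 * t * ((H (snd s) x - G (fst s) x) * G' (fst s) x)
           + t\<^sup>2 * (G' (fst s) x)\<^sup>2 \<partial>\<mu>)"
        by (intro Bochner_Integration.integral_cong refl) (simp add: power2_eq_square algebra_simps)
      then show ?thesis
        using energy_integrable[OF G s] pairing_integrable[OF G G' s] square_integrable[OF G', of "fst s"] by simp
    qed
    have "min_energy \<le> energy (\<lambda>\<phi> x. G \<phi> x + t * G' \<phi> x)" by (rule min_energy_le[OF a])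
    then have "min_energy \<le> \<Lambda> (\<lambda>s. \<integral>x. (H (snd s) x - (G (fst s) x + t * G' (fst s) x))\<^sup>2 \<partial>\<mu>)"
      by (simp add: energy_def)
    also have "\<dots> \<le> \<Lambda> (\<lambda>s. (\<integral>x. (H (snd s) x - G (fst s) x)\<^sup>2 \<partial>\<mu>)
        + (- 2 * t) * (\<integral>x. (H (snd s) x - G (fst s) x) * G' (fst s) x \<partial>\<mu>) + t\<^sup>2 * q)"
    proof (rule mono)
      show "bounded_on S (\<lambda>s. \<integral>x. (H (snd s) x - (G (fst s) x + t * G' (fst s) x))\<^sup>2 \<partial>\<mu>)"
        by (rule bounded_on_energy[OF a])
      show "bounded_on S (\<lambda>s. (\<integral>x. (H (snd s) x - G (fst s) x)\<^sup>2 \<partial>\<mu>)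
        + (- 2 * t) * (\<integral>x. (H (snd s) x - G (fst s) x) * G' (fst s) x \<partial>\<mu>) + t\<^sup>2 * q)"
        by (intro bounded_on_add bounded_on_cmult bounded_on_const bounded_on_energy[OF G] bounded_on_pairing[OF G G'])
      fix s assume s: "s \<in> S"
      have "t\<^sup>2 * (\<integral>x. (G' (fst s) x)\<^sup>2 \<partial>\<mu>) \<le> t\<^sup>2 * q"
        unfolding q_def by (intro mult_left_mono square_integral_le[OF G']) auto
      then show "(\<integral>x. (H (snd s) x - (G (fst s) x + t * G' (fst s) x))\<^sup>2 \<partial>\<mu>) \<le>
        (\<integral>x. (H (snd s) x - G (fst s) x)\<^sup>2 \<partial>\<mu>)
        + (- 2 * t) * (\<integral>x. (H (snd s) x - G (fst s) x) * G' (fst s) x \<partial>\<mu>) + t\<^sup>2 * q"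
        using expand[OF s] by simp
    qed
    also have "\<dots> = energy G + (- 2 * t) * pairing G G' + t\<^sup>2 * q"
      unfolding energy_def pairing_def
      by (simp only: add cmult const bounded_on_add bounded_on_cmult bounded_on_const
          bounded_on_energy[OF G] bounded_on_pairing[OF G G'])
    finally show ?thesis using e by simp
  qed
  \<comment> \<open>The steps \<open>t = e\<close> and \<open>t = -e\<close> balance the energy
    defect \<open>e\<^sup>2\<close> against the quadratic term.\<close>
  have "2 * e * \<bar>pairing G G'\<bar> \<le> e\<^sup>2 + e\<^sup>2 * q"
    using main[of e] main[of "- e"] by (cases "0 \<le> pairing G G'") auto
  then have "e * (2 * \<bar>pairing G G'\<bar>) \<le> e * (e * (1 + q))" by (simp add: power2_eq_square algebra_simps)
  then have "2 * \<bar>pairing G G'\<bar> \<le> e * (1 + q)" using e(2) by simp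
  then show ?thesis by (simp add: q_def)
qed

text \<open>The midpoint is admissible with the same bound, so four times its energy cancels the
  four copies of the infimum and only the defects remain.\<close>

lemma energy_parallelogram:
  assumes G: "admissible 1 G" "energy G \<le> min_energy + e" and G': "admissible 1 G'" "energy G' \<le> min_energy + e"
  shows "\<Lambda> (\<lambda>s. \<integral>x. (G (fst s) x - G' (fst s) x)\<^sup>2 \<partial>\<mu>) \<le> 4 * e"
proof -
  let ?M = "\<lambda>\<phi> x. (1/2) * G \<phi> x + (1/2) * G' \<phi> x"
  have M: "admissible (1/2 + 1/2) ?M"
    by (intro admissible_add admissible_compose[OF G(1)] admissible_compose[OF G'(1)]) auto
  have eq: "(\<integral>x. (G (fst s) x - G' (fst s) x)\<^sup>2 \<partial>\<mu>) = 2 * (\<integral>x. (H (snd s) x - G (fst s) x)\<^sup>2 \<partial>\<mu>)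
      + 2 * (\<integral>x. (H (snd s) x - G' (fst s) x)\<^sup>2 \<partial>\<mu>) + (-4) * (\<integral>x. (H (snd s) x - ?M (fst s) x)\<^sup>2 \<partial>\<mu>)"
    if s: "s \<in> S" for s
  proof -
    have "(\<integral>x. (G (fst s) x - G' (fst s) x)\<^sup>2 \<partial>\<mu>) = (\<integral>x. 2 * (H (snd s) x - G (fst s) x)\<^sup>2
      + 2 * (H (snd s) x - G' (fst s) x)\<^sup>2 + (-4) * (H (snd s) x - ?M (fst s) x)\<^sup>2 \<partial>\<mu>)"
      by (intro Bochner_Integration.integral_cong refl) (simp add: power2_eq_square field_simps)
    then show ?thesis
      using energy_integrable[OF G(1) s] energy_integrable[OF G'(1) s] energy_integrable[OF M s]
      by (simp add: Bochner_Integration.integral_add Bochner_Integration.integral_diff)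
  qed
  have bd: "bounded_on S (\<lambda>s. 2 * (\<integral>x. (H (snd s) x - G (fst s) x)\<^sup>2 \<partial>\<mu>)
      + 2 * (\<integral>x. (H (snd s) x - G' (fst s) x)\<^sup>2 \<partial>\<mu>) + (-4) * (\<integral>x. (H (snd s) x - ?M (fst s) x)\<^sup>2 \<partial>\<mu>))"
    by (intro bounded_on_add bounded_on_cmult bounded_on_energy[OF G(1)] bounded_on_energy[OF G'(1)] bounded_on_energy[OF M])
  have "\<Lambda> (\<lambda>s. \<integral>x. (G (fst s) x - G' (fst s) x)\<^sup>2 \<partial>\<mu>) \<le> \<Lambda> (\<lambda>s. 2 * (\<integral>x. (H (snd s) x - G (fst s) x)\<^sup>2 \<partial>\<mu>)
      + 2 * (\<integral>x. (H (snd s) x - G' (fst s) x)\<^sup>2 \<partial>\<mu>) + (-4) * (\<integral>x. (H (snd s) x - ?M (fst s) x)\<^sup>2 \<partial>\<mu>))"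
  proof (rule mono[OF _ bd])
    show "bounded_on S (\<lambda>s. \<integral>x. (G (fst s) x - G' (fst s) x)\<^sup>2 \<partial>\<mu>)"
      using bd eq by (simp add: bounded_on_def)
  qed (simp add: eq)
  also have "\<dots> = 2 * energy G + 2 * energy G' + (-4) * energy ?M"
    unfolding energy_def
    by (simp only: add cmult bounded_on_add bounded_on_cmult bounded_on_energy[OF G(1)]
        bounded_on_energy[OF G'(1)] bounded_on_energy[OF M])
  also have "\<dots> \<le> 4 * e" using G(2) G'(2) min_energy_le[OF M] by simp
  finally show ?thesis .
qed

section \<open>Vectors represented by near-minimizers\<close>

definition J :: "('a \<Rightarrow> real) \<Rightarrow> 'x" where
  "J h = (SOME z. represents h z)"

lemma represents_J: "admissible B G \<Longrightarrow> represents (G \<phi>) (J (G \<phi>))"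
  unfolding J_def using exists_represents[of "G \<phi>" B] by (auto simp: admissible_def intro: someI_ex)

lemma norm_J: "admissible 1 G \<Longrightarrow> norm (J (G \<phi>)) \<le> C"
  using norm_le_sup_if_represents[OF _ _ represents_J, of G \<phi> 1 1] by (simp add: admissible_def)

lemma bounded_on_apply:
  assumes "\<And>s. s \<in> S \<Longrightarrow> norm (a s) \<le> A" "\<And>s. s \<in> S \<Longrightarrow> norm (v s) \<le> B" "0 \<le> A"
  shows "bounded_on S (\<lambda>s. blinfun_apply (a s) (v s :: 'x) :: real)"
proof (rule bounded_onI[where B = "A * B"])
  fix s assume s: "s \<in> S"
  have "\<bar>blinfun_apply (a s) (v s)\<bar> \<le> norm (a s) * norm (v s)"
    using norm_blinfun[of "a s" "v s"] by simp
  also have "\<dots> \<le> A * B" using assms s by (intro mult_mono) auto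
  finally show "\<bar>blinfun_apply (a s) (v s)\<bar> \<le> A * B" .
qed

text \<open>For test functionals that are functions of \<open>\<phi>\<close> with finite range,
  \<open>w\<close> and \<open>J (G \<phi>)\<close> agree in the mean up to \<open>e\<close>. The
  clipped density \<open>clip L (\<beta> (a \<phi>))\<close> is an admissible direction, to which
  \<open>H - G\<close> is nearly orthogonal, and the part cut off is uniformly small. The threshold
  \<open>\<gamma>\<close> does not depend on the test \<open>a\<close>.\<close>

lemma near_minimizer_averages:
  assumes e: "0 < e"
  obtains \<gamma> where "0 < \<gamma>"
    "\<And>\<delta> G a. 0 < \<delta> \<Longrightarrow> \<delta> \<le> \<gamma> \<Longrightarrow> admissible 1 G \<Longrightarrow> energy G \<le> min_energy + \<delta>\<^sup>2 \<Longrightarrow> finite (range a) \<Longrightarrow>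
      (\<And>\<phi>. norm (a \<phi>) \<le> 1) \<Longrightarrow>
      \<bar>\<Lambda> (\<lambda>s. blinfun_apply (a (fst s)) (snd s) - blinfun_apply (a (fst s)) (J (G (fst s))))\<bar> \<le> e"
proof -
  \<comment> \<open>The factor \<open>H - G\<close> is bounded by 2, so clipping costs
    \<open>e / 2\<close> in the end.\<close>
  obtain L where L: "0 \<le> L" "\<And>\<phi>. norm \<phi> \<le> 1 \<Longrightarrow> (\<integral>x. \<bar>\<beta> \<phi> x - clip L (\<beta> \<phi> x)\<bar> \<partial>\<mu>) \<le> e / 4"
    using clip_approximates[of "e / 4"] e by auto
  define q where "q = 1 + L\<^sup>2 * measure \<mu> (space \<mu>)"
  have q: "0 < q" by (simp add: q_def add_pos_nonneg)
  have main: "\<bar>\<Lambda> (\<lambda>s. blinfun_apply (a (fst s)) (snd s) - blinfun_apply (a (fst s)) (J (G (fst s))))\<bar> \<le> e"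
    if \<delta>: "0 < \<delta>" "\<delta> \<le> e / (2 * q)" and G: "admissible 1 G" "energy G \<le> min_energy + \<delta>\<^sup>2"
      and a: "finite (range a)" "\<And>\<phi>. norm (a \<phi>) \<le> 1" for \<delta> G a
  proof -
    define G' where "G' \<phi> x = clip L (\<beta> (a \<phi>) x)" for \<phi> x
    have "range G' = (\<lambda>\<psi> x. clip L (\<beta> \<psi> x)) ` range a" by (auto simp: G'_def[abs_def])
    moreover have "G' \<phi> \<in> borel_measurable \<mu>" for \<phi>
      unfolding G'_def by measurable
    ultimately have G': "admissible L G'"
      using a(1) L(1) by (auto simp: admissible_def G'_def abs_clip_le)
    define R where "R s = (\<integral>x. (H (snd s) x - G (fst s) x) * (\<beta> (a (fst s)) x - G' (fst s) x) \<partial>\<mu>)" for s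
    have cint: "integrable \<mu> (\<lambda>x. \<beta> (a \<phi>) x - G' \<phi> x)" for \<phi>
      using admissibleD[OF G'] by (intro Bochner_Integration.integrable_diff int integrable_bounded[where B = L]) auto
    have R: "\<bar>R s\<bar> \<le> e / 2" if s: "s \<in> S" for s
    proof -
      have "\<bar>R s\<bar> \<le> (\<integral>x. 2 * \<bar>\<beta> (a (fst s)) x - G' (fst s) x\<bar> \<partial>\<mu>)"
        unfolding R_def
      proof (rule abs_integral_le)
        show "integrable \<mu> (\<lambda>x. (H (snd s) x - G (fst s) x) * (\<beta> (a (fst s)) x - G' (fst s) x))"
          by (rule integrable_bounded_times[OF cint diff_meas[OF G(1) s] diff_le[OF G(1) s]])
        show "\<bar>(H (snd s) x - G (fst s) x) * (\<beta> (a (fst s)) x - G' (fst s) x)\<bar> \<le> 2 * \<bar>\<beta> (a (fst s)) x - G' (fst s) x\<bar>" for x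
          using diff_le[OF G(1) s, of x] unfolding abs_mult by (intro mult_right_mono) auto
      qed (intro integrable_mult_right integrable_abs cint)
      also have "\<dots> \<le> 2 * (e / 4)" using L(2)[OF a(2), of "fst s"] by (simp add: G'_def)
      finally show ?thesis by simp
    qed
    have eq: "blinfun_apply (a (fst s)) (snd s) - blinfun_apply (a (fst s)) (J (G (fst s))) =
      (\<integral>x. (H (snd s) x - G (fst s) x) * G' (fst s) x \<partial>\<mu>) + R s" if s: "s \<in> S" for s
    proof -
      have "blinfun_apply (a (fst s)) (snd s) - blinfun_apply (a (fst s)) (J (G (fst s)))
          = (\<integral>x. (H (snd s) x - G (fst s) x) * \<beta> (a (fst s)) x \<partial>\<mu>)"
        using represents_diff[OF H_meas[OF s] H_le[OF s] admissibleD(2,3)[OF G(1)] H_rep[OF s] represents_J[OF G(1)]]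
        by (simp add: represents_def blinfun.diff_right)
      also have "\<dots> = (\<integral>x. (H (snd s) x - G (fst s) x) * G' (fst s) x
          + (H (snd s) x - G (fst s) x) * (\<beta> (a (fst s)) x - G' (fst s) x) \<partial>\<mu>)"
        by (simp add: algebra_simps)
      also have "\<dots> = (\<integral>x. (H (snd s) x - G (fst s) x) * G' (fst s) x \<partial>\<mu>) + R s"
        unfolding R_def
        by (intro Bochner_Integration.integral_add pairing_integrable[OF G(1) G' s]
            integrable_bounded_times[OF cint diff_meas[OF G(1) s] diff_le[OF G(1) s]])
      finally show ?thesis .
    qed
    have b1: "bounded_on S (\<lambda>s. blinfun_apply (a (fst s)) (snd s) - blinfun_apply (a (fst s)) (J (G (fst s))))"
      using a S_norm norm_J[OF G(1)] by (intro bounded_on_diff bounded_on_apply[where A = 1]) auto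
    have b2: "bounded_on S (\<lambda>s. \<integral>x. (H (snd s) x - G (fst s) x) * G' (fst s) x \<partial>\<mu>)"
      by (rule bounded_on_pairing[OF G(1) G'])
    have "\<bar>\<Lambda> (\<lambda>s. (blinfun_apply (a (fst s)) (snd s) - blinfun_apply (a (fst s)) (J (G (fst s)))) -
        (\<integral>x. (H (snd s) x - G (fst s) x) * G' (fst s) x \<partial>\<mu>))\<bar> \<le> \<Lambda> (\<lambda>_. e / 2)"
      by (rule abs_le) (use b1 b2 eq R in \<open>auto intro: bounded_on_diff\<close>)
    then have "\<bar>\<Lambda> (\<lambda>s. blinfun_apply (a (fst s)) (snd s) - blinfun_apply (a (fst s)) (J (G (fst s)))) - pairing G G'\<bar> \<le> e / 2"
      unfolding diff[OF b1 b2] const pairing_def .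
    moreover have "\<bar>pairing G G'\<bar> \<le> \<delta> * q"
      unfolding q_def by (rule pairing_le[OF G \<delta>(1) G'])
    moreover have "\<delta> * q \<le> e / 2" using \<delta> q by (simp add: field_simps)
    ultimately show ?thesis by linarith
  qed
  have "0 < e / (2 * q)" using e q by simp
  then show thesis by (rule that) (rule main)
qed

definition minimizers_close :: "real \<Rightarrow> real \<Rightarrow> bool" where
  "minimizers_close \<gamma> e \<longleftrightarrow> (\<forall>G G'. admissible 1 G \<longrightarrow> admissible 1 G' \<longrightarrow> energy G \<le> min_energy + \<gamma> \<longrightarrow>
    energy G' \<le> min_energy + \<gamma> \<longrightarrow> \<Lambda> (\<lambda>s. norm (J (G (fst s)) - J (G' (fst s)))) \<le> e)"

text \<open>The parallelogram estimate controls the mean square distance of the functions;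
  \<open>norm_le_L2\<close> passes from there to the vectors.\<close>

lemma near_minimizers_close:
  assumes e: "0 < e"
  shows "\<exists>\<gamma>>0. minimizers_close \<gamma> e"
proof -
  obtain K where K: "0 \<le> K" "\<And>h z. h \<in> borel_measurable \<mu> \<Longrightarrow> (\<And>x. \<bar>h x\<bar> \<le> 2) \<Longrightarrow> represents h z \<Longrightarrow>
      norm z \<le> e / 2 + K * (\<integral>x. (h x)\<^sup>2 \<partial>\<mu>)"
    using norm_le_L2[of "e / 2"] e by auto
  have "\<Lambda> (\<lambda>s. norm (J (G (fst s)) - J (G' (fst s)))) \<le> e"
    if G: "admissible 1 G" "energy G \<le> min_energy + e / (8 * (K + 1))"
      and G': "admissible 1 G'" "energy G' \<le> min_energy + e / (8 * (K + 1))" for G G'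
  proof -
    have adm: "admissible (1 + 1) (\<lambda>\<phi> x. G \<phi> x + (- 1) * G' \<phi> x)"
      by (intro admissible_add G admissible_compose[OF G'(1)]) auto
    have b: "bounded_on S (\<lambda>s. \<integral>x. (G (fst s) x - G' (fst s) x)\<^sup>2 \<partial>\<mu>)"
      using bounded_on_square[OF adm] by simp
    have "\<Lambda> (\<lambda>s. norm (J (G (fst s)) - J (G' (fst s)))) \<le>
      \<Lambda> (\<lambda>s. e / 2 + K * (\<integral>x. (G (fst s) x - G' (fst s) x)\<^sup>2 \<partial>\<mu>))"
    proof (rule mono)
      show "bounded_on S (\<lambda>s. norm (J (G (fst s)) - J (G' (fst s))))"
      proof (rule bounded_onI)
        show "\<bar>norm (J (G (fst s)) - J (G' (fst s)))\<bar> \<le> C + C" for s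
          using norm_triangle_ineq4[of "J (G (fst s))" "J (G' (fst s))"] norm_J[OF G(1), of "fst s"] norm_J[OF G'(1), of "fst s"]
          by simp
      qed
      show "bounded_on S (\<lambda>s. e / 2 + K * (\<integral>x. (G (fst s) x - G' (fst s) x)\<^sup>2 \<partial>\<mu>))"
        by (intro bounded_on_add bounded_on_cmult bounded_on_const b)
      fix s assume "s \<in> S"
      have "represents (\<lambda>x. G (fst s) x - G' (fst s) x) (J (G (fst s)) - J (G' (fst s)))"
        by (rule represents_diff[OF admissibleD(2,3)[OF G(1)] admissibleD(2,3)[OF G'(1)] represents_J[OF G(1)] represents_J[OF G'(1)]])
      then show "norm (J (G (fst s)) - J (G' (fst s))) \<le> e / 2 + K * (\<integral>x. (G (fst s) x - G' (fst s) x)\<^sup>2 \<partial>\<mu>)"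
        using admissibleD(2,3)[OF adm] by (intro K) auto
    qed
    also have "\<dots> = e / 2 + K * \<Lambda> (\<lambda>s. \<integral>x. (G (fst s) x - G' (fst s) x)\<^sup>2 \<partial>\<mu>)"
      by (simp only: add cmult const bounded_on_add bounded_on_cmult bounded_on_const b)
    \<comment> \<open>The factor 4 comes from the parallelogram estimate; with
      \<open>8 * (K + 1)\<close> the second term stays below \<open>e / 2\<close>.\<close>
    also have "\<dots> \<le> e / 2 + K * (4 * (e / (8 * (K + 1))))"
      using K(1) energy_parallelogram[OF G G'] by (intro add_left_mono mult_left_mono)
    also have "\<dots> \<le> e" using K(1) e by (simp add: field_simps)
    finally show ?thesis .
  qed
  then show ?thesis
    using e K(1) by (intro exI[of _ "e / (8 * (K + 1))"]) (auto simp: minimizers_close_def)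
qed

end

section \<open>Finite rank operators and discretization of their adjoints\<close>

definition finite_rank :: "('y::real_normed_vector \<Rightarrow>\<^sub>L 'x::real_normed_vector) \<Rightarrow> bool" where
  "finite_rank T \<longleftrightarrow> (\<exists>B. finite B \<and> range (blinfun_apply T) \<subseteq> span B)"

lemma finite_rank_combination:
  assumes "finite_rank T" "finite_rank T'"
  shows "finite_rank (u *\<^sub>R T + v *\<^sub>R T')"
proof -
  obtain B B' where B: "finite B" "range (blinfun_apply T) \<subseteq> span B" "finite B'" "range (blinfun_apply T') \<subseteq> span B'"
    using assms by (auto simp: finite_rank_def)
  have "span B \<subseteq> span (B \<union> B')" "span B' \<subseteq> span (B \<union> B')" by (intro span_mono; simp)+
  then have "blinfun_apply T x \<in> span (B \<union> B')" "blinfun_apply T' x \<in> span (B \<union> B')" for x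
    using B(2,4) rangeI[of "blinfun_apply T" x] rangeI[of "blinfun_apply T'" x] by blast+
  then have "range (blinfun_apply (u *\<^sub>R T + v *\<^sub>R T')) \<subseteq> span (B \<union> B')"
    by (auto simp: blinfun.add_left blinfun.scaleR_left intro!: span_add span_scale)
  then show ?thesis using B unfolding finite_rank_def by (intro exI[of _ "B \<union> B'"]) auto
qed

lemma finite_range_rounding:
  fixes f :: "'a \<Rightarrow> real"
  assumes "\<And>x. \<bar>f x\<bar> \<le> B" "0 < \<kappa>"
  shows "finite (range (\<lambda>x. \<kappa> * of_int \<lfloor>f x / \<kappa>\<rfloor>))" "\<bar>\<kappa> * of_int \<lfloor>f x / \<kappa>\<rfloor> - f x\<bar> \<le> \<kappa>"
proof -
  have "\<lfloor>f x / \<kappa>\<rfloor> \<in> {\<lfloor>- B / \<kappa>\<rfloor>..\<lfloor>B / \<kappa>\<rfloor>}" for x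
  proof -
    have "- B \<le> f x" "f x \<le> B" using assms(1)[of x] by (simp_all add: abs_le_iff)
    then have "- B / \<kappa> \<le> f x / \<kappa>" "f x / \<kappa> \<le> B / \<kappa>" using assms(2) by (intro divide_right_mono; simp)+
    then show ?thesis by (simp add: floor_mono)
  qed
  then have "range (\<lambda>x. \<kappa> * of_int \<lfloor>f x / \<kappa>\<rfloor>) \<subseteq> (\<lambda>i. \<kappa> * of_int i) ` {\<lfloor>- B / \<kappa>\<rfloor>..\<lfloor>B / \<kappa>\<rfloor>}" by auto
  then show "finite (range (\<lambda>x. \<kappa> * of_int \<lfloor>f x / \<kappa>\<rfloor>))" by (rule finite_subset) auto
  have "\<bar>of_int \<lfloor>f x / \<kappa>\<rfloor> - f x / \<kappa>\<bar> \<le> 1" by linarith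
  then have "\<kappa> * \<bar>of_int \<lfloor>f x / \<kappa>\<rfloor> - f x / \<kappa>\<bar> \<le> \<kappa> * 1" using assms(2) by (intro mult_left_mono) auto
  also have "\<kappa> * \<bar>of_int \<lfloor>f x / \<kappa>\<rfloor> - f x / \<kappa>\<bar> = \<bar>\<kappa> * (of_int \<lfloor>f x / \<kappa>\<rfloor> - f x / \<kappa>)\<bar>"
    using assms(2) by (simp add: abs_mult)
  also have "\<kappa> * (of_int \<lfloor>f x / \<kappa>\<rfloor> - f x / \<kappa>) = \<kappa> * of_int \<lfloor>f x / \<kappa>\<rfloor> - f x"
    using assms(2) by (simp add: right_diff_distrib)
  finally show "\<bar>\<kappa> * of_int \<lfloor>f x / \<kappa>\<rfloor> - f x\<bar> \<le> \<kappa>" by simp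
qed

text \<open>The adjoint sends \<open>\<phi>\<close> to the combination of the \<open>a i\<close>
  with coefficients \<open>\<phi> (y i)\<close>. On the unit ball these coefficients are bounded,
  and rounding them to a grid of mesh \<open>\<kappa>\<close> leaves finitely many
  combinations.\<close>

lemma finite_rank_adjoint_finite_range:
  fixes T :: "'y::real_normed_vector \<Rightarrow>\<^sub>L 'x::real_normed_vector"
  assumes T: "finite_rank T" and e: "0 < e"
  obtains b :: "('x \<Rightarrow>\<^sub>L real) \<Rightarrow> ('y \<Rightarrow>\<^sub>L real)" where "finite (range b)"
    "\<And>\<phi> v. norm \<phi> \<le> 1 \<Longrightarrow> \<bar>blinfun_apply \<phi> (blinfun_apply T v) - blinfun_apply (b \<phi>) v\<bar> \<le> e * norm v"
proof -
  obtain N :: nat and a :: "nat \<Rightarrow> 'y \<Rightarrow>\<^sub>L real" and y :: "nat \<Rightarrow> 'x"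
    where T: "\<And>v. blinfun_apply T v = (\<Sum>i<N. blinfun_apply (a i) v *\<^sub>R y i)"
    using T finite_rank_blinfun_representation[of _ T] unfolding finite_rank_def by metis
  define A where "A = (\<Sum>i<N. norm (a i))"
  have A: "0 \<le> A" unfolding A_def by (intro sum_nonneg) auto
  define \<kappa> where "\<kappa> = e / (A + 1)"
  have \<kappa>: "0 < \<kappa>" "\<kappa> * A \<le> e" using e A by (auto simp: \<kappa>_def field_simps)
  \<comment> \<open>The value \<open>0\<close> outside the ball makes the coefficients bounded for
    all \<open>\<phi>\<close>, as finiteness of the full range of \<open>b\<close> requires.\<close>
  define f where "f i \<phi> = (if norm \<phi> \<le> 1 then blinfun_apply \<phi> (y i) else 0)" for i and \<phi> :: "'x \<Rightarrow>\<^sub>L real"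
  have f: "\<bar>f i \<phi>\<bar> \<le> norm (y i)" for i \<phi>
  proof -
    have "\<bar>blinfun_apply \<phi> (y i)\<bar> \<le> norm \<phi> * norm (y i)" using norm_blinfun[of \<phi> "y i"] by simp
    moreover have "norm \<phi> * norm (y i) \<le> 1 * norm (y i)" if "norm \<phi> \<le> 1"
      using that by (intro mult_right_mono) auto
    ultimately show ?thesis by (auto simp: f_def)
  qed
  define r where "r i \<phi> = \<kappa> * of_int \<lfloor>f i \<phi> / \<kappa>\<rfloor>" for i \<phi>
  have fin: "finite (range (r i))" and close: "\<bar>r i \<phi> - f i \<phi>\<bar> \<le> \<kappa>" for i \<phi>
    unfolding r_def by (rule finite_range_rounding[OF f \<kappa>(1)])+
  define b where "b \<phi> = (\<Sum>i<N. r i \<phi> *\<^sub>R a i)" for \<phi>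
  show thesis
  proof
    have "range b \<subseteq> (\<lambda>c. \<Sum>i<N. c i *\<^sub>R a i) ` (\<Pi>\<^sub>E i\<in>{..<N}. range (r i))"
    proof safe
      fix \<phi>
      show "b \<phi> \<in> (\<lambda>c. \<Sum>i<N. c i *\<^sub>R a i) ` (\<Pi>\<^sub>E i\<in>{..<N}. range (r i))"
        by (rule image_eqI[of _ _ "restrict (\<lambda>i. r i \<phi>) {..<N}"]) (auto simp: b_def)
    qed
    then show "finite (range b)"
      by (rule finite_subset) (intro finite_imageI finite_PiE fin finite_lessThan)
    fix \<phi> :: "'x \<Rightarrow>\<^sub>L real" and v assume \<phi>: "norm \<phi> \<le> 1"
    have "blinfun_apply \<phi> (blinfun_apply T v) - blinfun_apply (b \<phi>) v = (\<Sum>i<N. (f i \<phi> - r i \<phi>) * blinfun_apply (a i) v)"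
      using \<phi> by (simp add: T b_def f_def blinfun.sum_right blinfun.sum_left blinfun.scaleR_right blinfun.scaleR_left
          sum_subtractf[symmetric] algebra_simps)
    also have "\<bar>\<dots>\<bar> \<le> (\<Sum>i<N. \<bar>(f i \<phi> - r i \<phi>) * blinfun_apply (a i) v\<bar>)" by (rule sum_abs)
    also have "\<dots> \<le> (\<Sum>i<N. \<kappa> * (norm (a i) * norm v))"
    proof (rule sum_mono)
      fix i
      have "\<bar>f i \<phi> - r i \<phi>\<bar> \<le> \<kappa>" using close[of i \<phi>] by linarith
      then show "\<bar>(f i \<phi> - r i \<phi>) * blinfun_apply (a i) v\<bar> \<le> \<kappa> * (norm (a i) * norm v)"
        using norm_blinfun[of "a i" v] \<kappa> unfolding abs_mult by (intro mult_mono) auto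
    qed
    also have "\<dots> = \<kappa> * A * norm v" by (simp add: A_def sum_distrib_left sum_distrib_right mult.assoc)
    also have "\<dots> \<le> e * norm v" using \<kappa>(2) by (intro mult_right_mono) auto
    finally show "\<bar>blinfun_apply \<phi> (blinfun_apply T v) - blinfun_apply (b \<phi>) v\<bar> \<le> e * norm v" .
  qed
qed

lemma finite_range_scaled_le_one:
  fixes b :: "'c \<Rightarrow> 'y::real_normed_vector"
  assumes "finite (range b)"
  obtains R where "0 < R" "\<And>c. norm ((1 / R) *\<^sub>R b c) \<le> 1"
proof -
  define R where "R = (\<Sum>v\<in>range b. norm v) + 1"
  have le: "norm (b c) \<le> R" for c
    unfolding R_def using assms member_le_sum[of "b c" "range b" norm] by (simp add: add_increasing2)
  have R: "0 < R" unfolding R_def by (intro add_nonneg_pos sum_nonneg) auto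
  then show thesis using le that[of R] by simp
qed

section \<open>The mean along a minimizing sequence\<close>

context represented_mean
begin

lemma abs_apply_le: "s \<in> S \<Longrightarrow> \<bar>blinfun_apply (fst s) v\<bar> \<le> norm v"
proof -
  assume s: "s \<in> S"
  have "\<bar>blinfun_apply (fst s) v\<bar> \<le> norm (fst s) * norm v" using norm_blinfun[of "fst s" v] by simp
  also have "\<dots> \<le> 1 * norm v" using S_norm(1)[OF s] by (intro mult_right_mono) auto
  finally show ?thesis by simp
qed

lemma bounded_on_fst_apply:
  assumes "\<And>s. s \<in> S \<Longrightarrow> norm (v s) \<le> B"
  shows "bounded_on S (\<lambda>s. blinfun_apply (fst s) (v s))"
  using S_norm(1) assms by (intro bounded_on_apply[where A = 1]) auto

lemma norm_blinfun_le:
  assumes "norm v \<le> B"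
  shows "norm (blinfun_apply T v) \<le> norm T * B"
  using norm_blinfun[of T v] mult_left_mono[OF assms, of "norm T"] by simp

lemma eventually_inverse_Suc_le: "0 < \<gamma> \<Longrightarrow> \<forall>\<^sub>F n in sequentially. 1 / real (Suc n) \<le> \<gamma>"
  using order_tendstoD(2)[OF LIMSEQ_inverse_real_of_nat, of \<gamma>]
  by (auto simp: inverse_eq_divide elim: eventually_mono)

text \<open>\<open>\<phi> (T v)\<close> is the adjoint applied to \<open>v\<close>, a test that
  depends on \<open>\<phi>\<close> alone. Its discretization has finite range, and scaling by
  \<open>1 / R\<close> brings it into the unit ball, so \<open>near_minimizer_averages\<close>
  applies.\<close>

lemma mean_apply_converges:
  assumes T: "finite_rank T" and e: "0 < e"
    and Gn: "\<And>n. admissible 1 (G n)" "\<And>n. energy (G n) \<le> min_energy + (1 / real (Suc n))\<^sup>2"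
  shows "\<forall>\<^sub>F n in sequentially. \<Lambda> (\<lambda>s. blinfun_apply (fst s) (blinfun_apply T (snd s)))
      \<le> \<Lambda> (\<lambda>s. blinfun_apply (fst s) (blinfun_apply T (J (G n (fst s))))) + e"
proof -
  have C1: "0 < 2 * (1 + C)" using C_nonneg by simp
  \<comment> \<open>The vectors \<open>w - J (G \<phi>)\<close> have norm at most
    \<open>1 + C\<close>, so replacing the adjoint by its discretization costs
    \<open>e / 2\<close>.\<close>
  then have e': "0 < e / (2 * (1 + C))" using e by simp
  obtain b :: "('x \<Rightarrow>\<^sub>L real) \<Rightarrow> ('x \<Rightarrow>\<^sub>L real)" where b: "finite (range b)"
    "\<And>\<phi> v. norm \<phi> \<le> 1 \<Longrightarrow> \<bar>blinfun_apply \<phi> (blinfun_apply T v) - blinfun_apply (b \<phi>) v\<bar> \<le> e / (2 * (1 + C)) * norm v"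
    by (rule finite_rank_adjoint_finite_range[OF T e']) blast
  obtain R where R: "0 < R" "\<And>\<phi>. norm ((1 / R) *\<^sub>R b \<phi>) \<le> 1" by (rule finite_range_scaled_le_one[OF b(1)]) blast
  have fin: "finite (range (\<lambda>\<phi>. (1 / R) *\<^sub>R b \<phi>))"
    using finite_imageI[OF b(1), of "\<lambda>x. (1 / R) *\<^sub>R x"] by (simp add: image_image)
  have eR: "0 < e / (2 * R)" using e R by simp
  show ?thesis
  proof (rule near_minimizer_averages[OF eR])
    fix \<gamma> :: real
    assume \<gamma>: "0 < \<gamma>"
      "\<And>\<delta> G a. 0 < \<delta> \<Longrightarrow> \<delta> \<le> \<gamma> \<Longrightarrow> admissible 1 G \<Longrightarrow> energy G \<le> min_energy + \<delta>\<^sup>2 \<Longrightarrow> finite (range a) \<Longrightarrow>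
        (\<And>\<phi>. norm (a \<phi>) \<le> 1) \<Longrightarrow>
        \<bar>\<Lambda> (\<lambda>s. blinfun_apply (a (fst s)) (snd s) - blinfun_apply (a (fst s)) (J (G (fst s))))\<bar> \<le> e / (2 * R)"
    have main: "\<Lambda> (\<lambda>s. blinfun_apply (fst s) (blinfun_apply T (snd s)))
        \<le> \<Lambda> (\<lambda>s. blinfun_apply (fst s) (blinfun_apply T (J (G (fst s))))) + e"
      if \<delta>: "0 < \<delta>" "\<delta> \<le> \<gamma>" and G: "admissible 1 G" "energy G \<le> min_energy + \<delta>\<^sup>2" for \<delta> G
    proof -
      let ?a = "\<lambda>\<phi>. (1 / R) *\<^sub>R b \<phi>"
      let ?d = "\<lambda>s. blinfun_apply (?a (fst s)) (snd s) - blinfun_apply (?a (fst s)) (J (G (fst s)))"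
      have b1: "bounded_on S (\<lambda>s. blinfun_apply (fst s) (blinfun_apply T (snd s)))"
        using S_norm(2) by (intro bounded_on_fst_apply[where B = "norm T * 1"] norm_blinfun_le)
      have b2: "bounded_on S (\<lambda>s. blinfun_apply (fst s) (blinfun_apply T (J (G (fst s)))))"
        using norm_J[OF G(1)] by (intro bounded_on_fst_apply[where B = "norm T * C"] norm_blinfun_le)
      have b3: "bounded_on S ?d"
        using R S_norm norm_J[OF G(1)] by (intro bounded_on_diff bounded_on_apply[where A = 1]) auto
      have pt: "blinfun_apply (fst s) (blinfun_apply T (snd s)) - blinfun_apply (fst s) (blinfun_apply T (J (G (fst s))))
          \<le> R * ?d s + e / 2" if s: "s \<in> S" for s
      proof -
        let ?v = "snd s - J (G (fst s))"
        have "norm ?v \<le> 1 + C"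
          using norm_triangle_ineq4[of "snd s" "J (G (fst s))"] S_norm(2)[OF s] norm_J[OF G(1), of "fst s"] by linarith
        then have "e / (2 * (1 + C)) * norm ?v \<le> e / (2 * (1 + C)) * (1 + C)" using e' by (intro mult_left_mono) auto
        also have "\<dots> = e / 2"
        proof -
          have "1 + C \<noteq> 0" using C_nonneg by simp
          then show ?thesis by (simp add: divide_simps)
        qed
        finally have "blinfun_apply (fst s) (blinfun_apply T ?v) \<le> blinfun_apply (b (fst s)) ?v + e / 2"
          using b(2)[OF S_norm(1)[OF s], of ?v] by linarith
        moreover have "R * ?d s = blinfun_apply (b (fst s)) ?v"
          using R(1) by (simp add: blinfun.scaleR_left blinfun.diff_right diff_divide_distrib[symmetric])
        ultimately show ?thesis by (simp add: blinfun.diff_right)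
      qed
      have "\<Lambda> (\<lambda>s. blinfun_apply (fst s) (blinfun_apply T (snd s))) - \<Lambda> (\<lambda>s. blinfun_apply (fst s) (blinfun_apply T (J (G (fst s)))))
          = \<Lambda> (\<lambda>s. blinfun_apply (fst s) (blinfun_apply T (snd s)) - blinfun_apply (fst s) (blinfun_apply T (J (G (fst s)))))"
        by (rule diff[OF b1 b2, symmetric])
      also have "\<dots> \<le> \<Lambda> (\<lambda>s. R * ?d s + e / 2)"
        by (intro mono bounded_on_diff b1 b2 bounded_on_add bounded_on_cmult b3 bounded_on_const pt)
      also have "\<dots> = R * \<Lambda> ?d + e / 2"
        by (simp only: add cmult const bounded_on_cmult bounded_on_const b3)
      also have "R * \<Lambda> ?d \<le> R * (e / (2 * R))"
        using \<gamma>(2)[OF \<delta> G fin R(2)] R(1) by (intro mult_left_mono) auto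
      also have "R * (e / (2 * R)) = e / 2" using R(1) by simp
      finally show ?thesis by simp
    qed
    show ?thesis
      using eventually_inverse_Suc_le[OF \<gamma>(1)] by (rule eventually_mono) (rule main[OF _ _ Gn]; simp)
  qed
qed

text \<open>A norming functional of \<open>J (G \<phi>)\<close> is chosen from the function
  \<open>G \<phi>\<close>, so it is a test with finite range. Applied to \<open>w\<close> instead,
  it gives at most 1.\<close>

lemma mean_norm_le:
  assumes e: "0 < e"
    and Gn: "\<And>n. admissible 1 (G n)" "\<And>n. energy (G n) \<le> min_energy + (1 / real (Suc n))\<^sup>2"
  shows "\<forall>\<^sub>F n in sequentially. \<Lambda> (\<lambda>s. norm (J (G n (fst s)))) \<le> 1 + e"
proof -
  have "\<exists>\<phi>. norm \<phi> \<le> 1 \<and> blinfun_apply \<phi> v = norm v" for v :: 'x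
    by (rule exists_norming_functional[of v]) blast
  then obtain nf where nf: "\<And>v :: 'x. norm (nf v) \<le> 1" "\<And>v. blinfun_apply (nf v) v = norm v" by metis
  show ?thesis
  proof (rule near_minimizer_averages[OF e])
    fix \<gamma> :: real
    assume \<gamma>: "0 < \<gamma>"
      "\<And>\<delta> G a. 0 < \<delta> \<Longrightarrow> \<delta> \<le> \<gamma> \<Longrightarrow> admissible 1 G \<Longrightarrow> energy G \<le> min_energy + \<delta>\<^sup>2 \<Longrightarrow> finite (range a) \<Longrightarrow>
        (\<And>\<phi>. norm (a \<phi>) \<le> 1) \<Longrightarrow>
        \<bar>\<Lambda> (\<lambda>s. blinfun_apply (a (fst s)) (snd s) - blinfun_apply (a (fst s)) (J (G (fst s))))\<bar> \<le> e"
    have main: "\<Lambda> (\<lambda>s. norm (J (G (fst s)))) \<le> 1 + e"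
      if \<delta>: "0 < \<delta>" "\<delta> \<le> \<gamma>" and G: "admissible 1 G" "energy G \<le> min_energy + \<delta>\<^sup>2" for \<delta> G
    proof -
      let ?a = "\<lambda>\<phi>. nf (J (G \<phi>))"
      have fin: "finite (range ?a)"
        using finite_imageI[OF admissibleD(1)[OF G(1)], of "\<lambda>g. nf (J g)"] by (simp add: image_image)
      have b1: "bounded_on S (\<lambda>s. blinfun_apply (?a (fst s)) (snd s))"
        using nf(1) S_norm(2) by (intro bounded_on_apply[where A = 1]) auto
      have b2: "bounded_on S (\<lambda>s. blinfun_apply (?a (fst s)) (J (G (fst s))))"
        using nf(1) norm_J[OF G(1)] by (intro bounded_on_apply[where A = 1]) auto
      have "\<Lambda> (\<lambda>s. blinfun_apply (?a (fst s)) (J (G (fst s)))) \<le> \<Lambda> (\<lambda>s. blinfun_apply (?a (fst s)) (snd s)) + e"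
        using \<gamma>(2)[OF \<delta> G fin nf(1)] unfolding diff[OF b1 b2] by linarith
      also have "\<Lambda> (\<lambda>s. blinfun_apply (?a (fst s)) (snd s)) \<le> 1"
      proof (rule le_bound[OF b1])
        fix s assume s: "s \<in> S"
        have "blinfun_apply (?a (fst s)) (snd s) \<le> norm (?a (fst s)) * norm (snd s)"
          using norm_blinfun[of "?a (fst s)" "snd s"] by simp
        also have "\<dots> \<le> 1 * 1" using nf(1) S_norm(2)[OF s] by (intro mult_mono) auto
        finally show "blinfun_apply (?a (fst s)) (snd s) \<le> 1" by simp
      qed
      finally show ?thesis by (simp add: nf(2))
    qed
    show ?thesis
      using eventually_inverse_Suc_le[OF \<gamma>(1)] by (rule eventually_mono) (rule main[OF _ _ Gn]; simp)
  qed
qed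

text \<open>Step \<open>n\<close> adds \<open>\<eta> * 2^n * (1/4)^n = \<eta> * (1/2)^n\<close>; the
  right-hand side is \<open>\<eta>\<close> for the initial vectors plus the geometric sum of the
  first \<open>n\<close> steps.\<close>

lemma telescoping_bound:
  assumes G: "\<And>n. admissible 1 (G n)"
    and D: "\<And>n. \<Lambda> (\<lambda>s. norm (J (G (Suc n) (fst s)) - J (G n (fst s)))) \<le> (1/4)^n"
    and T0: "\<And>\<phi>. norm (blinfun_apply T (J (G 0 \<phi>)) - J (G 0 \<phi>)) \<le> \<eta>"
    and T: "\<And>n \<phi>. norm (blinfun_apply T (J (G (Suc n) \<phi>) - J (G n \<phi>)) - (J (G (Suc n) \<phi>) - J (G n \<phi>)))
      \<le> \<eta> * 2^n * norm (J (G (Suc n) \<phi>) - J (G n \<phi>))"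
    and \<eta>: "0 \<le> \<eta>"
  shows "\<Lambda> (\<lambda>s. blinfun_apply (fst s) (blinfun_apply T (J (G n (fst s))) - J (G n (fst s)))) \<le> \<eta> * (3 - 2 * (1/2)^n)"
proof (induction n)
  have TI: "norm (blinfun_apply T v - v) \<le> norm T * B + B" if "norm v \<le> B" for v B
    using norm_triangle_ineq4[of "blinfun_apply T v" v] norm_blinfun_le[OF that, of T] that by linarith
  have bd: "bounded_on S (\<lambda>s. blinfun_apply (fst s) (blinfun_apply T (J (G n (fst s))) - J (G n (fst s))))" for n
    by (intro bounded_on_fst_apply[where B = "norm T * C + C"] TI norm_J[OF G])
  {
    case 0
    have "blinfun_apply (fst s) (blinfun_apply T (J (G 0 (fst s))) - J (G 0 (fst s))) \<le> \<eta>" if "s \<in> S" for s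
      using abs_apply_le[OF that, of "blinfun_apply T (J (G 0 (fst s))) - J (G 0 (fst s))"] T0[of "fst s"] by linarith
    then show ?case using le_bound[OF bd] by simp
  next
    case (Suc n)
    let ?D = "\<lambda>s. J (G (Suc n) (fst s)) - J (G n (fst s))"
    have nD: "norm (?D s) \<le> C + C" for s
      using norm_triangle_ineq4[of "J (G (Suc n) (fst s))" "J (G n (fst s))"]
        norm_J[OF G, of "Suc n" "fst s"] norm_J[OF G, of n "fst s"] by linarith
    then have b: "bounded_on S (\<lambda>s. norm (?D s))" by (intro bounded_onI[where B = "C + C"]) auto
    have "\<Lambda> (\<lambda>s. blinfun_apply (fst s) (blinfun_apply T (J (G (Suc n) (fst s))) - J (G (Suc n) (fst s))))
      \<le> \<Lambda> (\<lambda>s. blinfun_apply (fst s) (blinfun_apply T (J (G n (fst s))) - J (G n (fst s))) + \<eta> * 2^n * norm (?D s))"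
    proof (intro mono bd bounded_on_add bounded_on_cmult b)
      fix s assume s: "s \<in> S"
      have "blinfun_apply (fst s) (blinfun_apply T (J (G (Suc n) (fst s))) - J (G (Suc n) (fst s)))
        = blinfun_apply (fst s) (blinfun_apply T (J (G n (fst s))) - J (G n (fst s)))
          + blinfun_apply (fst s) (blinfun_apply T (?D s) - ?D s)"
        by (simp add: blinfun.diff_right)
      also have "blinfun_apply (fst s) (blinfun_apply T (?D s) - ?D s) \<le> norm (blinfun_apply T (?D s) - ?D s)"
        using abs_apply_le[OF s, of "blinfun_apply T (?D s) - ?D s"] by linarith
      also have "\<dots> \<le> \<eta> * 2^n * norm (?D s)" by (rule T)
      finally show "blinfun_apply (fst s) (blinfun_apply T (J (G (Suc n) (fst s))) - J (G (Suc n) (fst s)))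
        \<le> blinfun_apply (fst s) (blinfun_apply T (J (G n (fst s))) - J (G n (fst s))) + \<eta> * 2^n * norm (?D s)" by simp
    qed
    also have "\<dots> = \<Lambda> (\<lambda>s. blinfun_apply (fst s) (blinfun_apply T (J (G n (fst s))) - J (G n (fst s))))
        + \<eta> * 2^n * \<Lambda> (\<lambda>s. norm (?D s))"
      by (simp only: add cmult bounded_on_cmult bd b)
    also have "\<dots> \<le> \<eta> * (3 - 2 * (1/2)^n) + \<eta> * 2^n * (1/4)^n"
      using \<eta> by (intro add_mono Suc.IH mult_left_mono D) auto
    also have "\<eta> * 2^n * (1/4)^n = \<eta> * (1/2)^n"
      by (simp add: mult.assoc power_mult_distrib[symmetric])
    also have "\<eta> * (3 - 2 * (1/2)^n) + \<eta> * (1/2)^n = \<eta> * (3 - 2 * (1/2)^Suc n)"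
      by (simp add: algebra_simps)
    finally show ?case .
  }
qed

lemma exists_minimizing_sequence:
  obtains G where "\<And>n. admissible 1 (G n)" "\<And>n. energy (G n) \<le> min_energy + (1 / real (Suc n))\<^sup>2"
    "\<And>n. \<Lambda> (\<lambda>s. norm (J (G (Suc n) (fst s)) - J (G n (fst s)))) \<le> (1/4)^n"
proof -
  have "\<exists>\<gamma>>0. minimizers_close \<gamma> ((1/4)^n)" for n :: nat
    by (rule near_minimizers_close) simp
  then obtain \<gamma> where \<gamma>: "\<And>n::nat. 0 < \<gamma> n" "\<And>n. minimizers_close (\<gamma> n) ((1/4)^n)"
    by metis
  \<comment> \<open>The minimum over all \<open>k \<le> n\<close> makes \<open>G n\<close> and
    \<open>G (Suc n)\<close> both meet the threshold \<open>\<gamma> n\<close>, so consecutive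
    members can be compared.\<close>
  define e where "e n = Min (insert ((1 / real (Suc n))\<^sup>2) (\<gamma> ` {..n}))" for n
  have e: "0 < e n" for n unfolding e_def using \<gamma>(1) by simp
  have le1: "e n \<le> (1 / real (Suc n))\<^sup>2" for n unfolding e_def by (intro Min_le) auto
  have le2: "e n \<le> \<gamma> k" if "k \<le> n" for n k unfolding e_def using that by (intro Min_le) auto
  obtain G where G: "\<And>n. admissible 1 (G n)" "\<And>n. energy (G n) \<le> min_energy + e n"
    using exists_near_minimizer[OF e] by metis
  show thesis
  proof
    show "admissible 1 (G n)" for n by (rule G)
    show "energy (G n) \<le> min_energy + (1 / real (Suc n))\<^sup>2" for n using G(2)[of n] le1[of n] by linarith
    show "\<Lambda> (\<lambda>s. norm (J (G (Suc n) (fst s)) - J (G n (fst s)))) \<le> (1/4)^n" for n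
    proof -
      have "energy (G n) \<le> min_energy + \<gamma> n" "energy (G (Suc n)) \<le> min_energy + \<gamma> n"
        using G(2)[of n] G(2)[of "Suc n"] le2[of n n] le2[of n "Suc n"] by auto
      then show ?thesis
        using \<gamma>(2)[of n] G(1)[of n] G(1)[of "Suc n"] unfolding minimizers_close_def by blast
    qed
  qed
qed

text \<open>
  The increments \<open>d\<^sub>n\<close> are of size \<open>4\<^sup>-\<^sup>n\<close> in mean. Rescaled to norm \<open>2\<^sup>-\<^sup>n\<close> they form a compact set on
  which \<open>T\<close> is within \<open>\<eta>\<close> of the identity, which leaves an error of \<open>\<eta> 2\<^sup>n 4\<^sup>-\<^sup>n\<close> in step \<open>n\<close>.
\<close>

theorem compact_set_controls_mean:
  obtains K where "compact K" "\<And>T \<eta>. finite_rank T \<Longrightarrow> 0 \<le> \<eta> \<Longrightarrow> (\<And>x. x \<in> K \<Longrightarrow> norm (blinfun_apply T x - x) \<le> \<eta>) \<Longrightarrow>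
    \<Lambda> (\<lambda>s. blinfun_apply (fst s) (blinfun_apply T (snd s))) \<le> 1 + 3 * \<eta>"
proof -
  obtain G where G: "\<And>n. admissible 1 (G n)" and G2: "\<And>n. energy (G n) \<le> min_energy + (1 / real (Suc n))\<^sup>2"
    and D: "\<And>n. \<Lambda> (\<lambda>s. norm (J (G (Suc n) (fst s)) - J (G n (fst s)))) \<le> (1/4)^n"
    by (rule exists_minimizing_sequence) blast
  define d where "d n \<phi> = J (G (Suc n) \<phi>) - J (G n \<phi>)" for n \<phi>
  \<comment> \<open>For \<open>d n \<phi> = 0\<close> the division by zero is harmless, as the
    rescaled vector is \<open>0\<close>.\<close>
  define F where "F n = range (\<lambda>\<phi>. ((1/2)^n / norm (d n \<phi>)) *\<^sub>R d n \<phi>)" for n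
  have "finite (F n)" for n
  proof -
    have "F n \<subseteq> (\<lambda>(g, g'). ((1/2)^n / norm (J g' - J g)) *\<^sub>R (J g' - J g)) ` (range (G n) \<times> range (G (Suc n)))"
      by (auto simp: F_def d_def)
    then show ?thesis
      by (rule finite_subset) (intro finite_imageI finite_cartesian_product admissibleD(1)[OF G])
  qed
  moreover have "norm x \<le> (1/2)^n" if "x \<in> F n" for n x
    using that by (auto simp: F_def)
  ultimately have cF: "compact (insert 0 (\<Union>n. F n))" by (rule compact_insert_zero_UN)
  have "finite (range (\<lambda>\<phi>. J (G 0 \<phi>)))"
    using finite_imageI[OF admissibleD(1)[OF G[of 0]], of J] by (simp add: image_image)
  then have cK: "compact (range (\<lambda>\<phi>. J (G 0 \<phi>)) \<union> insert 0 (\<Union>n. F n))"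
    by (intro compact_Un cF finite_imp_compact)
  show thesis
  proof (rule that[OF cK])
    fix T :: "'x \<Rightarrow>\<^sub>L 'x" and \<eta> :: real
    assume T: "finite_rank T" and \<eta>: "0 \<le> \<eta>"
      and close: "\<And>x. x \<in> range (\<lambda>\<phi>. J (G 0 \<phi>)) \<union> insert 0 (\<Union>n. F n) \<Longrightarrow> norm (blinfun_apply T x - x) \<le> \<eta>"
    have Td: "norm (blinfun_apply T (d n \<phi>) - d n \<phi>) \<le> \<eta> * 2^n * norm (d n \<phi>)" for n \<phi>
    proof (cases "d n \<phi> = 0")
      case False
      define c where "c = (1/2)^n / norm (d n \<phi>)"
      have c: "0 < c" using False by (simp add: c_def)
      have "c *\<^sub>R d n \<phi> \<in> F n" by (auto simp: F_def c_def)
      then have "norm (blinfun_apply T (c *\<^sub>R d n \<phi>) - c *\<^sub>R d n \<phi>) \<le> \<eta>" by (intro close) auto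
      then have "c * norm (blinfun_apply T (d n \<phi>) - d n \<phi>) \<le> \<eta>"
        using c by (simp add: blinfun.scaleR_right scaleR_diff_right[symmetric])
      then have "norm (blinfun_apply T (d n \<phi>) - d n \<phi>) \<le> \<eta> / c" using c by (simp add: field_simps)
      also have "\<eta> / c = \<eta> * 2^n * norm (d n \<phi>)" using False by (simp add: c_def power_one_over)
      finally show ?thesis .
    qed simp
    show "\<Lambda> (\<lambda>s. blinfun_apply (fst s) (blinfun_apply T (snd s))) \<le> 1 + 3 * \<eta>"
    proof (rule field_le_epsilon)
      fix e :: real assume "0 < e"
      then have e: "0 < e / 2" by simp
      \<comment> \<open>Both replacements of \<open>w\<close> hold for all large \<open>n\<close>,
        hence at a common stage.\<close>
      have "\<exists>n. \<Lambda> (\<lambda>s. blinfun_apply (fst s) (blinfun_apply T (snd s)))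
          \<le> \<Lambda> (\<lambda>s. blinfun_apply (fst s) (blinfun_apply T (J (G n (fst s))))) + e / 2 \<and>
        \<Lambda> (\<lambda>s. norm (J (G n (fst s)))) \<le> 1 + e / 2"
        using eventually_conj[OF mean_apply_converges[OF T e G G2] mean_norm_le[OF e G G2]]
        by (rule eventually_happens'[OF sequentially_bot])
      then obtain n where n: "\<Lambda> (\<lambda>s. blinfun_apply (fst s) (blinfun_apply T (snd s)))
          \<le> \<Lambda> (\<lambda>s. blinfun_apply (fst s) (blinfun_apply T (J (G n (fst s))))) + e / 2"
        "\<Lambda> (\<lambda>s. norm (J (G n (fst s)))) \<le> 1 + e / 2"
        by (elim exE conjE)
      let ?v = "\<lambda>s. J (G n (fst s))"
      have b1: "bounded_on S (\<lambda>s. blinfun_apply (fst s) (?v s))"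
        by (intro bounded_on_fst_apply[where B = C] norm_J[OF G])
      have b2: "bounded_on S (\<lambda>s. blinfun_apply (fst s) (blinfun_apply T (?v s)))"
        by (intro bounded_on_fst_apply[where B = "norm T * C"] norm_blinfun_le norm_J[OF G])
      have b3: "bounded_on S (\<lambda>s. norm (?v s))"
        using norm_J[OF G] by (intro bounded_onI[where B = C]) auto
      have "\<Lambda> (\<lambda>s. blinfun_apply (fst s) (blinfun_apply T (?v s) - ?v s)) \<le> \<eta> * (3 - 2 * (1/2)^n)"
      proof (rule telescoping_bound[OF G D _ _ \<eta>])
        show "norm (blinfun_apply T (J (G 0 \<phi>)) - J (G 0 \<phi>)) \<le> \<eta>" for \<phi> by (rule close) auto
        show "norm (blinfun_apply T (J (G (Suc n) \<phi>) - J (G n \<phi>)) - (J (G (Suc n) \<phi>) - J (G n \<phi>)))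
          \<le> \<eta> * 2^n * norm (J (G (Suc n) \<phi>) - J (G n \<phi>))" for n \<phi>
          using Td[of n \<phi>] by (simp add: d_def)
      qed
      also have "\<dots> \<le> \<eta> * 3" using \<eta> by (intro mult_left_mono) auto
      finally have "\<Lambda> (\<lambda>s. blinfun_apply (fst s) (blinfun_apply T (?v s))) \<le> \<Lambda> (\<lambda>s. blinfun_apply (fst s) (?v s)) + 3 * \<eta>"
        unfolding blinfun.diff_right diff[OF b2 b1] by simp
      moreover have "\<Lambda> (\<lambda>s. blinfun_apply (fst s) (?v s)) \<le> \<Lambda> (\<lambda>s. norm (?v s))"
        using abs_apply_le by (intro mono b1 b3) (simp add: abs_le_iff)
      ultimately show "\<Lambda> (\<lambda>s. blinfun_apply (fst s) (blinfun_apply T (snd s))) \<le> 1 + 3 * \<eta> + e" using n by linarith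
    qed
  qed
qed

end

section \<open>Finite rank approximation with a norm bound on represented vectors\<close>

theorem (in bounded_vector_density) finite_rank_approximation:
  assumes ap: "approximation_property TYPE('x)" and e: "0 < \<epsilon>" and Q: "compact Q"
    and W: "\<And>w. w \<in> W \<Longrightarrow> norm w \<le> 1"
      "\<And>w. w \<in> W \<Longrightarrow> \<exists>h\<in>borel_measurable \<mu>. (\<forall>x. \<bar>h x\<bar> \<le> 1) \<and> represents h w"
  obtains T :: "'x \<Rightarrow>\<^sub>L 'x" where "finite_rank T" "\<And>x. x \<in> Q \<Longrightarrow> norm (blinfun_apply T x - x) \<le> \<epsilon>"
    "\<And>w. w \<in> W \<Longrightarrow> norm (blinfun_apply T w) \<le> 1 + \<epsilon>"
proof -
  have AP: "\<exists>T :: 'x \<Rightarrow>\<^sub>L 'x. finite_rank T \<and> (\<forall>x\<in>K. norm (blinfun_apply T x - x) \<le> \<eta>)"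
    if "compact K" "0 < \<eta>" for K \<eta>
    using ap that unfolding approximation_property_def finite_rank_def by blast
  define A where "A = {T :: 'x \<Rightarrow>\<^sub>L 'x. finite_rank T \<and> (\<forall>x\<in>Q. norm (blinfun_apply T x - x) \<le> \<epsilon>)}"
  have ex: "\<exists>T\<in>A. \<forall>w\<in>W. norm (blinfun_apply T w) \<le> 1 + \<epsilon>"
  proof (rule ccontr)
    assume "\<not> ?thesis"
    then have large: "\<exists>w\<in>W. 1 + \<epsilon> < norm (blinfun_apply T w)" if "T \<in> A" for T
      using that by (meson linorder_not_le)
    have ne: "A \<noteq> {}" using AP[OF Q e] by (auto simp: A_def)
    then have Wne: "W \<noteq> {}" using large by auto
    define S where "S = {\<phi> :: 'x \<Rightarrow>\<^sub>L real. norm \<phi> \<le> 1} \<times> W"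
    define F where "F T s = blinfun_apply (fst s) (blinfun_apply T (snd s))" for T :: "'x \<Rightarrow>\<^sub>L 'x" and s :: "('x \<Rightarrow>\<^sub>L real) \<times> 'x"
    have bddF: "bounded_on S (F T)" for T
    proof (rule bounded_onI)
      fix s assume s: "s \<in> S"
      have "\<bar>F T s\<bar> \<le> norm (fst s) * norm (blinfun_apply T (snd s))"
        using norm_blinfun[of "fst s" "blinfun_apply T (snd s)"] by (simp add: F_def)
      also have "\<dots> \<le> 1 * (norm T * norm (snd s))"
        using s by (intro mult_mono norm_blinfun) (auto simp: S_def)
      also have "\<dots> \<le> 1 * (norm T * 1)"
        using s W(1) by (intro mult_left_mono) (auto simp: S_def)
      finally show "\<bar>F T s\<bar> \<le> norm T" by simp
    qed
    obtain \<Lambda> where \<Lambda>: "mean S \<Lambda>" "\<And>f. f \<in> F ` A \<Longrightarrow> 1 + \<epsilon> \<le> \<Lambda> f"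
    proof (rule exists_mean[of S "F ` A" "1 + \<epsilon>"])
      have "0 \<in> {\<phi> :: 'x \<Rightarrow>\<^sub>L real. norm \<phi> \<le> 1}" by simp
      then show "S \<noteq> {}" using Wne unfolding S_def by blast
      show "F ` A \<noteq> {}" using ne by simp
      show "bounded_on S f" if "f \<in> F ` A" for f using that bddF by auto
      show "\<exists>s\<in>S. 1 + \<epsilon> \<le> f s" if "f \<in> F ` A" for f
      proof -
        obtain T where T: "T \<in> A" "f = F T" using \<open>f \<in> F ` A\<close> by auto
        obtain w where w: "w \<in> W" "1 + \<epsilon> < norm (blinfun_apply T w)" using large[OF T(1)] by auto
        obtain \<phi> :: "'x \<Rightarrow>\<^sub>L real" where "norm \<phi> \<le> 1" "blinfun_apply \<phi> (blinfun_apply T w) = norm (blinfun_apply T w)"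
          by (rule exists_norming_functional)
        then show ?thesis using w T by (intro bexI[of _ "(\<phi>, w)"]) (auto simp: F_def S_def)
      qed
      fix f g and u v :: real assume fg: "f \<in> F ` A" "g \<in> F ` A" and uv: "0 \<le> u" "0 \<le> v" "u + v = 1"
      then obtain T T' where T: "T \<in> A" "f = F T" "T' \<in> A" "g = F T'" by auto
      have "norm (blinfun_apply (u *\<^sub>R T + v *\<^sub>R T') x - x) \<le> \<epsilon>" if x: "x \<in> Q" for x
      proof -
        have v: "v = 1 - u" using uv by simp
        have "blinfun_apply (u *\<^sub>R T + v *\<^sub>R T') x - x
            = u *\<^sub>R (blinfun_apply T x - x) + v *\<^sub>R (blinfun_apply T' x - x)"
          unfolding blinfun.add_left blinfun.scaleR_left v by (simp add: algebra_simps)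
        also have "norm \<dots> \<le> u * norm (blinfun_apply T x - x) + v * norm (blinfun_apply T' x - x)"
          using norm_triangle_ineq[of "u *\<^sub>R (blinfun_apply T x - x)" "v *\<^sub>R (blinfun_apply T' x - x)"] uv by simp
        also have "\<dots> \<le> u * \<epsilon> + v * \<epsilon>"
          using T x uv by (intro add_mono mult_left_mono) (auto simp: A_def)
        also have "\<dots> = \<epsilon>" using uv by (simp add: distrib_right[symmetric])
        finally show ?thesis .
      qed
      then have "u *\<^sub>R T + v *\<^sub>R T' \<in> A"
        using T finite_rank_combination by (auto simp: A_def)
      moreover have "(\<lambda>s. u * f s + v * g s) = F (u *\<^sub>R T + v *\<^sub>R T')"
        by (auto simp: T F_def blinfun.add_left blinfun.scaleR_left blinfun.add_right blinfun.scaleR_right)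
      ultimately show "(\<lambda>s. u * f s + v * g s) \<in> F ` A" by auto
    qed blast
    obtain H where H: "\<And>w. w \<in> W \<Longrightarrow> H w \<in> borel_measurable \<mu>" "\<And>w x. w \<in> W \<Longrightarrow> \<bar>H w x\<bar> \<le> 1"
      "\<And>w. w \<in> W \<Longrightarrow> represents (H w) w"
      using W(2) by metis
    interpret represented_mean \<mu> \<beta> C S \<Lambda> H
      by (intro represented_mean.intro bounded_vector_density_axioms \<Lambda>(1) represented_mean_axioms.intro)
        (auto simp: S_def W(1) H)
    obtain K where K: "compact K" "\<And>T \<eta>. finite_rank T \<Longrightarrow> 0 \<le> \<eta> \<Longrightarrow> (\<And>x. x \<in> K \<Longrightarrow> norm (blinfun_apply T x - x) \<le> \<eta>) \<Longrightarrow>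
      \<Lambda> (\<lambda>s. blinfun_apply (fst s) (blinfun_apply T (snd s))) \<le> 1 + 3 * \<eta>"
      by (rule compact_set_controls_mean) blast
    \<comment> \<open>Closeness on \<open>Q\<close> puts \<open>T\<close> into \<open>A\<close>,
      while closeness on \<open>K\<close>, with its factor 3, gives
      \<open>1 + 3 * (\<epsilon> / 4)\<close>, which is below \<open>1 + \<epsilon>\<close>.\<close>
    obtain T :: "'x \<Rightarrow>\<^sub>L 'x" where T: "finite_rank T" "\<And>x. x \<in> K \<union> Q \<Longrightarrow> norm (blinfun_apply T x - x) \<le> \<epsilon> / 4"
      using AP[of "K \<union> Q" "\<epsilon> / 4"] K(1) Q e by auto
    have "norm (blinfun_apply T x - x) \<le> \<epsilon>" if "x \<in> Q" for x
      using T(2)[of x] that e by auto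
    then have "T \<in> A" using T(1) by (simp add: A_def)
    then have "1 + \<epsilon> \<le> \<Lambda> (F T)" using \<Lambda>(2) by blast
    also have "\<dots> \<le> 1 + 3 * (\<epsilon> / 4)"
      unfolding F_def using e T by (intro K(2)) auto
    finally show False using e by simp
  qed
  then obtain T where T: "T \<in> A" "\<And>w. w \<in> W \<Longrightarrow> norm (blinfun_apply T w) \<le> 1 + \<epsilon>" by auto
  show thesis
    by (rule that[of T]) (use T in \<open>auto simp: A_def\<close>)
qed

subsection \<open>The space \<open>L\<^sup>1(m)\<close> in terms of scalar densities\<close>

locale controlled_vector_measure =
  fixes M \<mu> :: "'a measure" and m :: "'a set \<Rightarrow> 'x::banach"
  assumes vm: "vector_measure M m" and fin: "finite_measure \<mu>" and equiv: "equivalent_measure M \<mu> m"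
begin

lemma sets_eq: "sets \<mu> = sets M" and space_eq: "space \<mu> = space M"
  using equiv by (auto simp: equivalent_measure_def dest: sets_eq_imp_space_eq)

lemma meas_iff: "f \<in> borel_measurable \<mu> \<longleftrightarrow> f \<in> borel_measurable M"
  using measurable_cong_sets[OF sets_eq refl] by auto

lemma null_sets_zero:
  assumes A: "A \<in> sets M" "emeasure \<mu> A = 0"
  shows "m A = 0"
proof -
  have "norm (m A) \<le> 0"
  proof (rule norm_le_functional)
    fix \<phi> :: "'x \<Rightarrow>\<^sub>L real" assume \<phi>: "norm \<phi> \<le> 1"
    have "ennreal \<bar>scalar_measure m \<phi> A\<bar> \<le> emeasure (variation_measure M (scalar_measure m \<phi>)) A"
      by (rule abs_le_variation_measure[OF vector_measure_scalar_measure[OF vm] A(1)])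
    also have "\<dots> \<le> semivariation M m A"
      unfolding semivariation_def using \<phi> by (intro SUP_upper) auto
    also have "\<dots> = 0" using equiv A by (simp add: equivalent_measure_def)
    finally show "blinfun_apply \<phi> (m A) \<le> 0" by (simp add: scalar_measure_def)
  qed
  then show ?thesis by simp
qed

text \<open>The same choice of derivative as in \<open>RN_functional\<close>, so no comparison of
  different versions almost everywhere arises.\<close>

definition rn :: "('x \<Rightarrow>\<^sub>L real) \<Rightarrow> 'a \<Rightarrow> real" where
  "rn \<phi> = signed_RN_deriv \<mu> (scalar_measure m \<phi>)"

lemma rn_integrable: "integrable \<mu> (rn \<phi>)"
  and rn_eq: "A \<in> sets M \<Longrightarrow> scalar_measure m \<phi> A = set_lebesgue_integral \<mu> A (rn \<phi>)"
proof -
  obtain b where "integrable \<mu> b" "\<And>A. A \<in> sets M \<Longrightarrow> scalar_measure m \<phi> A = set_lebesgue_integral \<mu> A b"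
    using signed_density[OF vector_measure_scalar_measure[OF vm] fin sets_eq, of \<phi>] null_sets_zero
    by (auto simp: scalar_measure_def)
  then have "\<exists>h. integrable \<mu> h \<and> (\<forall>A\<in>sets \<mu>. scalar_measure m \<phi> A = set_lebesgue_integral \<mu> A h)"
    unfolding sets_eq by blast
  then have "integrable \<mu> (rn \<phi>) \<and> (\<forall>A\<in>sets \<mu>. scalar_measure m \<phi> A = set_lebesgue_integral \<mu> A (rn \<phi>))"
    unfolding rn_def signed_RN_deriv_def by (rule someI_ex)
  then show "integrable \<mu> (rn \<phi>)" "A \<in> sets M \<Longrightarrow> scalar_measure m \<phi> A = set_lebesgue_integral \<mu> A (rn \<phi>)"
    by (auto simp: sets_eq)
qed

lemma vm_L1D:
  assumes f: "f \<in> vm_L1 M m"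
  shows "f \<in> borel_measurable M" "integrable \<mu> (\<lambda>x. f x * rn \<phi> x)"
    "A \<in> sets M \<Longrightarrow> \<exists>y. \<forall>\<phi>. blinfun_apply \<phi> y = (\<integral>x. indicator A x * (f x * rn \<phi> x) \<partial>\<mu>)"
proof -
  show fm: "f \<in> borel_measurable M" using f by (simp add: vm_L1_def)
  show int: "integrable \<mu> (\<lambda>x. f x * rn \<phi> x)" for \<phi>
    using f integrable_variation_measure[OF sets_eq rn_integrable rn_eq fm] by (simp add: vm_L1_def)
  assume A: "A \<in> sets M"
  then obtain y where "is_vm_integral M m A f y" using f by (auto simp: vm_L1_def)
  then show "\<exists>y. \<forall>\<phi>. blinfun_apply \<phi> y = (\<integral>x. indicator A x * (f x * rn \<phi> x) \<partial>\<mu>)"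
    using signed_integral_density[OF sets_eq rn_integrable rn_eq fm int A]
    by (auto simp: is_vm_integral_def)
qed

lemma nn_integral_variation_rn:
  assumes "f \<in> borel_measurable M"
  shows "(\<integral>\<^sup>+x. ennreal \<bar>f x\<bar> \<partial>variation_measure M (scalar_measure m \<phi>)) = (\<integral>\<^sup>+x. ennreal \<bar>f x * rn \<phi> x\<bar> \<partial>\<mu>)"
  by (rule nn_integral_variation_measure[OF sets_eq rn_integrable rn_eq assms])

lemma L1_norm_rn:
  assumes "f \<in> borel_measurable M"
  shows "L1_norm M m f = (SUP \<phi>\<in>{\<phi>. norm \<phi> \<le> 1}. \<integral>\<^sup>+x. ennreal \<bar>f x * rn \<phi> x\<bar> \<partial>\<mu>)"
  unfolding L1_norm_def nn_integral_variation_rn[OF assms] ..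

lemma integral_le_L1_norm:
  assumes f: "f \<in> vm_L1 M m" and \<phi>: "norm \<phi> \<le> 1"
  shows "ennreal (\<integral>x. \<bar>f x * rn \<phi> x\<bar> \<partial>\<mu>) \<le> L1_norm M m f"
proof -
  have "ennreal (\<integral>x. \<bar>f x * rn \<phi> x\<bar> \<partial>\<mu>) = (\<integral>\<^sup>+x. ennreal \<bar>f x * rn \<phi> x\<bar> \<partial>\<mu>)"
    using vm_L1D(2)[OF f] by (intro nn_integral_eq_integral[symmetric]) auto
  also have "\<dots> \<le> L1_norm M m f"
    unfolding L1_norm_rn[OF vm_L1D(1)[OF f]] using \<phi> by (intro SUP_upper) auto
  finally show ?thesis .
qed

definition sign_on :: "'a set \<Rightarrow> 'a \<Rightarrow> real" where
  "sign_on A x = (if x \<in> A then 1 else - 1)"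

lemma sign_on_measurable: "A \<in> sets M \<Longrightarrow> sign_on A \<in> borel_measurable M"
proof -
  have "sign_on A = (\<lambda>x. 2 * indicator A x - 1)" by (auto simp: sign_on_def split: split_indicator)
  then show "A \<in> sets M \<Longrightarrow> sign_on A \<in> borel_measurable M" by simp
qed

lemma integrable_sign_on:
  assumes "integrable \<mu> b" "A \<in> sets M"
  shows "integrable \<mu> (\<lambda>x. sign_on A x * b x)"
  using assms by (intro integrable_bounded_times[where B = 1]) (auto simp: meas_iff sign_on_measurable, simp add: sign_on_def)

lemma exists_sign_integral:
  assumes f: "f \<in> vm_L1 M m" and A: "A \<in> sets M" and B: "B \<in> sets M"
  shows "\<exists>w. \<forall>\<phi>. blinfun_apply \<phi> w = (\<integral>x. sign_on A x * (indicator B x * (f x * rn \<phi> x)) \<partial>\<mu>)"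
proof -
  obtain y where y: "\<And>\<phi>. blinfun_apply \<phi> y = (\<integral>x. indicator (B \<inter> A) x * (f x * rn \<phi> x) \<partial>\<mu>)"
    using vm_L1D(3)[OF f, of "B \<inter> A"] A B by auto
  obtain z where z: "\<And>\<phi>. blinfun_apply \<phi> z = (\<integral>x. indicator (B - A) x * (f x * rn \<phi> x) \<partial>\<mu>)"
    using vm_L1D(3)[OF f, of "B - A"] A B by auto
  have "blinfun_apply \<phi> (y - z) = (\<integral>x. sign_on A x * (indicator B x * (f x * rn \<phi> x)) \<partial>\<mu>)" for \<phi>
  proof -
    have "blinfun_apply \<phi> (y - z) = (\<integral>x. indicator (B \<inter> A) x * (f x * rn \<phi> x) - indicator (B - A) x * (f x * rn \<phi> x) \<partial>\<mu>)"
      using A B vm_L1D(2)[OF f] unfolding blinfun.diff_right y z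
      by (intro Bochner_Integration.integral_diff[symmetric] integrable_indicator_times) (auto simp: sets_eq)
    also have "\<dots> = (\<integral>x. sign_on A x * (indicator B x * (f x * rn \<phi> x)) \<partial>\<mu>)"
      by (intro Bochner_Integration.integral_cong) (auto simp: sign_on_def split: split_indicator)
    finally show ?thesis .
  qed
  then show ?thesis by blast
qed

text \<open>The integral of \<open>f\<close> multiplied by \<open>1\<close> on \<open>A\<close> and
  \<open>-1\<close> off \<open>A\<close>. Signs rather than indicators are used because they turn a
  scalar integral into the integral of its modulus.\<close>

definition sign_integral :: "('a \<Rightarrow> real) \<Rightarrow> 'a set \<Rightarrow> 'x" where
  "sign_integral f A = (SOME w. \<forall>\<phi>. blinfun_apply \<phi> w = (\<integral>x. sign_on A x * (f x * rn \<phi> x) \<partial>\<mu>))"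

lemma sign_integral:
  assumes f: "f \<in> vm_L1 M m" and A: "A \<in> sets M"
  shows "blinfun_apply \<phi> (sign_integral f A) = (\<integral>x. sign_on A x * (f x * rn \<phi> x) \<partial>\<mu>)"
proof -
  have "(\<integral>x. sign_on A x * (indicator (space M) x * (f x * rn \<phi> x)) \<partial>\<mu>) = (\<integral>x. sign_on A x * (f x * rn \<phi> x) \<partial>\<mu>)" for \<phi>
    by (intro Bochner_Integration.integral_cong) (auto simp: space_eq)
  then have "\<exists>w. \<forall>\<phi>. blinfun_apply \<phi> w = (\<integral>x. sign_on A x * (f x * rn \<phi> x) \<partial>\<mu>)"
    using exists_sign_integral[OF f A sets.top] by simp
  then have "\<forall>\<phi>. blinfun_apply \<phi> (sign_integral f A) = (\<integral>x. sign_on A x * (f x * rn \<phi> x) \<partial>\<mu>)"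
    unfolding sign_integral_def by (rule someI_ex)
  then show ?thesis by blast
qed

lemma norm_sign_integral:
  assumes f: "f \<in> vm_L1 M m" and A: "A \<in> sets M" and r: "L1_norm M m f \<le> ennreal r" "0 \<le> r"
  shows "norm (sign_integral f A) \<le> r"
proof (rule norm_le_functional)
  fix \<phi> :: "'x \<Rightarrow>\<^sub>L real" assume \<phi>: "norm \<phi> \<le> 1"
  have "blinfun_apply \<phi> (sign_integral f A) \<le> (\<integral>x. \<bar>f x * rn \<phi> x\<bar> \<partial>\<mu>)"
    unfolding sign_integral[OF f A] using vm_L1D(2)[OF f, of \<phi>] A
    by (intro integral_mono integrable_sign_on) (auto simp: sign_on_def)
  also have "\<dots> \<le> r"
    using order_trans[OF integral_le_L1_norm[OF f \<phi>] r(1)] r(2) by (simp add: ennreal_le_iff)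
  finally show "blinfun_apply \<phi> (sign_integral f A) \<le> r" .
qed

subsection \<open>Finite rank operators composed with the measure\<close>

context
  fixes n :: nat and a :: "nat \<Rightarrow> 'x \<Rightarrow>\<^sub>L real" and y :: "nat \<Rightarrow> 'x" and T :: "'x \<Rightarrow>\<^sub>L 'x"
  assumes T: "\<And>v. blinfun_apply T v = (\<Sum>i<n. blinfun_apply (a i) v *\<^sub>R y i)"
begin

definition rank_op :: "('a \<Rightarrow> real) \<Rightarrow> 'x" where
  "rank_op f = (\<Sum>i<n. RN_functional \<mu> m (a i) f *\<^sub>R y i)"

lemma finite_rank_RN_rank_op: "finite_rank_RN_operator M \<mu> m rank_op"
  unfolding finite_rank_RN_operator_def rank_op_def by blast

text \<open>The density of \<open>\<psi>\<close> applied to the measure \<open>T\<close> composed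
  with \<open>m\<close>; finite rank makes it a finite sum of the densities of
  \<open>m\<close>.\<close>

definition comb :: "('x \<Rightarrow>\<^sub>L real) \<Rightarrow> 'a \<Rightarrow> real" where
  "comb \<psi> x = (\<Sum>i<n. blinfun_apply \<psi> (y i) * rn (a i) x)"

lemma comb_integrable: "integrable \<mu> (comb \<psi>)"
  unfolding comb_def[abs_def] using rn_integrable by auto

lemma scalar_associated_measure:
  assumes A: "A \<in> sets M"
  shows "scalar_measure (associated_measure rank_op) \<psi> A = set_lebesgue_integral \<mu> A (comb \<psi>)"
proof -
  have "set_lebesgue_integral \<mu> A (comb \<psi>) = (\<integral>x. (\<Sum>i<n. blinfun_apply \<psi> (y i) * (indicator A x * rn (a i) x)) \<partial>\<mu>)"
    unfolding set_lebesgue_integral_def comb_def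
    by (intro Bochner_Integration.integral_cong) (auto simp: sum_distrib_left algebra_simps)
  also have "\<dots> = (\<Sum>i<n. blinfun_apply \<psi> (y i) * (\<integral>x. indicator A x * rn (a i) x \<partial>\<mu>))"
    using A rn_integrable by (subst Bochner_Integration.integral_sum) (auto simp: sets_eq intro: integrable_indicator_times)
  finally show ?thesis
    by (simp add: scalar_measure_def associated_measure_def rank_op_def RN_functional_def rn_def
        blinfun.sum_right blinfun.scaleR_right mult.commute)
qed

lemma nn_integral_variation_comb:
  assumes "f \<in> borel_measurable M"
  shows "(\<integral>\<^sup>+x. ennreal \<bar>f x\<bar> \<partial>variation_measure M (scalar_measure (associated_measure rank_op) \<psi>))
    = (\<integral>\<^sup>+x. ennreal \<bar>f x * comb \<psi> x\<bar> \<partial>\<mu>)"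
  by (rule nn_integral_variation_measure[OF sets_eq comb_integrable scalar_associated_measure assms])

lemma L1_norm_associated:
  assumes "f \<in> borel_measurable M"
  shows "L1_norm M (associated_measure rank_op) f = (SUP \<psi>\<in>{\<psi>. norm \<psi> \<le> 1}. \<integral>\<^sup>+x. ennreal \<bar>f x * comb \<psi> x\<bar> \<partial>\<mu>)"
  unfolding L1_norm_def nn_integral_variation_comb[OF assms] ..

lemma comb_integral:
  assumes f: "f \<in> vm_L1 M m" and A: "A \<in> sets M"
  shows "integrable \<mu> (\<lambda>x. f x * comb \<psi> x)"
    "blinfun_apply \<psi> (blinfun_apply T (sign_integral f A)) = (\<integral>x. sign_on A x * (f x * comb \<psi> x) \<partial>\<mu>)"
proof -
  have eq: "f x * comb \<psi> x = (\<Sum>i<n. blinfun_apply \<psi> (y i) * (f x * rn (a i) x))" for x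
    by (simp add: comb_def sum_distrib_left algebra_simps)
  show "integrable \<mu> (\<lambda>x. f x * comb \<psi> x)"
    unfolding eq using vm_L1D(2)[OF f] by auto
  have "(\<integral>x. sign_on A x * (f x * comb \<psi> x) \<partial>\<mu>) = (\<integral>x. (\<Sum>i<n. blinfun_apply \<psi> (y i) * (sign_on A x * (f x * rn (a i) x))) \<partial>\<mu>)"
    unfolding eq by (simp add: sum_distrib_left algebra_simps)
  also have "\<dots> = (\<Sum>i<n. blinfun_apply \<psi> (y i) * (\<integral>x. sign_on A x * (f x * rn (a i) x) \<partial>\<mu>))"
    using integrable_sign_on[OF vm_L1D(2)[OF f] A] by (subst Bochner_Integration.integral_sum) auto
  finally show "blinfun_apply \<psi> (blinfun_apply T (sign_integral f A)) = (\<integral>x. sign_on A x * (f x * comb \<psi> x) \<partial>\<mu>)"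
    by (simp add: T sign_integral[OF f A] blinfun.sum_right blinfun.scaleR_right mult.commute)
qed

text \<open>For each \<open>\<psi>\<close> the sign of \<open>f * comb \<psi>\<close> determines an
  \<open>A\<close> for which the integral of the modulus equals
  \<open>\<psi> (T (sign_integral f A))\<close>.\<close>

lemma L1_norm_associated_le:
  assumes f: "f \<in> vm_L1 M m" and r: "\<And>A. A \<in> sets M \<Longrightarrow> norm (blinfun_apply T (sign_integral f A)) \<le> r"
  shows "L1_norm M (associated_measure rank_op) f \<le> ennreal r"
  unfolding L1_norm_associated[OF vm_L1D(1)[OF f]]
proof (rule SUP_least, clarify)
  fix \<psi> :: "'x \<Rightarrow>\<^sub>L real" assume \<psi>: "norm \<psi> \<le> 1"
  define A where "A = {x \<in> space M. 0 \<le> f x * comb \<psi> x}"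
  have "comb \<psi> \<in> borel_measurable M" using comb_integrable[of \<psi>] by (simp add: meas_iff[symmetric])
  then have A: "A \<in> sets M" unfolding A_def using vm_L1D(1)[OF f] by measurable
  have "(\<integral>\<^sup>+x. ennreal \<bar>f x * comb \<psi> x\<bar> \<partial>\<mu>) = ennreal (\<integral>x. \<bar>f x * comb \<psi> x\<bar> \<partial>\<mu>)"
    using comb_integral(1)[OF f A] by (intro nn_integral_eq_integral) auto
  also have "(\<integral>x. \<bar>f x * comb \<psi> x\<bar> \<partial>\<mu>) = (\<integral>x. sign_on A x * (f x * comb \<psi> x) \<partial>\<mu>)"
    by (intro Bochner_Integration.integral_cong) (auto simp: sign_on_def A_def space_eq)
  also have "\<dots> = blinfun_apply \<psi> (blinfun_apply T (sign_integral f A))"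
    by (rule comb_integral(2)[OF f A, symmetric])
  also have "\<dots> \<le> norm \<psi> * norm (blinfun_apply T (sign_integral f A))"
    using norm_blinfun[of \<psi> "blinfun_apply T (sign_integral f A)"] by simp
  also have "\<dots> \<le> 1 * r" using \<psi> r[OF A] by (intro mult_mono) auto
  finally show "(\<integral>\<^sup>+x. ennreal \<bar>f x * comb \<psi> x\<bar> \<partial>\<mu>) \<le> ennreal r" by (simp add: ennreal_leI)
qed

lemma L1_norm_associated_ge:
  assumes f: "f \<in> vm_L1 M m" and A: "A \<in> sets M" and \<psi>: "norm \<psi> \<le> 1"
  shows "ennreal (blinfun_apply \<psi> (blinfun_apply T (sign_integral f A))) \<le> L1_norm M (associated_measure rank_op) f"
proof -
  have "blinfun_apply \<psi> (blinfun_apply T (sign_integral f A)) \<le> (\<integral>x. \<bar>f x * comb \<psi> x\<bar> \<partial>\<mu>)"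
    unfolding comb_integral(2)[OF f A] using comb_integral(1)[OF f A, of \<psi>] A
    by (intro integral_mono integrable_sign_on) (auto simp: sign_on_def)
  then have "ennreal (blinfun_apply \<psi> (blinfun_apply T (sign_integral f A))) \<le> ennreal (\<integral>x. \<bar>f x * comb \<psi> x\<bar> \<partial>\<mu>)"
    by (rule ennreal_leI)
  also have "\<dots> = (\<integral>\<^sup>+x. ennreal \<bar>f x * comb \<psi> x\<bar> \<partial>\<mu>)"
    using comb_integral(1)[OF f A] by (intro nn_integral_eq_integral[symmetric]) auto
  also have "\<dots> \<le> L1_norm M (associated_measure rank_op) f"
    unfolding L1_norm_associated[OF vm_L1D(1)[OF f]] using \<psi> by (intro SUP_upper) auto
  finally show ?thesis .
qed

end

section \<open>Approximation of the norms of finitely many functions\<close>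

text \<open>The supremum defining the norm is approached by some \<open>\<phi>\<close>, and the sign
  of \<open>f * rn \<phi>\<close> turns its integral into a value of \<open>\<phi>\<close> at one
  vector. The norm is thus visible at a single point, to which an operator can be kept
  close.\<close>

lemma exists_almost_norming:
  assumes f: "f \<in> vm_L1 M m" and e: "0 < e"
  shows "\<exists>\<phi> A. norm \<phi> \<le> 1 \<and> A \<in> sets M \<and>
    min (L1_norm M m f) (ennreal (1 / e)) \<le> ennreal (blinfun_apply \<phi> (sign_integral f A)) + ennreal (e / 2)"
proof -
  let ?l = "min (L1_norm M m f) (ennreal (1 / e))"
  have "\<exists>\<phi>::'x \<Rightarrow>\<^sub>L real. norm \<phi> \<le> 1 \<and> ?l \<le> (\<integral>\<^sup>+x. ennreal \<bar>f x * rn \<phi> x\<bar> \<partial>\<mu>) + ennreal (e / 2)"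
  proof (rule ccontr)
    assume "\<not> ?thesis"
    then have le: "(\<integral>\<^sup>+x. ennreal \<bar>f x * rn \<phi> x\<bar> \<partial>\<mu>) + ennreal (e / 2) \<le> ?l" if "norm \<phi> \<le> 1" for \<phi> :: "'x \<Rightarrow>\<^sub>L real"
      using that by (meson linorder_not_le less_imp_le)
    have ne: "{\<phi> :: 'x \<Rightarrow>\<^sub>L real. norm \<phi> \<le> 1} \<noteq> {}" by (auto intro: exI[of _ 0])
    have "L1_norm M m f + ennreal (e / 2) = (SUP \<phi>\<in>{\<phi>. norm \<phi> \<le> 1}. (\<integral>\<^sup>+x. ennreal \<bar>f x * rn \<phi> x\<bar> \<partial>\<mu>) + ennreal (e / 2))"
      unfolding L1_norm_rn[OF vm_L1D(1)[OF f]] by (rule ennreal_SUP_add_left[OF ne, symmetric])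
    also have "\<dots> \<le> ?l" using le by (intro SUP_least) auto
    finally have l: "L1_norm M m f + ennreal (e / 2) \<le> ?l" .
    \<comment> \<open>The truncation at \<open>1 / e\<close> shows that the norm is finite, after
      which the surplus \<open>e / 2\<close> is contradictory.\<close>
    then have "L1_norm M m f + ennreal (e / 2) \<le> ennreal (1 / e)" by simp
    then have "L1_norm M m f + ennreal (e / 2) < top" using order_le_less_trans ennreal_less_top by blast
    then obtain r where r: "L1_norm M m f = ennreal r" "0 \<le> r" by (cases "L1_norm M m f") auto
    have "ennreal r + ennreal (e / 2) \<le> ennreal r" using l r by simp
    then have "r + e / 2 \<le> r" using r e by (simp add: ennreal_plus[symmetric] ennreal_le_iff del: ennreal_plus)
    then show False using e by simp
  qed
  then obtain \<phi> :: "'x \<Rightarrow>\<^sub>L real" where \<phi>: "norm \<phi> \<le> 1" "?l \<le> (\<integral>\<^sup>+x. ennreal \<bar>f x * rn \<phi> x\<bar> \<partial>\<mu>) + ennreal (e / 2)"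
    by blast
  define A where "A = {x \<in> space M. 0 \<le> f x * rn \<phi> x}"
  have "rn \<phi> \<in> borel_measurable M" using rn_integrable[of \<phi>] by (simp add: meas_iff[symmetric])
  then have A: "A \<in> sets M" unfolding A_def using vm_L1D(1)[OF f] by measurable
  have "(\<integral>\<^sup>+x. ennreal \<bar>f x * rn \<phi> x\<bar> \<partial>\<mu>) = ennreal (\<integral>x. \<bar>f x * rn \<phi> x\<bar> \<partial>\<mu>)"
    using vm_L1D(2)[OF f] by (intro nn_integral_eq_integral) auto
  also have "(\<integral>x. \<bar>f x * rn \<phi> x\<bar> \<partial>\<mu>) = (\<integral>x. sign_on A x * (f x * rn \<phi> x) \<partial>\<mu>)"
    by (intro Bochner_Integration.integral_cong) (auto simp: sign_on_def A_def space_eq)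
  also have "\<dots> = blinfun_apply \<phi> (sign_integral f A)" by (rule sign_integral[OF f A, symmetric])
  finally show ?thesis using \<phi> A by auto
qed

text \<open>The sum of the \<open>\<bar>f\<bar> / l f\<close> dominates every normalized
  \<open>f\<close>, so one vector measure represents all the needed vectors by bounded functions.
  Its weak integrals come from those of \<open>f\<close> by splitting at the sign of
  \<open>f\<close>, and each summand adds at most 1 to the total bound.\<close>

lemma bounded_vector_density_sum:
  assumes F: "finite F" "F \<subseteq> vm_L1 M m" and pos: "\<And>f. f \<in> F \<Longrightarrow> 0 < l f"
    and le: "\<And>f. f \<in> F \<Longrightarrow> L1_norm M m f \<le> ennreal (l f)"
  shows "bounded_vector_density \<mu> (\<lambda>\<phi> x. (\<Sum>f\<in>F. \<bar>f x\<bar> / l f) * rn \<phi> x) (real (card F))"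
proof -
  have expand: "(\<Sum>f\<in>F. \<bar>f x\<bar> / l f) * rn \<phi> x = (\<Sum>f\<in>F. (1 / l f) * (sign_on {x \<in> space M. 0 \<le> f x} x * (f x * rn \<phi> x)))"
    if "x \<in> space M" for x \<phi>
    unfolding sum_distrib_right using that by (intro sum.cong) (auto simp: sign_on_def)
  have P: "{x \<in> space M. 0 \<le> f x} \<in> sets M" if "f \<in> F" for f
  proof -
    have "f \<in> borel_measurable M" using that F vm_L1D(1) by blast
    then show ?thesis by measurable
  qed
  have int1: "integrable \<mu> (\<lambda>x. (1 / l f) * (sign_on {x \<in> space M. 0 \<le> f x} x * (f x * rn \<phi> x)))" if "f \<in> F" for f \<phi>
    using that F by (intro integrable_mult_right integrable_sign_on vm_L1D(2) P) auto
  have int: "integrable \<mu> (\<lambda>x. (\<Sum>f\<in>F. \<bar>f x\<bar> / l f) * rn \<phi> x)" for \<phi>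
  proof -
    have "integrable \<mu> (\<lambda>x. \<Sum>f\<in>F. (1 / l f) * (sign_on {x \<in> space M. 0 \<le> f x} x * (f x * rn \<phi> x)))"
      by (intro Bochner_Integration.integrable_sum int1)
    then show ?thesis
      by (subst Bochner_Integration.integrable_cong[OF refl expand]) (auto simp: space_eq)
  qed
  have ex: "\<exists>z. \<forall>\<phi>. blinfun_apply \<phi> z = (\<integral>x. indicator A x * ((\<Sum>f\<in>F. \<bar>f x\<bar> / l f) * rn \<phi> x) \<partial>\<mu>)"
    if A: "A \<in> sets M" for A
  proof -
    have "\<forall>f\<in>F. \<exists>w. \<forall>\<phi>. blinfun_apply \<phi> w = (\<integral>x. sign_on {x \<in> space M. 0 \<le> f x} x * (indicator A x * (f x * rn \<phi> x)) \<partial>\<mu>)"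
    proof
      fix f assume f: "f \<in> F"
      then have "f \<in> vm_L1 M m" using F by auto
      from exists_sign_integral[OF this P[OF f] A]
      show "\<exists>w. \<forall>\<phi>. blinfun_apply \<phi> w = (\<integral>x. sign_on {x \<in> space M. 0 \<le> f x} x * (indicator A x * (f x * rn \<phi> x)) \<partial>\<mu>)" .
    qed
    from bchoice[OF this] obtain w where w: "\<forall>f\<in>F. \<forall>\<phi>.
        blinfun_apply \<phi> (w f) = (\<integral>x. sign_on {x \<in> space M. 0 \<le> f x} x * (indicator A x * (f x * rn \<phi> x)) \<partial>\<mu>)" ..
    have "blinfun_apply \<phi> (\<Sum>f\<in>F. (1 / l f) *\<^sub>R w f) = (\<integral>x. indicator A x * ((\<Sum>f\<in>F. \<bar>f x\<bar> / l f) * rn \<phi> x) \<partial>\<mu>)" for \<phi>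
    proof -
      have "(\<integral>x. indicator A x * ((\<Sum>f\<in>F. \<bar>f x\<bar> / l f) * rn \<phi> x) \<partial>\<mu>)
        = (\<integral>x. (\<Sum>f\<in>F. (1 / l f) * (sign_on {x \<in> space M. 0 \<le> f x} x * (indicator A x * (f x * rn \<phi> x)))) \<partial>\<mu>)"
      proof (intro Bochner_Integration.integral_cong refl)
        fix x assume "x \<in> space \<mu>"
        then have "indicator A x * ((\<Sum>f\<in>F. \<bar>f x\<bar> / l f) * rn \<phi> x) =
          indicator A x * (\<Sum>f\<in>F. (1 / l f) * (sign_on {x \<in> space M. 0 \<le> f x} x * (f x * rn \<phi> x)))"
          by (simp only: expand space_eq)
        then show "indicator A x * ((\<Sum>f\<in>F. \<bar>f x\<bar> / l f) * rn \<phi> x) =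
          (\<Sum>f\<in>F. (1 / l f) * (sign_on {x \<in> space M. 0 \<le> f x} x * (indicator A x * (f x * rn \<phi> x))))"
          unfolding sum_distrib_left by (simp add: mult.left_commute)
      qed
      also have "\<dots> = (\<Sum>f\<in>F. (1 / l f) * blinfun_apply \<phi> (w f))"
      proof (subst Bochner_Integration.integral_sum)
        fix f assume f: "f \<in> F"
        then show "integrable \<mu> (\<lambda>x. (1 / l f) * (sign_on {x \<in> space M. 0 \<le> f x} x * (indicator A x * (f x * rn \<phi> x))))"
          using F A by (intro integrable_mult_right integrable_sign_on integrable_indicator_times vm_L1D(2) P) (auto simp: sets_eq)
      qed (simp add: w)
      finally show ?thesis by (simp add: blinfun.sum_right blinfun.scaleR_right)
    qed
    then show ?thesis by blast
  qed
  have bound: "(\<integral>x. \<bar>(\<Sum>f\<in>F. \<bar>f x\<bar> / l f) * rn \<phi> x\<bar> \<partial>\<mu>) \<le> real (card F)" if \<phi>: "norm \<phi> \<le> 1" for \<phi>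
  proof -
    have "(\<integral>x. \<bar>(\<Sum>f\<in>F. \<bar>f x\<bar> / l f) * rn \<phi> x\<bar> \<partial>\<mu>) = (\<integral>x. (\<Sum>f\<in>F. (1 / l f) * \<bar>f x * rn \<phi> x\<bar>) \<partial>\<mu>)"
    proof (intro Bochner_Integration.integral_cong refl)
      fix x
      have "0 \<le> (\<Sum>f\<in>F. \<bar>f x\<bar> / l f)" using pos by (intro sum_nonneg) (simp add: less_imp_le)
      then show "\<bar>(\<Sum>f\<in>F. \<bar>f x\<bar> / l f) * rn \<phi> x\<bar> = (\<Sum>f\<in>F. (1 / l f) * \<bar>f x * rn \<phi> x\<bar>)"
        unfolding abs_mult by (simp add: abs_of_nonneg sum_distrib_right)
    qed
    also have "\<dots> = (\<Sum>f\<in>F. (1 / l f) * (\<integral>x. \<bar>f x * rn \<phi> x\<bar> \<partial>\<mu>))"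
      using F vm_L1D(2) by (subst Bochner_Integration.integral_sum) auto
    also have "\<dots> \<le> (\<Sum>f\<in>F. 1)"
    proof (rule sum_mono)
      fix f assume f: "f \<in> F"
      then have fL: "f \<in> vm_L1 M m" using F by auto
      have "(\<integral>x. \<bar>f x * rn \<phi> x\<bar> \<partial>\<mu>) \<le> l f"
        using order_trans[OF integral_le_L1_norm[OF fL \<phi>] le[OF f]] pos[OF f] by (simp add: ennreal_le_iff)
      then show "(1 / l f) * (\<integral>x. \<bar>f x * rn \<phi> x\<bar> \<partial>\<mu>) \<le> 1" using pos[OF f] by (simp add: field_simps)
    qed
    finally show ?thesis by simp
  qed
  show ?thesis
    using fin int ex bound
    by (intro bounded_vector_density.intro vector_density.intro vector_density_axioms.intro bounded_vector_density_axioms.intro)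
      (auto simp: sets_eq)
qed

end

context controlled_vector_measure
begin

lemma finite_stage_operator:
  assumes ap: "approximation_property TYPE('x)" and F: "finite F" "F \<subseteq> vm_L1 M m" and Q: "finite Q" and e: "0 < e"
  obtains T :: "'x \<Rightarrow>\<^sub>L 'x" where "finite_rank T" "\<And>x. x \<in> Q \<Longrightarrow> norm (blinfun_apply T x - x) \<le> e"
    "\<And>f r A. f \<in> F \<Longrightarrow> L1_norm M m f = ennreal r \<Longrightarrow> 0 \<le> r \<Longrightarrow> A \<in> sets M \<Longrightarrow>
      norm (blinfun_apply T (sign_integral f A)) \<le> (1 + e) * r"
proof -
  \<comment> \<open>Norms \<open>0\<close> and \<open>\<infinity>\<close> cannot be normalized. For
    norm \<open>0\<close> all vectors \<open>sign_integral f A\<close> vanish, and for norm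
    \<open>\<infinity>\<close> nothing is claimed.\<close>
  define F' where "F' = {f \<in> F. 0 < L1_norm M m f \<and> L1_norm M m f < top}"
  define l where "l f = enn2real (L1_norm M m f)" for f
  have F': "finite F'" "F' \<subseteq> vm_L1 M m" using F by (auto simp: F'_def)
  have l: "0 < l f" "L1_norm M m f = ennreal (l f)" if "f \<in> F'" for f
    using that by (auto simp: F'_def l_def enn2real_positive_iff less_top)
  define g where "g x = (\<Sum>f\<in>F'. \<bar>f x\<bar> / l f)" for x
  interpret D: bounded_vector_density \<mu> "\<lambda>\<phi> x. (\<Sum>f\<in>F'. \<bar>f x\<bar> / l f) * rn \<phi> x" "real (card F')"
    using l by (intro bounded_vector_density_sum F') auto
  define W where "W = {(1 / l f) *\<^sub>R sign_integral f A | f A. f \<in> F' \<and> A \<in> sets M}"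
  have W1: "norm w \<le> 1" if "w \<in> W" for w
  proof -
    obtain f A where w: "w = (1 / l f) *\<^sub>R sign_integral f A" "f \<in> F'" "A \<in> sets M" using \<open>w \<in> W\<close> by (auto simp: W_def)
    have "norm (sign_integral f A) \<le> l f"
      using w F' l[OF w(2)] by (intro norm_sign_integral) auto
    then show ?thesis using l[OF w(2)] w(1) by (simp add: field_simps)
  qed
  have W2: "\<exists>h\<in>borel_measurable \<mu>. (\<forall>x. \<bar>h x\<bar> \<le> 1) \<and> D.represents h w" if "w \<in> W" for w
  proof -
    obtain f A where w: "w = (1 / l f) *\<^sub>R sign_integral f A" "f \<in> F'" "A \<in> sets M" using \<open>w \<in> W\<close> by (auto simp: W_def)
    have fL: "f \<in> vm_L1 M m" using w F' by auto
    \<comment> \<open>Where \<open>g\<close> vanishes so does \<open>f\<close>, and the quotient is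
      \<open>0\<close> by convention.\<close>
    define h where "h x = sign_on A x * (f x / l f) / g x" for x
    have fg: "\<bar>f x\<bar> / l f \<le> g x" for x
      unfolding g_def using w(2) F'(1) l(1) by (intro member_le_sum) (auto simp: less_imp_le)
    have g_nonneg: "0 \<le> g x" for x
      unfolding g_def using l(1) by (intro sum_nonneg) (simp add: less_imp_le)
    have "f' \<in> borel_measurable M" if "f' \<in> F'" for f' using that F' vm_L1D(1) by blast
    then have "g \<in> borel_measurable M" unfolding g_def[abs_def] by (intro borel_measurable_sum) simp
    then have h_meas: "h \<in> borel_measurable \<mu>"
      unfolding meas_iff h_def[abs_def] using sign_on_measurable[OF w(3)] vm_L1D(1)[OF fL] by simp
    have h_le: "\<bar>h x\<bar> \<le> 1" for x
    proof -
      have "\<bar>h x\<bar> = (\<bar>f x\<bar> / l f) / g x"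
        using l(1)[OF w(2)] g_nonneg[of x] by (simp add: h_def sign_on_def abs_mult)
      also have "\<dots> \<le> g x / g x" by (rule divide_right_mono[OF fg g_nonneg])
      also have "\<dots> \<le> 1" by simp
      finally show ?thesis .
    qed
    have hg: "h x * g x = sign_on A x * (f x / l f)" for x
    proof (cases "g x = 0")
      case True
      then have "\<bar>f x\<bar> / l f \<le> 0" using fg[of x] by simp
      then have "f x = 0" using l(1)[OF w(2)] by (simp add: divide_le_0_iff)
      then show ?thesis using True by simp
    qed (simp add: h_def)
    have "D.represents h w"
      unfolding D.represents_def
    proof
      fix \<phi> :: "'x \<Rightarrow>\<^sub>L real"
      have "blinfun_apply \<phi> w = (\<integral>x. (1 / l f) * (sign_on A x * (f x * rn \<phi> x)) \<partial>\<mu>)"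
        by (simp add: w(1) blinfun.scaleR_right sign_integral[OF fL w(3)])
      also have "\<dots> = (\<integral>x. h x * ((\<Sum>f\<in>F'. \<bar>f x\<bar> / l f) * rn \<phi> x) \<partial>\<mu>)"
      proof (intro Bochner_Integration.integral_cong refl)
        fix x
        have "h x * ((\<Sum>f\<in>F'. \<bar>f x\<bar> / l f) * rn \<phi> x) = (h x * g x) * rn \<phi> x" by (simp add: g_def)
        then show "(1 / l f) * (sign_on A x * (f x * rn \<phi> x)) = h x * ((\<Sum>f\<in>F'. \<bar>f x\<bar> / l f) * rn \<phi> x)"
          by (simp add: hg)
      qed
      finally show "blinfun_apply \<phi> w = (\<integral>x. h x * ((\<Sum>f\<in>F'. \<bar>f x\<bar> / l f) * rn \<phi> x) \<partial>\<mu>)" .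
    qed
    then show ?thesis using h_meas h_le by blast
  qed
  show thesis
  proof (rule D.finite_rank_approximation[OF ap e finite_imp_compact[OF Q] W1 W2])
    fix T :: "'x \<Rightarrow>\<^sub>L 'x"
    assume T: "finite_rank T" "\<And>x. x \<in> Q \<Longrightarrow> norm (blinfun_apply T x - x) \<le> e"
      "\<And>w. w \<in> W \<Longrightarrow> norm (blinfun_apply T w) \<le> 1 + e"
    show thesis
    proof (rule that[OF T(1,2)])
      fix f r A assume f: "f \<in> F" "L1_norm M m f = ennreal r" "0 \<le> r" and A: "A \<in> sets M"
      show "norm (blinfun_apply T (sign_integral f A)) \<le> (1 + e) * r"
      proof (cases "r = 0")
        case True
        then have "norm (sign_integral f A) \<le> 0" using f F A by (intro norm_sign_integral) auto
        then show ?thesis using True by simp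
      next
        case False
        then have f': "f \<in> F'" "l f = r" using f by (auto simp: F'_def l_def)
        then have "(1 / r) *\<^sub>R sign_integral f A \<in> W" using A unfolding W_def by blast
        then have "norm (blinfun_apply T ((1 / r) *\<^sub>R sign_integral f A)) \<le> 1 + e" by (rule T(3))
        then show ?thesis using f(3) False by (simp add: blinfun.scaleR_right field_simps)
      qed
    qed
  qed
qed

text \<open>The minimum covers the case that the norm, a supremum in \<open>[0, \<infinity>]\<close>, is infinite.\<close>

theorem finite_stage:
  assumes ap: "approximation_property TYPE('x)" and F: "finite F" "F \<subseteq> vm_L1 M m" and e: "0 < e"
  shows "\<exists>R. finite_rank_RN_operator M \<mu> m R \<and> (\<forall>f\<in>F.
    L1_norm M (associated_measure R) f \<le> ennreal (1 + e) * L1_norm M m f \<and>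
    min (L1_norm M m f) (ennreal (1 / e)) \<le> L1_norm M (associated_measure R) f + ennreal e)"
proof -
  have "\<forall>f\<in>F. \<exists>p. norm (fst p) \<le> 1 \<and> snd p \<in> sets M \<and>
    min (L1_norm M m f) (ennreal (1 / e)) \<le> ennreal (blinfun_apply (fst p) (sign_integral f (snd p))) + ennreal (e / 2)"
    using F exists_almost_norming[OF _ e] by fastforce
  from bchoice[OF this] obtain p where p: "\<forall>f\<in>F. norm (fst (p f)) \<le> 1 \<and> snd (p f) \<in> sets M \<and>
    min (L1_norm M m f) (ennreal (1 / e)) \<le> ennreal (blinfun_apply (fst (p f)) (sign_integral f (snd (p f)))) + ennreal (e / 2)" ..
  define w where "w f = sign_integral f (snd (p f))" for f
  \<comment> \<open>Half of the error is spent on the almost norming pair, the other half on the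
    distance of \<open>T\<close> from the identity at \<open>w f\<close>.\<close>
  have e2: "0 < e / 2" using e by simp
  obtain T :: "'x \<Rightarrow>\<^sub>L 'x" where T: "finite_rank T" "\<And>x. x \<in> w ` F \<Longrightarrow> norm (blinfun_apply T x - x) \<le> e / 2"
    "\<And>f r A. f \<in> F \<Longrightarrow> L1_norm M m f = ennreal r \<Longrightarrow> 0 \<le> r \<Longrightarrow> A \<in> sets M \<Longrightarrow>
      norm (blinfun_apply T (sign_integral f A)) \<le> (1 + e / 2) * r"
    by (rule finite_stage_operator[OF ap F finite_imageI[OF F(1), of w] e2]) blast
  obtain n :: nat and a :: "nat \<Rightarrow> 'x \<Rightarrow>\<^sub>L real" and y :: "nat \<Rightarrow> 'x"
    where ay: "\<And>v. blinfun_apply T v = (\<Sum>i<n. blinfun_apply (a i) v *\<^sub>R y i)"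
    using T(1) finite_rank_blinfun_representation[of _ T] unfolding finite_rank_def by metis
  show ?thesis
  proof (intro exI conjI ballI)
    show "finite_rank_RN_operator M \<mu> m (rank_op n a y)" by (rule finite_rank_RN_rank_op[OF ay])
    fix f assume f: "f \<in> F"
    then have fL: "f \<in> vm_L1 M m" using F by auto
    show "L1_norm M (associated_measure (rank_op n a y)) f \<le> ennreal (1 + e) * L1_norm M m f"
    proof (cases "L1_norm M m f")
      case (real r)
      have "L1_norm M (associated_measure (rank_op n a y)) f \<le> ennreal ((1 + e / 2) * r)"
        using T(3)[OF f real(2,1)] by (intro L1_norm_associated_le[OF ay fL]) auto
      also have "\<dots> \<le> ennreal ((1 + e) * r)" using e real by (intro ennreal_leI mult_right_mono) auto
      finally show ?thesis using real e by (simp add: ennreal_mult)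
    next
      case top
      then show ?thesis using e by (simp add: ennreal_mult_top)
    qed
    have pf: "norm (fst (p f)) \<le> 1" "snd (p f) \<in> sets M" using p f by auto
    have "\<bar>blinfun_apply (fst (p f)) (blinfun_apply T (w f) - w f)\<bar> \<le> norm (fst (p f)) * norm (blinfun_apply T (w f) - w f)"
      using norm_blinfun[of "fst (p f)" "blinfun_apply T (w f) - w f"] by simp
    also have "\<dots> \<le> 1 * (e / 2)" using pf T(2)[of "w f"] f by (intro mult_mono) auto
    finally have "blinfun_apply (fst (p f)) (w f) \<le> blinfun_apply (fst (p f)) (blinfun_apply T (w f)) + e / 2"
      unfolding blinfun.diff_right by linarith
    then have "ennreal (blinfun_apply (fst (p f)) (w f)) \<le> ennreal (blinfun_apply (fst (p f)) (blinfun_apply T (w f)) + e / 2)"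
      by (rule ennreal_leI)
    \<comment> \<open>The case distinction is due to \<open>ennreal\<close> sending negative reals
      to \<open>0\<close>.\<close>
    also have "\<dots> \<le> ennreal (blinfun_apply (fst (p f)) (blinfun_apply T (w f))) + ennreal (e / 2)"
      using e by (cases "0 \<le> blinfun_apply (fst (p f)) (blinfun_apply T (w f))")
        (auto simp: ennreal_plus ennreal_neg intro: ennreal_leI)
    also have "ennreal (blinfun_apply (fst (p f)) (blinfun_apply T (w f))) \<le> L1_norm M (associated_measure (rank_op n a y)) f"
      unfolding w_def by (rule L1_norm_associated_ge[OF ay fL pf(2,1)])
    finally have "ennreal (blinfun_apply (fst (p f)) (w f)) \<le> L1_norm M (associated_measure (rank_op n a y)) f + ennreal (e / 2)"
      by (simp add: add_right_mono)
    then have "ennreal (blinfun_apply (fst (p f)) (w f)) + ennreal (e / 2)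
        \<le> L1_norm M (associated_measure (rank_op n a y)) f + ennreal (e / 2) + ennreal (e / 2)"
      by (rule add_right_mono)
    also have "\<dots> = L1_norm M (associated_measure (rank_op n a y)) f + ennreal e"
      using e by (simp add: add.assoc ennreal_plus[symmetric] del: ennreal_plus)
    finally show "min (L1_norm M m f) (ennreal (1 / e)) \<le> L1_norm M (associated_measure (rank_op n a y)) f + ennreal e"
      using p f unfolding w_def by (meson order_trans)
  qed
qed

end

section \<open>Convergence in \<open>[0, \<infinity>]\<close> and the assembly of the net\<close>

lemma ennreal_between_real:
  fixes a b :: ennreal
  assumes "a < b"
  obtains r where "0 \<le> r" "a < ennreal r" "ennreal r < b"
proof -
  obtain c where c: "a < c" "c < b" using dense[OF assms] by blast
  then have "c < top" by (simp add: less_top[symmetric] order_less_imp_triv) (metis top.extremum_strict)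
  then show thesis using that c by (cases c) auto
qed

text \<open>A multiplicative upper and a truncated additive lower estimate are both meaningful for
  \<open>L = \<infinity>\<close>, where the upper one is void and the truncation level
  \<open>1 / d i\<close> tends to infinity.\<close>

lemma ennreal_net_tendsto:
  fixes g :: "'i \<Rightarrow> ennreal" and d :: "'i \<Rightarrow> real"
  assumes small: "\<And>e. 0 < e \<Longrightarrow> eventually (\<lambda>i. 0 < d i \<and> d i \<le> e) \<F>"
    and upper: "eventually (\<lambda>i. g i \<le> ennreal (1 + d i) * L) \<F>"
    and lower: "eventually (\<lambda>i. min L (ennreal (1 / d i)) \<le> g i + ennreal (d i)) \<F>"
  shows "(g \<longlongrightarrow> L) \<F>"
proof (rule order_tendstoI)
  fix c assume "c < L"
  then obtain r where r: "0 \<le> r" "c < ennreal r" "ennreal r < L" by (rule ennreal_between_real)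
  obtain q where q: "0 \<le> q" "c < ennreal q" "ennreal q < ennreal r" by (rule ennreal_between_real[OF r(2)])
  then have qr: "q < r" by (simp add: ennreal_less_iff)
  \<comment> \<open>The first term makes the additive error at most the gap \<open>r - q\<close>;
    the second lifts the truncation level above \<open>r\<close>.\<close>
  define e where "e = min (r - q) (1 / (r + 1))"
  have e: "0 < e" using qr r by (simp add: e_def add_nonneg_pos)
  show "eventually (\<lambda>i. c < g i) \<F>"
    using small[OF e] lower
  proof eventually_elim
    case (elim i)
    have "r \<le> 1 / (1 / (r + 1))" using r by simp
    also have "\<dots> \<le> 1 / d i" using elim(1) r by (intro divide_left_mono) (auto simp: e_def)
    finally have "ennreal r \<le> ennreal (1 / d i)" by (rule ennreal_leI)
    then have "ennreal r \<le> g i + ennreal (d i)" using elim(2) r(3) by (meson less_imp_le min.boundedI order_trans)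
    also have "\<dots> \<le> g i + ennreal (r - q)" using elim(1) by (intro add_left_mono ennreal_leI) (auto simp: e_def)
    finally have "ennreal r - ennreal (r - q) \<le> g i" by (simp add: ennreal_minus_le_iff add.commute)
    moreover have "ennreal r - ennreal (r - q) = ennreal q" using qr by (simp add: ennreal_minus)
    ultimately show "c < g i" using q(2) by simp
  qed
next
  fix c assume "L < c"
  then obtain r where r: "0 \<le> r" "L < ennreal r" "ennreal r < c" by (rule ennreal_between_real)
  then obtain q where q: "0 \<le> q" "L = ennreal q" by (cases L) auto
  have qr: "q < r" using r q by (simp add: ennreal_less_iff)
  \<comment> \<open>Chosen so that \<open>(1 + e) * q \<le> r\<close>; adding 1 covers
    \<open>q = 0\<close>.\<close>
  define e where "e = (r - q) / (q + 1)"
  have e: "0 < e" using qr q by (simp add: e_def)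
  show "eventually (\<lambda>i. g i < c) \<F>"
    using small[OF e] upper
  proof eventually_elim
    case (elim i)
    have "d i * q \<le> e * q" using elim(1) q by (intro mult_right_mono) auto
    also have "\<dots> \<le> r - q" using qr q by (simp add: e_def field_simps)
    finally have "(1 + d i) * q \<le> r" by (simp add: algebra_simps)
    moreover have "ennreal (1 + d i) * L = ennreal ((1 + d i) * q)" using elim(1) q by (simp add: ennreal_mult)
    ultimately have "g i \<le> ennreal r" using elim(2) by (metis ennreal_leI order_trans)
    then show "g i < c" using r(3) by (rule order_le_less_trans)
  qed
qed

theorem corollary3p8:
  fixes M \<mu> :: "'a measure" and m :: "'a set \<Rightarrow> 'x::banach"
  assumes "approximation_property TYPE('x)"
    and "vector_measure M m"
    and "weakly_compact_integration_map M m"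
    and "finite_measure \<mu>"
    and "equivalent_measure M \<mu> m"
  shows "\<exists>(I :: (('a \<Rightarrow> real) set \<times> real) set) le (R :: ('a \<Rightarrow> real) set \<times> real \<Rightarrow> ('a \<Rightarrow> real) \<Rightarrow> 'x).
    directed_set I le \<and>
    (\<forall>\<alpha>\<in>I. finite_rank_RN_operator M \<mu> m (R \<alpha>)) \<and>
    (\<forall>f\<in>vm_L1 M m.
       ((\<lambda>\<alpha>. L1_norm M (associated_measure (R \<alpha>)) f) \<longlongrightarrow> L1_norm M m f) (net_filter I le))"
proof -
  interpret controlled_vector_measure M \<mu> m
    using assms by (intro controlled_vector_measure.intro)
  define I where "I = {F. finite F \<and> F \<subseteq> vm_L1 M m} \<times> {e :: real. 0 < e}"
  define le where "le p q \<longleftrightarrow> fst p \<subseteq> fst q \<and> snd q \<le> snd p" for p q :: "('a \<Rightarrow> real) set \<times> real"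
  define good where "good p R \<longleftrightarrow> finite_rank_RN_operator M \<mu> m R \<and> (\<forall>f\<in>fst p.
    L1_norm M (associated_measure R) f \<le> ennreal (1 + snd p) * L1_norm M m f \<and>
    min (L1_norm M m f) (ennreal (1 / snd p)) \<le> L1_norm M (associated_measure R) f + ennreal (snd p))"
    for p :: "('a \<Rightarrow> real) set \<times> real" and R :: "('a \<Rightarrow> real) \<Rightarrow> 'x"
  have "\<forall>p\<in>I. \<exists>R. good p R"
    using finite_stage[OF assms(1)] unfolding good_def by (auto simp: I_def)
  from bchoice[OF this] obtain R where R: "\<forall>p\<in>I. good p (R p)" ..
  have dir: "directed_set I le"
    unfolding directed_set_def
  proof (intro conjI ballI impI)
    show "I \<noteq> {}" by (auto simp: I_def intro: exI[of _ 1])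
    show "le i i" for i by (simp add: le_def)
    show "le i k" if "le i j" "le j k" for i j k using that by (auto simp: le_def)
    fix i j assume "i \<in> I" "j \<in> I"
    then show "\<exists>k\<in>I. le i k \<and> le j k"
      by (intro bexI[of _ "(fst i \<union> fst j, min (snd i) (snd j))"]) (auto simp: I_def le_def)
  qed
  have "((\<lambda>\<alpha>. L1_norm M (associated_measure (R \<alpha>)) f) \<longlongrightarrow> L1_norm M m f) (net_filter I le)"
    if f: "f \<in> vm_L1 M m" for f
  proof -
    have ev: "eventually (\<lambda>\<alpha>. \<alpha> \<in> I \<and> f \<in> fst \<alpha> \<and> snd \<alpha> \<le> e) (net_filter I le)" if "0 < e" for e
      unfolding eventually_net_filter[OF dir]
      using f that by (intro bexI[of _ "({f}, e)"]) (auto simp: I_def le_def)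
    have ev1: "eventually (\<lambda>\<alpha>. \<alpha> \<in> I \<and> f \<in> fst \<alpha>) (net_filter I le)"
      using ev[of 1] by (rule eventually_mono) auto
    show ?thesis
    proof (rule ennreal_net_tendsto[where d = snd])
      show "eventually (\<lambda>\<alpha>. 0 < snd \<alpha> \<and> snd \<alpha> \<le> e) (net_filter I le)" if "0 < e" for e
        using ev[OF that] by (rule eventually_mono) (auto simp: I_def)
      show "eventually (\<lambda>\<alpha>. L1_norm M (associated_measure (R \<alpha>)) f \<le> ennreal (1 + snd \<alpha>) * L1_norm M m f) (net_filter I le)"
        using ev1 R by (auto simp: good_def elim!: eventually_mono)
      show "eventually (\<lambda>\<alpha>. min (L1_norm M m f) (ennreal (1 / snd \<alpha>))
          \<le> L1_norm M (associated_measure (R \<alpha>)) f + ennreal (snd \<alpha>)) (net_filter I le)"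
        using ev1 R by (auto simp: good_def elim!: eventually_mono)
    qed
  qed
  then show ?thesis
    using dir R unfolding good_def by (intro exI[of _ I] exI[of _ le] exI[of _ R]) auto
qed

end
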